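(* Consider the uncapacitated min-cost flow primal-dual pair $\min\{c^Tx : Ax=b,\ x\ge 0\}=\max\{b^Ty : A^Ty+s=c,\ s\ge 0\}$ on a connected directed graph $G=(V,A)$ with $n$ nodes and $m$ arcs, with $c\in\mathbb{Z}^m$, $b\in\mathbb{Z}^n$, $\mathbf{1}^Tb=0$, and assume the problem is feasible and finite. Let $x$ be a feasible primal solution and $(y^0,s^0)$ a feasible dual solution with $x^Ts^0<1$. If the Crossover procedure described below is initialized with $x$ and $y^0,s^0$, then it outputs optimal integral potentials $y$ (i.e. an integral optimal dual solution, with $s=c-A^Ty\ge 0$), and it can be implemented to run in $O(m+n\log n)$ time.
   Context: $A\in\{-1,0,1\}^{n\times m}$ is the node-arc incidence matrix: the column of arc $(v,w)$ has $-1$ in row $v$, $+1$ in row $w$, zeros elsewhere; so the dual slack of arc $a=(v,w)$ is $s_a=c_a+y_v-y_w$. For $S\subseteq V$, $b(S)=\sum_{v\in S}b_v$, $\delta^{\mathrm{out}}(S)$ is the set of arcs leaving $S$ and $\delta^{\mathrm{in}}(S)$ the set of arcs entering $S$. Crossover procedure: pick an arbitrary node $s$, set $y_s:=0$ and $S^1:=\{s\}$. For $k=1,\dots,n-1$: if $b(S^k)<0$ or $\delta^{\mathrm{in}}(S^k)=\emptyset$, choose an arc $(v,w)\in\delta^{\mathrm{out}}(S^k)$ ($v\in S^k$, $w\notin S^k$) minimizing $c_{(v,w)}+y_v-y^0_w$ and set $y_w:=c_{(v,w)}+y_v$; otherwise choose an arc $(w,v)\in\delta^{\mathrm{in}}(S^k)$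 ($w\notin S^k$, $v\in S^k$) minimizing $c_{(w,v)}+y^0_w-y_v$ and set $y_w:=y_v-c_{(w,v)}$. In either case set $S^{k+1}:=S^k\cup\{w\}$. Return $y$. (Here $y_v$ for $v\in S^k$ denotes the already assigned new potential.) *)

theory Defs
  imports Complex_Main "Graph_Theory.Digraph_Component"
begin

section \<open>Uncapacitated minimum-cost flow\<close>

text \<open>Arcs carry their own identity, so parallel arcs are allowed; loops are excluded in
  \<open>mcf_problem\<close> below, where the incidence matrix would not be meaningful.\<close>

definition incidence :: "('v, 'a) pre_digraph \<Rightarrow> 'v \<Rightarrow> 'a \<Rightarrow> real" where
  "incidence G v a = (if v = tail G a then -1 else if v = head G a then 1 else 0)"

definition primal_feasible ::
  "('v, 'a) pre_digraph \<Rightarrow> ('v \<Rightarrow> int) \<Rightarrow> ('a \<Rightarrow> real) \<Rightarrow> bool" where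
  "primal_feasible G b x \<longleftrightarrow>
     (\<forall>v\<in>verts G. (\<Sum>a\<in>arcs G. incidence G v a * x a) = real_of_int (b v)) \<and>
     (\<forall>a\<in>arcs G. 0 \<le> x a)"

definition primal_objective :: "('v, 'a) pre_digraph \<Rightarrow> ('a \<Rightarrow> int) \<Rightarrow> ('a \<Rightarrow> real) \<Rightarrow> real" where
  "primal_objective G c x = (\<Sum>a\<in>arcs G. real_of_int (c a) * x a)"

definition dual_feasible ::
  "('v, 'a) pre_digraph \<Rightarrow> ('a \<Rightarrow> int) \<Rightarrow> ('v \<Rightarrow> real) \<Rightarrow> ('a \<Rightarrow> real) \<Rightarrow> bool" where
  "dual_feasible G c y s \<longleftrightarrow>
     (\<forall>a\<in>arcs G. (\<Sum>v\<in>verts G. incidence G v a * y v) + s a = real_of_int (c a)) \<and>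
     (\<forall>a\<in>arcs G. 0 \<le> s a)"

definition dual_objective :: "('v, 'a) pre_digraph \<Rightarrow> ('v \<Rightarrow> int) \<Rightarrow> ('v \<Rightarrow> real) \<Rightarrow> real" where
  "dual_objective G b y = (\<Sum>v\<in>verts G. real_of_int (b v) * y v)"

definition dual_optimal ::
  "('v, 'a) pre_digraph \<Rightarrow> ('a \<Rightarrow> int) \<Rightarrow> ('v \<Rightarrow> int) \<Rightarrow> ('v \<Rightarrow> real) \<Rightarrow> ('a \<Rightarrow> real) \<Rightarrow> bool" where
  "dual_optimal G c b y s \<longleftrightarrow>
     dual_feasible G c y s \<and>
     (\<forall>y' s'. dual_feasible G c y' s' \<longrightarrow> dual_objective G b y' \<le> dual_objective G b y)"

definition dual_slack ::
  "('v, 'a) pre_digraph \<Rightarrow> ('a \<Rightarrow> int) \<Rightarrow> ('v \<Rightarrow> real) \<Rightarrow> 'a \<Rightarrow> real" where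
  "dual_slack G c y a = real_of_int (c a) - (\<Sum>v\<in>verts G. incidence G v a * y v)"

text \<open>\<^const>\<open>Digraph_Component.connected\<close> is connectedness of the underlying undirected graph
  and includes that there is at least one node.\<close>

definition mcf_problem ::
  "('v, 'a) pre_digraph \<Rightarrow> ('a \<Rightarrow> int) \<Rightarrow> ('v \<Rightarrow> int) \<Rightarrow> bool" where
  "mcf_problem G c b \<longleftrightarrow>
     fin_digraph G \<and> loopfree_digraph G \<and> Digraph_Component.connected G \<and>
     (\<Sum>v\<in>verts G. b v) = 0 \<and>
     (\<exists>x. primal_feasible G b x) \<and>
     bdd_below (primal_objective G c ` {x. primal_feasible G b x})"

definition crossover_input ::
  "('v, 'a) pre_digraph \<Rightarrow> ('a \<Rightarrow> int) \<Rightarrow> ('v \<Rightarrow> int) \<Rightarrow>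
     ('a \<Rightarrow> real) \<Rightarrow> ('v \<Rightarrow> real) \<Rightarrow> ('a \<Rightarrow> real) \<Rightarrow> bool" where
  "crossover_input G c b x y0 s0 \<longleftrightarrow>
     mcf_problem G c b \<and> primal_feasible G b x \<and> dual_feasible G c y0 s0 \<and>
     (\<Sum>a\<in>arcs G. x a * s0 a) < 1"


section \<open>The crossover procedure\<close>

definition out_cut :: "('v, 'a) pre_digraph \<Rightarrow> 'v set \<Rightarrow> 'a set" where
  "out_cut G S = {a \<in> arcs G. tail G a \<in> S \<and> head G a \<notin> S}"

definition in_cut :: "('v, 'a) pre_digraph \<Rightarrow> 'v set \<Rightarrow> 'a set" where
  "in_cut G S = {a \<in> arcs G. tail G a \<notin> S \<and> head G a \<in> S}"

text \<open>One iteration of the loop on pairs \<open>(S, y)\<close>. Ties between minimizing arcs are broken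
  arbitrarily, so this is a relation.\<close>

inductive crossover_step ::
  "('v, 'a) pre_digraph \<Rightarrow> ('a \<Rightarrow> int) \<Rightarrow> ('v \<Rightarrow> int) \<Rightarrow> ('v \<Rightarrow> real) \<Rightarrow>
     'v set \<times> ('v \<Rightarrow> real) \<Rightarrow> 'v set \<times> ('v \<Rightarrow> real) \<Rightarrow> bool"
  for G :: "('v, 'a) pre_digraph" and c :: "'a \<Rightarrow> int" and b :: "'v \<Rightarrow> int" and y0 :: "'v \<Rightarrow> real"
where
  out_step:
    "\<lbrakk> (\<Sum>v\<in>S. b v) < 0 \<or> in_cut G S = {};
       a \<in> out_cut G S;
       \<forall>a'\<in>out_cut G S. real_of_int (c a) + y (tail G a) - y0 (head G a)
                        \<le> real_of_int (c a') + y (tail G a') - y0 (head G a') \<rbrakk>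
     \<Longrightarrow> crossover_step G c b y0 (S, y)
           (insert (head G a) S, y(head G a := real_of_int (c a) + y (tail G a)))"
| in_step:
    "\<lbrakk> \<not> ((\<Sum>v\<in>S. b v) < 0 \<or> in_cut G S = {});
       a \<in> in_cut G S;
       \<forall>a'\<in>in_cut G S. real_of_int (c a) + y0 (tail G a) - y (head G a)
                       \<le> real_of_int (c a') + y0 (tail G a') - y (head G a') \<rbrakk>
     \<Longrightarrow> crossover_step G c b y0 (S, y)
           (insert (tail G a) S, y(tail G a := y (head G a) - real_of_int (c a)))"

text \<open>Values of \<open>y\<close> outside \<open>S\<close> are never read by a step, so initializing them with 0 is
  immaterial.\<close>

definition crossover_reachable ::
  "('v, 'a) pre_digraph \<Rightarrow> ('a \<Rightarrow> int) \<Rightarrow> ('v \<Rightarrow> int) \<Rightarrow> ('v \<Rightarrow> real) \<Rightarrow> 'v \<Rightarrow> nat \<Rightarrow>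
     'v set \<times> ('v \<Rightarrow> real) \<Rightarrow> bool" where
  "crossover_reachable G c b y0 r k \<sigma> \<longleftrightarrow>
     (crossover_step G c b y0 ^^ k) ({r}, \<lambda>_. 0) \<sigma>"

definition crossover_output ::
  "('v, 'a) pre_digraph \<Rightarrow> ('a \<Rightarrow> int) \<Rightarrow> ('v \<Rightarrow> int) \<Rightarrow> ('v \<Rightarrow> real) \<Rightarrow> 'v \<Rightarrow>
     ('v \<Rightarrow> real) \<Rightarrow> bool" where
  "crossover_output G c b y0 r y \<longleftrightarrow>
     (\<exists>S. crossover_reachable G c b y0 r (card (verts G) - 1) (S, y))"


section \<open>A random access machine with real numbers\<close>

text \<open>
  Running times refer to a uniform-cost random access machine in the comparison-addition model,
  presented as a structured language. A program works on natural-number variables and on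
  indirectly addressable arrays of natural numbers and of reals. Every constant, variable access,
  array access, arithmetic operation (addition and subtraction), comparison, Boolean connective,
  assignment and branch costs one unit. There is neither multiplication nor rounding, and 0 is the
  only real constant. A fixed program mentions finitely many names, so the arrays can be interleaved
  into one memory with constant overhead.
\<close>

datatype nexp =
    NConst nat
  | NVar string
  | NArr string nexp
  | NPlus nexp nexp
  | NMinus nexp nexp

datatype rexp =
    RZero
  | RArr string nexp
  | RPlus rexp rexp
  | RMinus rexp rexp

datatype bexp =
    NLess nexp nexp
  | RLess rexp rexp
  | BNot bexp
  | BAnd bexp bexp

datatype com =
    Skip
  | NAssign string nexp
  | NArrAssign string nexp nexp
  | RArrAssign string nexp rexp
  | Seq com com
  | If bexp com com
  | While bexp com

record store =
  nvar :: "string \<Rightarrow> nat"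
  narr :: "string \<Rightarrow> nat \<Rightarrow> nat"
  rarr :: "string \<Rightarrow> nat \<Rightarrow> real"

fun nval :: "nexp \<Rightarrow> store \<Rightarrow> nat" where
  "nval (NConst k) \<sigma> = k"
| "nval (NVar z) \<sigma> = nvar \<sigma> z"
| "nval (NArr z e) \<sigma> = narr \<sigma> z (nval e \<sigma>)"
| "nval (NPlus e f) \<sigma> = nval e \<sigma> + nval f \<sigma>"
| "nval (NMinus e f) \<sigma> = nval e \<sigma> - nval f \<sigma>"

fun rval :: "rexp \<Rightarrow> store \<Rightarrow> real" where
  "rval RZero \<sigma> = 0"
| "rval (RArr z e) \<sigma> = rarr \<sigma> z (nval e \<sigma>)"
| "rval (RPlus e f) \<sigma> = rval e \<sigma> + rval f \<sigma>"
| "rval (RMinus e f) \<sigma> = rval e \<sigma> - rval f \<sigma>"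

fun bval :: "bexp \<Rightarrow> store \<Rightarrow> bool" where
  "bval (NLess e f) \<sigma> \<longleftrightarrow> nval e \<sigma> < nval f \<sigma>"
| "bval (RLess e f) \<sigma> \<longleftrightarrow> rval e \<sigma> < rval f \<sigma>"
| "bval (BNot p) \<sigma> \<longleftrightarrow> \<not> bval p \<sigma>"
| "bval (BAnd p q) \<sigma> \<longleftrightarrow> bval p \<sigma> \<and> bval q \<sigma>"

fun ncost :: "nexp \<Rightarrow> nat" where
  "ncost (NConst k) = 1"
| "ncost (NVar z) = 1"
| "ncost (NArr z e) = 1 + ncost e"
| "ncost (NPlus e f) = 1 + ncost e + ncost f"
| "ncost (NMinus e f) = 1 + ncost e + ncost f"

fun rcost :: "rexp \<Rightarrow> nat" where
  "rcost RZero = 1"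
| "rcost (RArr z e) = 1 + ncost e"
| "rcost (RPlus e f) = 1 + rcost e + rcost f"
| "rcost (RMinus e f) = 1 + rcost e + rcost f"

fun bcost :: "bexp \<Rightarrow> nat" where
  "bcost (NLess e f) = 1 + ncost e + ncost f"
| "bcost (RLess e f) = 1 + rcost e + rcost f"
| "bcost (BNot p) = 1 + bcost p"
| "bcost (BAnd p q) = 1 + bcost p + bcost q"

text \<open>\<open>runs P \<sigma> t \<sigma>'\<close>: program \<open>P\<close> started in \<open>\<sigma>\<close> terminates in \<open>\<sigma>'\<close> at total cost \<open>t\<close>.\<close>

inductive runs :: "com \<Rightarrow> store \<Rightarrow> nat \<Rightarrow> store \<Rightarrow> bool" where
  Skip: "runs Skip \<sigma> 1 \<sigma>"
| NAssign: "runs (NAssign z e) \<sigma> (1 + ncost e) (\<sigma>\<lparr>nvar := (nvar \<sigma>)(z := nval e \<sigma>)\<rparr>)"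
| NArrAssign:
    "runs (NArrAssign z i e) \<sigma> (1 + ncost i + ncost e)
       (\<sigma>\<lparr>narr := (narr \<sigma>)(z := (narr \<sigma> z)(nval i \<sigma> := nval e \<sigma>))\<rparr>)"
| RArrAssign:
    "runs (RArrAssign z i e) \<sigma> (1 + ncost i + rcost e)
       (\<sigma>\<lparr>rarr := (rarr \<sigma>)(z := (rarr \<sigma> z)(nval i \<sigma> := rval e \<sigma>))\<rparr>)"
| Seq: "\<lbrakk> runs P \<sigma> t \<sigma>'; runs Q \<sigma>' u \<sigma>'' \<rbrakk> \<Longrightarrow> runs (Seq P Q) \<sigma> (t + u) \<sigma>''"
| IfTrue: "\<lbrakk> bval p \<sigma>; runs P \<sigma> t \<sigma>' \<rbrakk> \<Longrightarrow> runs (If p P Q) \<sigma> (1 + bcost p + t) \<sigma>'"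
| IfFalse: "\<lbrakk> \<not> bval p \<sigma>; runs Q \<sigma> t \<sigma>' \<rbrakk> \<Longrightarrow> runs (If p P Q) \<sigma> (1 + bcost p + t) \<sigma>'"
| WhileFalse: "\<not> bval p \<sigma> \<Longrightarrow> runs (While p P) \<sigma> (1 + bcost p) \<sigma>"
| WhileTrue:
    "\<lbrakk> bval p \<sigma>; runs P \<sigma> t \<sigma>'; runs (While p P) \<sigma>' u \<sigma>'' \<rbrakk>
     \<Longrightarrow> runs (While p P) \<sigma> (1 + bcost p + t + u) \<sigma>''"

text \<open>
  Input encoding: the nodes are \<open>0, \<dots>, n - 1\<close>, the arcs are \<open>0, \<dots>, m - 1\<close>, and the graph is given
  as an unordered arc list. All memory that does not hold input is 0.
\<close>

definition input_array :: "nat \<Rightarrow> (nat \<Rightarrow> 'b::zero) \<Rightarrow> nat \<Rightarrow> 'b" where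
  "input_array k f i = (if i < k then f i else 0)"

definition input_store ::
  "nat \<Rightarrow> nat \<Rightarrow> (nat, nat) pre_digraph \<Rightarrow> (nat \<Rightarrow> int) \<Rightarrow> (nat \<Rightarrow> int) \<Rightarrow>
     (nat \<Rightarrow> real) \<Rightarrow> (nat \<Rightarrow> real) \<Rightarrow> (nat \<Rightarrow> real) \<Rightarrow> nat \<Rightarrow> store" where
  "input_store n m G c b x y0 s0 r =
     \<lparr> nvar = (\<lambda>_. 0)(''n'' := n, ''m'' := m, ''r'' := r),
       narr = (\<lambda>_ _. 0)(''tail'' := input_array m (tail G), ''head'' := input_array m (head G)),
       rarr = (\<lambda>_ _. 0)(''c'' := input_array m (\<lambda>a. real_of_int (c a)),
                        ''b'' := input_array n (\<lambda>v. real_of_int (b v)),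
                        ''x'' := input_array m x,
                        ''y0'' := input_array n y0,
                        ''s0'' := input_array m s0) \<rparr>"

end

theory Submission
  imports Defs
begin

text \<open>
  Let \<open>b(S)\<close> be the net demand of the current set \<open>S\<close>. Extend the potentials assigned so far by
  \<open>y0 + D\<close> outside \<open>S\<close>, with \<open>D\<close> chosen such that the last arc taken is tight. Each step moves \<open>D\<close> in
  the direction in which the dual objective does not decrease until an arc of the cut becomes tight,
  so this extension stays feasible and never gets worse than \<open>y0\<close>; at the end it is integral.
  By integrality, a duality gap below 1 leaves no room for a better dual solution.

  The running time is that of Dijkstra's algorithm with Fibonacci heaps. There are two heaps, one
  for each direction of the cut; an element whose node has meanwhile entered \<open>S\<close> through the other
  heap stays in place and is skipped when it is extracted. The cost of the heap operations
  is amortized against the number of roots and of marked elements. The logarithmic degree bound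
  comes from counting: an element with at least \<open>k + 3\<close> children has two children with at least \<open>k\<close>
  children, so the number of elements with at least \<open>k + 3\<close> children is at most half the number of
  those with at least \<open>k\<close> children.
\<close>

section \<open>Optimality of the crossover procedure\<close>

text \<open>Moving \<open>D\<close> shifts all nodes outside \<open>S\<close> alike. The keys
  \<open>c a + y v - y0 w\<close> and \<open>c a + y0 w - y v\<close> of the two heaps do not
  involve \<open>D\<close>, so they stay valid when \<open>S\<close> grows. This is why Dijkstra's
  data structure applies although \<open>D\<close> moves up as well as down. The obstacle is the
  test for an empty in-cut, since the in-heap may still hold elements whose node has entered
  \<open>S\<close>. The program tests the heap instead of the cut. A wrong answer is harmless: if
  the cut is empty, all elements left in the in-heap are stale, and extracting one merely discards
  it. A visited element is never inserted again, so each of the \<open>2 * n\<close> elements is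
  extracted at most once. Without multiplication and records, the forest is kept in one array with a
  row of slots per node, the row starts being found by repeated addition. The rows span
  quadratically many addresses, but memory is 0 at the start and only cells that are accessed cost
  time.\<close>

locale mcf = fin_digraph G + loopfree_digraph G
  for G :: "('v, 'a) pre_digraph" and c :: "'a \<Rightarrow> int" and b :: "'v \<Rightarrow> int" and x :: "'a \<Rightarrow> real" +
  assumes conn: "Digraph_Component.connected G"
    and balanced: "(\<Sum>v\<in>verts G. b v) = 0"
    and primal: "primal_feasible G b x"
begin

section \<open>Potentials, cuts and the flow across them\<close>

definition feasible_potential :: "('v \<Rightarrow> real) \<Rightarrow> bool" where
  "feasible_potential y \<longleftrightarrow> (\<forall>a\<in>arcs G. y (head G a) \<le> real_of_int (c a) + y (tail G a))"

text \<open>Without loops a column is the indicator of the head minus that of the tail. At a loop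
  \<open>incidence\<close> would give only the \<open>-1\<close>, and the identity would fail in
  general.\<close>

lemma sum_incidence:
  assumes "S \<subseteq> verts G" "a \<in> arcs G"
  shows "(\<Sum>v\<in>S. incidence G v a * y v)
    = (if head G a \<in> S then y (head G a) else 0) - (if tail G a \<in> S then y (tail G a) else 0)"
proof -
  have fin: "finite S" using assms(1) finite_verts by (rule finite_subset)
  have "tail G a \<noteq> head G a" using no_loops assms(2) by auto
  then have "incidence G v a * y v = (if v = head G a then y v else 0) - (if v = tail G a then y v else 0)" for v
    by (auto simp: incidence_def)
  then show ?thesis
    using fin by (simp add: sum_subtractf)
qed

lemma sum_incidence_verts:
  assumes "a \<in> arcs G"
  shows "(\<Sum>v\<in>verts G. incidence G v a * y v) = y (head G a) - y (tail G a)"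
  using sum_incidence[OF order_refl assms, of y] assms by simp

lemma dual_slack_eq:
  "a \<in> arcs G \<Longrightarrow> dual_slack G c y a = real_of_int (c a) + y (tail G a) - y (head G a)"
  by (simp add: dual_slack_def sum_incidence_verts)

lemma dual_feasible_potential:
  assumes "dual_feasible G c y s"
  shows "feasible_potential y"
  unfolding feasible_potential_def
proof
  fix a assume a: "a \<in> arcs G"
  then have "(\<Sum>v\<in>verts G. incidence G v a * y v) + s a = real_of_int (c a)" "0 \<le> s a"
    using assms unfolding dual_feasible_def by auto
  then show "y (head G a) \<le> real_of_int (c a) + y (tail G a)"
    using a by (simp add: sum_incidence_verts)
qed

lemma potential_dual_feasible:
  "feasible_potential y \<Longrightarrow> dual_feasible G c y (dual_slack G c y)"
  unfolding feasible_potential_def dual_feasible_def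
  by (auto simp: dual_slack_eq sum_incidence_verts)

text \<open>Conservation summed over \<open>S\<close>: an arc inside \<open>S\<close> contributes
  with both signs and cancels, so only cut arcs remain. This ties the sign of \<open>b(S)\<close> to
  the two cuts.\<close>

lemma net_inflow:
  assumes "S \<subseteq> verts G"
  shows "real_of_int (\<Sum>v\<in>S. b v) = (\<Sum>a\<in>in_cut G S. x a) - (\<Sum>a\<in>out_cut G S. x a)"
proof -
  have "real_of_int (\<Sum>v\<in>S. b v) = (\<Sum>v\<in>S. \<Sum>a\<in>arcs G. incidence G v a * x a)"
    using primal assms unfolding primal_feasible_def by (auto intro!: sum.cong)
  also have "\<dots> = (\<Sum>a\<in>arcs G. \<Sum>v\<in>S. incidence G v a * x a)"
    by (rule sum.swap)
  also have "\<dots> = (\<Sum>a\<in>arcs G. (if a \<in> in_cut G S then x a else 0) - (if a \<in> out_cut G S then x a else 0))"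
  proof (rule sum.cong)
    fix a assume "a \<in> arcs G"
    then show "(\<Sum>v\<in>S. incidence G v a * x a)
        = (if a \<in> in_cut G S then x a else 0) - (if a \<in> out_cut G S then x a else 0)"
      using sum_incidence[OF assms, of a "\<lambda>_. x a"] by (auto simp: in_cut_def out_cut_def)
  qed simp
  also have "\<dots> = (\<Sum>a\<in>arcs G \<inter> in_cut G S. x a) - (\<Sum>a\<in>arcs G \<inter> out_cut G S. x a)"
    by (simp add: sum_subtractf sum.inter_restrict)
  also have "\<dots> = (\<Sum>a\<in>in_cut G S. x a) - (\<Sum>a\<in>out_cut G S. x a)"
    by (intro arg_cong2[where f="(-)"] sum.cong) (auto simp: in_cut_def out_cut_def)
  finally show ?thesis .
qed

lemma flow_nonneg: "a \<in> arcs G \<Longrightarrow> 0 \<le> x a"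
  using primal unfolding primal_feasible_def by auto

text \<open>Serves the second disjunct of the branching condition: with nothing entering,
  \<open>b(S)\<close> has the sign that keeps the dual objective from decreasing in an
  out-step.\<close>

lemma supply_nonpos:
  assumes "S \<subseteq> verts G" "in_cut G S = {}"
  shows "(\<Sum>v\<in>S. b v) \<le> 0"
proof -
  have "0 \<le> (\<Sum>a\<in>out_cut G S. x a)"
    by (intro sum_nonneg flow_nonneg) (auto simp: out_cut_def)
  then have "real_of_int (\<Sum>v\<in>S. b v) \<le> 0"
    using net_inflow[OF assms(1)] assms(2) by simp
  then show ?thesis by linarith
qed

lemma supply_nonneg:
  assumes "S \<subseteq> verts G" "out_cut G S = {}"
  shows "0 \<le> (\<Sum>v\<in>S. b v)"
proof -
  have "0 \<le> (\<Sum>a\<in>in_cut G S. x a)"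
    by (intro sum_nonneg flow_nonneg) (auto simp: in_cut_def)
  then have "real_of_int (\<Sum>v\<in>S. b v) \<ge> 0"
    using net_inflow[OF assms(1)] assms(2) by simp
  then show ?thesis by linarith
qed

text \<open>Connectedness ignores directions, so a path from a node of \<open>S\<close> to a node
  outside crosses an arc of one cut or the other.\<close>

lemma cut_nonempty:
  assumes "S \<subset> verts G" "S \<noteq> {}"
  shows "in_cut G S \<union> out_cut G S \<noteq> {}"
proof
  assume none: "in_cut G S \<union> out_cut G S = {}"
  obtain u where u: "u \<in> S" using assms by auto
  obtain w where w: "w \<in> verts G" "w \<notin> S" using assms by auto
  have "(u, w) \<in> rtrancl_on (verts G) ((arcs_ends G)\<^sup>s)"
    using conn u w assms unfolding connected_conv by auto
  then have "w \<in> S"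
  proof (induction rule: rtrancl_on_induct)
    case base
    show ?case by (rule u)
  next
    case (step p q)
    then obtain a where "a \<in> arcs G" "(p, q) = (tail G a, head G a) \<or> (p, q) = (head G a, tail G a)"
      by (auto simp: symcl_def arcs_ends_def arc_to_ends_def)
    then show ?case
      using step none by (auto simp: in_cut_def out_cut_def)
  qed
  then show False using w by simp
qed

text \<open>Negative \<open>b(S)\<close> means net outflow and hence a leaving arc; with an empty
  in-cut, connectedness supplies one. The minimum in the out-branch is therefore over a nonempty
  set.\<close>

lemma out_cut_nonempty:
  assumes "S \<subset> verts G" "S \<noteq> {}" "(\<Sum>v\<in>S. b v) < 0 \<or> in_cut G S = {}"
  shows "out_cut G S \<noteq> {}"
  using assms cut_nonempty[of S] supply_nonneg[of S] by force

lemma finite_cuts: "finite (in_cut G S)" "finite (out_cut G S)"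
  by (auto simp: in_cut_def out_cut_def)

lemma step_exists:
  assumes "S \<subset> verts G" "S \<noteq> {}"
  shows "\<exists>\<sigma>'. crossover_step G c b y0 (S, y) \<sigma>'"
proof (cases "(\<Sum>v\<in>S. b v) < 0 \<or> in_cut G S = {}")
  case True
  define f where "f a = real_of_int (c a) + y (tail G a) - y0 (head G a)" for a
  have ne: "out_cut G S \<noteq> {}" using out_cut_nonempty assms True by auto
  obtain a where "is_arg_min f (\<lambda>a. a \<in> out_cut G S) a"
    using ex_is_arg_min_if_finite[OF finite_cuts(2) ne] by blast
  then have "a \<in> out_cut G S" "\<forall>a'\<in>out_cut G S. f a \<le> f a'"
    by (auto simp: is_arg_min_linorder)
  then show ?thesis
    using crossover_step.out_step[OF True, of a c y y0] unfolding f_def by blast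
next
  case False
  define f where "f a = real_of_int (c a) + y0 (tail G a) - y (head G a)" for a
  have ne: "in_cut G S \<noteq> {}" using False by auto
  obtain a where "is_arg_min f (\<lambda>a. a \<in> in_cut G S) a"
    using ex_is_arg_min_if_finite[OF finite_cuts(1) ne] by blast
  then have "a \<in> in_cut G S" "\<forall>a'\<in>in_cut G S. f a \<le> f a'"
    by (auto simp: is_arg_min_linorder)
  then show ?thesis
    using crossover_step.in_step[OF False, of a c y0 y] unfolding f_def by blast
qed

section \<open>The extended dual solution as an invariant\<close>

definition shifted :: "'v set \<Rightarrow> ('v \<Rightarrow> real) \<Rightarrow> ('v \<Rightarrow> real) \<Rightarrow> real \<Rightarrow> 'v \<Rightarrow> real" where
  "shifted S y y0 D v = (if v \<in> S then y v else y0 v + D)"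

text \<open>The demands sum to zero, so the nodes outside \<open>S\<close> have total demand
  \<open>- b(S)\<close>. The objective is thus affine in \<open>D\<close> with slope
  \<open>- b(S)\<close>, and the sign of \<open>b(S)\<close> says in which direction
  \<open>D\<close> may move.\<close>

lemma objective_shifted:
  assumes "S \<subseteq> verts G"
  shows "dual_objective G b (shifted S y y0 D)
    = dual_objective G b (shifted S y y0 D') + (D' - D) * real_of_int (\<Sum>v\<in>S. b v)"
proof -
  have fin: "finite (verts G)" by simp
  have D: "dual_objective G b (shifted S y y0 D)
      = (\<Sum>v\<in>S. real_of_int (b v) * y v) + (\<Sum>v\<in>verts G - S. real_of_int (b v) * (y0 v + D))" for D
    unfolding dual_objective_def using assms
    by (subst sum.subset_diff[OF assms fin]) (auto simp: shifted_def intro!: sum.cong arg_cong2[where f="(+)"])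
  have "(\<Sum>v\<in>verts G - S. b v) = - (\<Sum>v\<in>S. b v)"
    using balanced sum.subset_diff[OF assms fin, of b] by simp
  then have out: "(\<Sum>v\<in>verts G - S. real_of_int (b v)) = - real_of_int (\<Sum>v\<in>S. b v)"
    by (metis of_int_minus of_int_sum)
  have "(\<Sum>v\<in>verts G - S. real_of_int (b v) * (y0 v + D))
      = (\<Sum>v\<in>verts G - S. real_of_int (b v) * y0 v) - D * real_of_int (\<Sum>v\<in>S. b v)" for D
    using out by (simp add: ring_distribs sum.distrib flip: sum_distrib_right)
  then show ?thesis
    unfolding D by (simp add: algebra_simps)
qed

text \<open>\<open>D\<close> is existential because the procedure does not store it. Integrality is
  asked on \<open>S\<close> only: \<open>y0 + D\<close> may be fractional outside, and a node
  becomes integral when it is reached, by an integral cost from a node of \<open>S\<close>.\<close>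

definition progress :: "('v \<Rightarrow> real) \<Rightarrow> 'v set \<Rightarrow> ('v \<Rightarrow> real) \<Rightarrow> bool" where
  "progress y0 S y \<longleftrightarrow> S \<subseteq> verts G \<and> S \<noteq> {} \<and> (\<forall>v\<in>S. y v \<in> \<int>) \<and>
     (\<exists>D. feasible_potential (shifted S y y0 D) \<and>
          dual_objective G b y0 \<le> dual_objective G b (shifted S y y0 D))"

text \<open>Raising \<open>D\<close> uses up slack only on arcs leaving \<open>S\<close>, and
  \<open>D'\<close> is the value at which the minimizing one becomes tight. Entering arcs gain
  slack, all other arcs keep theirs.\<close>

lemma progress_out_step:
  assumes prog: "progress y0 S y"
    and cond: "(\<Sum>v\<in>S. b v) < 0 \<or> in_cut G S = {}"
    and a: "a \<in> out_cut G S"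
    and min: "\<forall>a'\<in>out_cut G S. real_of_int (c a) + y (tail G a) - y0 (head G a)
                \<le> real_of_int (c a') + y (tail G a') - y0 (head G a')"
  shows "progress y0 (insert (head G a) S) (y(head G a := real_of_int (c a) + y (tail G a)))"
proof -
  let ?y = "y(head G a := real_of_int (c a) + y (tail G a))" and ?S = "insert (head G a) S"
  from prog obtain D where S: "S \<subseteq> verts G" and int: "\<forall>v\<in>S. y v \<in> \<int>"
    and feas: "feasible_potential (shifted S y y0 D)"
    and obj: "dual_objective G b y0 \<le> dual_objective G b (shifted S y y0 D)"
    unfolding progress_def by blast
  define D' where "D' = real_of_int (c a) + y (tail G a) - y0 (head G a)"
  have ar: "a \<in> arcs G" "tail G a \<in> S" "head G a \<notin> S" using a by (auto simp: out_cut_def)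
  have "D \<le> D'"
    using feas ar unfolding feasible_potential_def shifted_def D'_def by fastforce
  \<comment> \<open>The new node receives exactly the value \<open>y0 + D'\<close> that the
    extension already gave it, so enlarging \<open>S\<close> leaves the extended potential
    unchanged.\<close>
  have eq: "shifted ?S ?y y0 D' = shifted S y y0 D'"
    using ar by (auto simp: shifted_def fun_eq_iff D'_def)
  have "feasible_potential (shifted S y y0 D')"
    unfolding feasible_potential_def
  proof
    fix e assume e: "e \<in> arcs G"
    have old: "shifted S y y0 D (head G e) \<le> real_of_int (c e) + shifted S y y0 D (tail G e)"
      using feas e unfolding feasible_potential_def by blast
    have "tail G e \<in> S \<Longrightarrow> head G e \<notin> S \<Longrightarrow> D' \<le> real_of_int (c e) + y (tail G e) - y0 (head G e)"
      using min e unfolding D'_def out_cut_def by blast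
    then show "shifted S y y0 D' (head G e) \<le> real_of_int (c e) + shifted S y y0 D' (tail G e)"
      using old \<open>D \<le> D'\<close> by (auto simp: shifted_def split: if_splits)
  qed
  moreover have "(\<Sum>v\<in>S. b v) \<le> 0"
    using cond supply_nonpos[OF S] by auto
  then have "(D' - D) * real_of_int (\<Sum>v\<in>S. b v) \<le> 0"
    using \<open>D \<le> D'\<close> by (intro mult_nonneg_nonpos) linarith+
  then have "dual_objective G b y0 \<le> dual_objective G b (shifted S y y0 D')"
    using obj objective_shifted[OF S, of y y0 D D'] by linarith
  ultimately show ?thesis
    unfolding progress_def using S int ar eq
    by (auto intro!: exI[of _ D'])
qed

text \<open>Mirror image of the out-step: lowering \<open>D\<close> uses up slack on entering arcs
  only. Minimizing \<open>c + y0 - y\<close> maximizes the \<open>D'\<close> at which an entering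
  arc becomes tight, so the arc met first on the way down is taken.\<close>

lemma progress_in_step:
  assumes prog: "progress y0 S y"
    and cond: "\<not> ((\<Sum>v\<in>S. b v) < 0 \<or> in_cut G S = {})"
    and a: "a \<in> in_cut G S"
    and min: "\<forall>a'\<in>in_cut G S. real_of_int (c a) + y0 (tail G a) - y (head G a)
                \<le> real_of_int (c a') + y0 (tail G a') - y (head G a')"
  shows "progress y0 (insert (tail G a) S) (y(tail G a := y (head G a) - real_of_int (c a)))"
proof -
  let ?y = "y(tail G a := y (head G a) - real_of_int (c a))" and ?S = "insert (tail G a) S"
  from prog obtain D where S: "S \<subseteq> verts G" and int: "\<forall>v\<in>S. y v \<in> \<int>"
    and feas: "feasible_potential (shifted S y y0 D)"
    and obj: "dual_objective G b y0 \<le> dual_objective G b (shifted S y y0 D)"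
    unfolding progress_def by blast
  define D' where "D' = y (head G a) - real_of_int (c a) - y0 (tail G a)"
  have ar: "a \<in> arcs G" "tail G a \<notin> S" "head G a \<in> S" using a by (auto simp: in_cut_def)
  have "D' \<le> D"
    using feas ar unfolding feasible_potential_def shifted_def D'_def by fastforce
  have eq: "shifted ?S ?y y0 D' = shifted S y y0 D'"
    using ar by (auto simp: shifted_def fun_eq_iff D'_def)
  have "feasible_potential (shifted S y y0 D')"
    unfolding feasible_potential_def
  proof
    fix e assume e: "e \<in> arcs G"
    have old: "shifted S y y0 D (head G e) \<le> real_of_int (c e) + shifted S y y0 D (tail G e)"
      using feas e unfolding feasible_potential_def by blast
    have "tail G e \<notin> S \<Longrightarrow> head G e \<in> S \<Longrightarrow> - D' \<le> real_of_int (c e) + y0 (tail G e) - y (head G e)"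
      using min e unfolding D'_def in_cut_def by fastforce
    then show "shifted S y y0 D' (head G e) \<le> real_of_int (c e) + shifted S y y0 D' (tail G e)"
      using old \<open>D' \<le> D\<close> by (auto simp: shifted_def split: if_splits)
  qed
  moreover have "0 \<le> (\<Sum>v\<in>S. b v)"
    using cond by auto
  then have "(D' - D) * real_of_int (\<Sum>v\<in>S. b v) \<le> 0"
    using \<open>D' \<le> D\<close> by (intro mult_nonpos_nonneg) linarith+
  then have "dual_objective G b y0 \<le> dual_objective G b (shifted S y y0 D')"
    using obj objective_shifted[OF S, of y y0 D D'] by linarith
  ultimately show ?thesis
    unfolding progress_def using S int ar eq
    by (auto intro!: exI[of _ D'])
qed

lemma progress_start:
  assumes "feasible_potential y0" "r \<in> verts G"
  shows "progress y0 {r} (\<lambda>_. 0)"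
proof -
  \<comment> \<open>The start is \<open>y0\<close> shifted by the constant \<open>- y0 r\<close>.
    Seen as an extension of the empty set, whose demand is 0, it has the objective of
    \<open>y0\<close> by \<open>objective_shifted\<close>.\<close>
  have eq: "shifted {r} (\<lambda>_. 0) y0 (- y0 r) = shifted {} y0 y0 (- y0 r)"
    by (auto simp: shifted_def fun_eq_iff)
  have "feasible_potential (shifted {} y0 y0 (- y0 r))"
    using assms by (auto simp: feasible_potential_def shifted_def)
  moreover have "dual_objective G b y0 = dual_objective G b (shifted {} y0 y0 (- y0 r))"
    using objective_shifted[of "{}" y0 y0 "- y0 r" 0] unfolding shifted_def by simp
  ultimately show ?thesis
    unfolding progress_def using assms(2) eq by (auto intro!: exI[of _ "- y0 r"])
qed

text \<open>Each step adds one node from outside, so the iteration number fixes the size of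
  \<open>S\<close>. After \<open>n - 1\<close> iterations \<open>S\<close> contains all nodes, and
  the extension is \<open>y\<close> itself.\<close>

lemma reachable_progress:
  assumes "feasible_potential y0" "r \<in> verts G"
  shows "crossover_reachable G c b y0 r k (S, y) \<Longrightarrow> progress y0 S y \<and> card S = Suc k"
proof (induction k arbitrary: S y)
  case 0
  then show ?case
    using progress_start[OF assms] by (auto simp: crossover_reachable_def)
next
  case (Suc k)
  then obtain S' y' where reach: "crossover_reachable G c b y0 r k (S', y')"
    and step: "crossover_step G c b y0 (S', y') (S, y)"
    by (auto simp: crossover_reachable_def OO_def)
  from Suc.IH[OF reach] have IH: "progress y0 S' y'" "card S' = Suc k" by auto
  have fin: "finite S'" using IH(2) card_ge_0_finite by force
  from step show ?case
  proof cases
    case (out_step a)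
    have "head G a \<notin> S'" using out_step(4) by (simp add: out_cut_def)
    then have "card S = Suc (Suc k)" using out_step(1) IH(2) fin by simp
    then show ?thesis
      using progress_out_step[OF IH(1) out_step(3-5)] out_step(1,2) by blast
  next
    case (in_step a)
    have "tail G a \<notin> S'" using in_step(4) by (simp add: in_cut_def)
    then have "card S = Suc (Suc k)" using in_step(1) IH(2) fin by simp
    then show ?thesis
      using progress_in_step[OF IH(1) in_step(3-5)] in_step(1,2) by blast
  qed
qed

lemma reachable_step:
  assumes "feasible_potential y0" "r \<in> verts G" "k < card (verts G) - 1"
    and reach: "crossover_reachable G c b y0 r k \<sigma>"
  shows "\<exists>\<sigma>'. crossover_step G c b y0 \<sigma> \<sigma>'"
proof -
  obtain S y where \<sigma>: "\<sigma> = (S, y)" by fastforce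
  then have *: "progress y0 S y" "card S = Suc k"
    using reachable_progress[OF assms(1,2)] reach by auto
  then have "S \<subset> verts G" "S \<noteq> {}"
    using assms(3) unfolding progress_def by auto
  then show ?thesis
    using step_exists \<sigma> by blast
qed

lemma output_exists:
  assumes "feasible_potential y0" "r \<in> verts G"
  shows "\<exists>y. crossover_output G c b y0 r y"
proof -
  have "k \<le> card (verts G) - 1 \<Longrightarrow> \<exists>\<sigma>. crossover_reachable G c b y0 r k \<sigma>" for k
  proof (induction k)
    case 0
    then show ?case by (auto simp: crossover_reachable_def)
  next
    case (Suc k)
    then obtain \<sigma> where \<sigma>: "crossover_reachable G c b y0 r k \<sigma>" by auto
    then obtain \<sigma>' where "crossover_step G c b y0 \<sigma> \<sigma>'"
      using reachable_step[OF assms _ \<sigma>] Suc.prems by auto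
    then have "crossover_reachable G c b y0 r (Suc k) \<sigma>'"
      using \<sigma> by (auto simp: crossover_reachable_def)
    then show ?case by blast
  qed
  from this[OF order_refl] show ?thesis
    unfolding crossover_output_def by auto
qed

lemma output_properties:
  assumes "feasible_potential y0" "r \<in> verts G" "crossover_output G c b y0 r y"
  shows "\<forall>v\<in>verts G. y v \<in> \<int>" "feasible_potential y" "dual_objective G b y0 \<le> dual_objective G b y"
proof -
  obtain S where S: "crossover_reachable G c b y0 r (card (verts G) - 1) (S, y)"
    using assms(3) unfolding crossover_output_def by auto
  from reachable_progress[OF assms(1,2) this]
  have prog: "progress y0 S y" and "card S = Suc (card (verts G) - 1)" by auto
  moreover have "card (verts G) > 0" using assms(2) by (auto simp: card_gt_0_iff)
  ultimately have "S = verts G"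
    unfolding progress_def by (intro card_subset_eq) auto
  with prog obtain D where *: "\<forall>v\<in>verts G. y v \<in> \<int>"
    "feasible_potential (shifted (verts G) y y0 D)"
    "dual_objective G b y0 \<le> dual_objective G b (shifted (verts G) y y0 D)"
    unfolding progress_def by blast
  then show "\<forall>v\<in>verts G. y v \<in> \<int>" "feasible_potential y" "dual_objective G b y0 \<le> dual_objective G b y"
    by (auto simp: feasible_potential_def shifted_def dual_objective_def)
qed

section \<open>Duality gap and optimality\<close>

lemma duality_gap:
  "primal_objective G c x - dual_objective G b y = (\<Sum>a\<in>arcs G. x a * dual_slack G c y a)"
proof -
  have "dual_objective G b y = (\<Sum>v\<in>verts G. (\<Sum>a\<in>arcs G. incidence G v a * x a) * y v)"
    using primal unfolding dual_objective_def primal_feasible_def by (auto intro!: sum.cong)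
  also have "\<dots> = (\<Sum>v\<in>verts G. \<Sum>a\<in>arcs G. x a * (incidence G v a * y v))"
    by (simp add: sum_distrib_right sum_distrib_left ac_simps)
  also have "\<dots> = (\<Sum>a\<in>arcs G. x a * (\<Sum>v\<in>verts G. incidence G v a * y v))"
    by (subst sum.swap) (simp add: sum_distrib_left)
  finally show ?thesis
    by (simp add: primal_objective_def dual_slack_def sum_subtractf algebra_simps)
qed

lemma weak_duality:
  assumes "feasible_potential y"
  shows "dual_objective G b y \<le> primal_objective G c x"
proof -
  have "0 \<le> (\<Sum>a\<in>arcs G. x a * dual_slack G c y a)"
    using assms flow_nonneg unfolding feasible_potential_def
    by (intro sum_nonneg) (auto simp: dual_slack_eq)
  then show ?thesis using duality_gap[of y] by linarith
qed

text \<open>No optimal solution is needed as a reference point: a better dual solution could be rounded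
  by the procedure itself to an integral one, whose objective value would exceed that of \<open>y\<close>
  by at least 1 and hence violate weak duality.\<close>

lemma output_optimal:
  assumes y0: "feasible_potential y0" and r: "r \<in> verts G" and out: "crossover_output G c b y0 r y"
    and gap: "(\<Sum>a\<in>arcs G. x a * dual_slack G c y0 a) < 1"
  shows "dual_optimal G c b y (dual_slack G c y)"
  unfolding dual_optimal_def
proof (intro conjI allI impI)
  note props = output_properties[OF y0 r out]
  show "dual_feasible G c y (dual_slack G c y)"
    using props potential_dual_feasible by auto
  fix y' s' assume "dual_feasible G c y' s'"
  then have y': "feasible_potential y'" by (rule dual_feasible_potential)
  then obtain z where z: "crossover_output G c b y' r z"
    using output_exists r by blast
  note zprops = output_properties[OF y' r z]
  have int: "\<forall>v\<in>verts G. u v \<in> \<int> \<Longrightarrow> dual_objective G b u \<in> \<int>" for u :: "'v \<Rightarrow> real"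
    unfolding dual_objective_def by (intro Ints_sum Ints_mult) auto
  obtain i j where ij: "dual_objective G b z = of_int i" "dual_objective G b y = of_int j"
    using int[OF props(1)] int[OF zprops(1)] by (auto elim!: Ints_cases)
  \<comment> \<open>Weak duality bounds the integral competitor by the primal value of
    \<open>x\<close>, which is less than the objective of \<open>y0\<close> plus 1, and
    \<open>y\<close> is at least as good as \<open>y0\<close>.\<close>
  have "dual_objective G b z < dual_objective G b y + 1"
    using weak_duality[OF zprops(2)] duality_gap[of y0] gap props(3) by linarith
  then have "i \<le> j" unfolding ij by linarith
  then show "dual_objective G b y' \<le> dual_objective G b y"
    using zprops(3) ij by simp
qed

end

lemma crossover_input_mcf:
  assumes "crossover_input G c b x y0 s0"
  shows "mcf G b x"
  using assms unfolding crossover_input_def mcf_problem_def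
  by (intro mcf.intro mcf_axioms.intro) auto

lemma crossover_input_gap:
  assumes "crossover_input G c b x y0 s0"
  shows "(\<Sum>a\<in>arcs G. x a * dual_slack G c y0 a) < 1"
proof -
  have "s0 a = dual_slack G c y0 a" if "a \<in> arcs G" for a
    using assms that unfolding crossover_input_def dual_feasible_def dual_slack_def
    by (auto simp: algebra_simps)
  then show ?thesis
    using assms unfolding crossover_input_def by simp
qed

lemma crossover_correct:
  assumes "crossover_input G c b x y0 s0" "r \<in> verts G"
  shows "(\<forall>k \<sigma>. k < card (verts G) - 1 \<and> crossover_reachable G c b y0 r k \<sigma> \<longrightarrow>
             (\<exists>\<sigma>'. crossover_step G c b y0 \<sigma> \<sigma>')) \<and>
          (\<exists>y. crossover_output G c b y0 r y) \<and>
          (\<forall>y. crossover_output G c b y0 r y \<longrightarrow>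
             (\<forall>v\<in>verts G. y v \<in> \<int>) \<and> dual_optimal G c b y (dual_slack G c y))"
proof -
  interpret mcf G c b x by (rule crossover_input_mcf[OF assms(1)])
  have y0: "feasible_potential y0"
    using assms(1) dual_feasible_potential unfolding crossover_input_def by blast
  show ?thesis
    using reachable_step[OF y0 assms(2)] output_exists[OF y0 assms(2)]
      output_properties(1)[OF y0 assms(2)]
      output_optimal[OF y0 assms(2) _ crossover_input_gap[OF assms(1)]]
    by blast
qed

section \<open>Weakest preconditions with cost\<close>

text \<open>Total correctness with cost: the postcondition also receives the time of the run. Since
  it just asks for some run, most of the rules below are equations, and simplification performs
  symbolic execution.\<close>

definition wp :: "com \<Rightarrow> (nat \<Rightarrow> store \<Rightarrow> bool) \<Rightarrow> store \<Rightarrow> bool" where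
  "wp P Q \<sigma> \<longleftrightarrow> (\<exists>t \<sigma>'. runs P \<sigma> t \<sigma>' \<and> Q t \<sigma>')"

inductive_cases runs_SkipE: "runs Skip \<sigma> t \<sigma>'"
inductive_cases runs_NAssignE: "runs (NAssign z e) \<sigma> t \<sigma>'"
inductive_cases runs_NArrAssignE: "runs (NArrAssign z i e) \<sigma> t \<sigma>'"
inductive_cases runs_RArrAssignE: "runs (RArrAssign z i e) \<sigma> t \<sigma>'"
inductive_cases runs_SeqE: "runs (Seq P R) \<sigma> t \<sigma>'"
inductive_cases runs_IfE: "runs (If p P R) \<sigma> t \<sigma>'"

lemma wp_Skip: "wp Skip Q \<sigma> = Q 1 \<sigma>"
  unfolding wp_def using runs.Skip by (auto elim!: runs_SkipE)

lemma wp_NAssign: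
  "wp (NAssign z e) Q \<sigma> = Q (1 + ncost e) (\<sigma>\<lparr>nvar := (nvar \<sigma>)(z := nval e \<sigma>)\<rparr>)"
  unfolding wp_def by (rule iffI) (auto elim!: runs_NAssignE intro!: exI runs.NAssign[simplified])

lemma wp_NArrAssign:
  "wp (NArrAssign z i e) Q \<sigma> = Q (1 + ncost i + ncost e)
     (\<sigma>\<lparr>narr := (narr \<sigma>)(z := (narr \<sigma> z)(nval i \<sigma> := nval e \<sigma>))\<rparr>)"
  unfolding wp_def by (rule iffI) (auto elim!: runs_NArrAssignE intro!: exI runs.NArrAssign[simplified])

lemma wp_RArrAssign:
  "wp (RArrAssign z i e) Q \<sigma> = Q (1 + ncost i + rcost e)
     (\<sigma>\<lparr>rarr := (rarr \<sigma>)(z := (rarr \<sigma> z)(nval i \<sigma> := rval e \<sigma>))\<rparr>)"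
  unfolding wp_def by (rule iffI) (auto elim!: runs_RArrAssignE intro!: exI runs.RArrAssign[simplified])

lemma wp_Seq: "wp (Seq P R) Q \<sigma> = wp P (\<lambda>t. wp R (\<lambda>u. Q (t + u))) \<sigma>"
  unfolding wp_def by (auto intro: runs.Seq elim!: runs_SeqE)

lemma wp_If:
  "wp (If p P R) Q \<sigma> =
     (if bval p \<sigma> then wp P (\<lambda>t. Q (1 + bcost p + t)) \<sigma> else wp R (\<lambda>t. Q (1 + bcost p + t)) \<sigma>)"
  unfolding wp_def
  by (auto elim!: runs_IfE) (blast intro: runs.IfTrue[simplified] runs.IfFalse[simplified])+

lemmas wp_simps = wp_Skip wp_NAssign wp_NArrAssign wp_RArrAssign wp_Seq wp_If

lemma wp_mono:
  "wp P Q \<sigma> \<Longrightarrow> (\<And>t \<sigma>'. Q t \<sigma>' \<Longrightarrow> Q' t \<sigma>') \<Longrightarrow> wp P Q' \<sigma>"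
  unfolding wp_def by blast

lemma wp_WhileFalse: "\<not> bval p \<sigma> \<Longrightarrow> Q (1 + bcost p) \<sigma> \<Longrightarrow> wp (While p P) Q \<sigma>"
  unfolding wp_def using runs.WhileFalse by blast

lemma wp_WhileTrue:
  "bval p \<sigma> \<Longrightarrow> wp P (\<lambda>t. wp (While p P) (\<lambda>u. Q (1 + bcost p + t + u))) \<sigma> \<Longrightarrow> wp (While p P) Q \<sigma>"
  unfolding wp_def using runs.WhileTrue by blast

text \<open>The potential \<open>\<Phi>\<close> pays for the iterations; since every iteration costs at least one unit,
  it also proves termination.\<close>

lemma wp_While:
  assumes body: "\<And>\<sigma>. I \<sigma> \<Longrightarrow> bval p \<sigma> \<Longrightarrow>
      wp P (\<lambda>t \<sigma>'. I \<sigma>' \<and> 1 + bcost p + t + \<Phi> \<sigma>' \<le> \<Phi> \<sigma>) \<sigma>"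
    and init: "I \<sigma>"
  shows "wp (While p P) (\<lambda>t \<sigma>'. I \<sigma>' \<and> \<not> bval p \<sigma>' \<and> t + \<Phi> \<sigma>' \<le> \<Phi> \<sigma> + 1 + bcost p) \<sigma>"
  using init
proof (induction "\<Phi> \<sigma>" arbitrary: \<sigma> rule: less_induct)
  case less
  show ?case
  proof (cases "bval p \<sigma>")
    case False
    then show ?thesis
      using less.prems unfolding wp_def by (auto intro!: exI runs.WhileFalse)
  next
    case True
    obtain t \<sigma>' where 1: "runs P \<sigma> t \<sigma>'" "I \<sigma>'" "1 + bcost p + t + \<Phi> \<sigma>' \<le> \<Phi> \<sigma>"
      using body[OF less.prems True] unfolding wp_def by blast
    then have "\<Phi> \<sigma>' < \<Phi> \<sigma>" by linarith
    from less.hyps[OF this 1(2)] obtain u \<sigma>'' where 2: "runs (While p P) \<sigma>' u \<sigma>''"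
      "I \<sigma>''" "\<not> bval p \<sigma>''" "u + \<Phi> \<sigma>'' \<le> \<Phi> \<sigma>' + 1 + bcost p"
      unfolding wp_def by blast
    have "runs (While p P) \<sigma> (1 + bcost p + t + u) \<sigma>''"
      using runs.WhileTrue[OF True 1(1) 2(1)] .
    then show ?thesis
      unfolding wp_def using 1 2 by (intro exI conjI) auto
  qed
qed

section \<open>Frame rule for variables and arrays that are not written\<close>

fun nvar_mods :: "com \<Rightarrow> string set" where
  "nvar_mods (NAssign z e) = {z}"
| "nvar_mods (Seq P Q) = nvar_mods P \<union> nvar_mods Q"
| "nvar_mods (If p P Q) = nvar_mods P \<union> nvar_mods Q"
| "nvar_mods (While p P) = nvar_mods P"
| "nvar_mods _ = {}"

fun narr_mods :: "com \<Rightarrow> string set" where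
  "narr_mods (NArrAssign z i e) = {z}"
| "narr_mods (Seq P Q) = narr_mods P \<union> narr_mods Q"
| "narr_mods (If p P Q) = narr_mods P \<union> narr_mods Q"
| "narr_mods (While p P) = narr_mods P"
| "narr_mods _ = {}"

fun rarr_mods :: "com \<Rightarrow> string set" where
  "rarr_mods (RArrAssign z i e) = {z}"
| "rarr_mods (Seq P Q) = rarr_mods P \<union> rarr_mods Q"
| "rarr_mods (If p P Q) = rarr_mods P \<union> rarr_mods Q"
| "rarr_mods (While p P) = rarr_mods P"
| "rarr_mods _ = {}"

definition unmodified :: "com \<Rightarrow> store \<Rightarrow> store \<Rightarrow> bool" where
  "unmodified P \<sigma> \<sigma>' \<longleftrightarrow>
     (\<forall>z. z \<notin> nvar_mods P \<longrightarrow> nvar \<sigma>' z = nvar \<sigma> z) \<and>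
     (\<forall>z. z \<notin> narr_mods P \<longrightarrow> narr \<sigma>' z = narr \<sigma> z) \<and>
     (\<forall>z. z \<notin> rarr_mods P \<longrightarrow> rarr \<sigma>' z = rarr \<sigma> z)"

lemma unmodifiedD:
  assumes "unmodified P \<sigma> \<sigma>'"
  shows "z \<notin> nvar_mods P \<Longrightarrow> nvar \<sigma>' z = nvar \<sigma> z"
    and "z \<notin> narr_mods P \<Longrightarrow> narr \<sigma>' z = narr \<sigma> z"
    and "z \<notin> rarr_mods P \<Longrightarrow> rarr \<sigma>' z = rarr \<sigma> z"
  using assms unfolding unmodified_def by auto

lemma runs_unmodified: "runs P \<sigma> t \<sigma>' \<Longrightarrow> unmodified P \<sigma> \<sigma>'"
  by (induction rule: runs.induct) (auto simp: unmodified_def)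

text \<open>Lets a specification mention only what a program changes; that names it does not assign
  keep their values is added afterwards.\<close>

lemma wp_frame:
  "wp P Q \<sigma> \<Longrightarrow> (\<And>t \<sigma>'. Q t \<sigma>' \<Longrightarrow> unmodified P \<sigma> \<sigma>' \<Longrightarrow> Q' t \<sigma>') \<Longrightarrow> wp P Q' \<sigma>"
  unfolding wp_def using runs_unmodified by blast

text \<open>Normal form of stores: \<open>nvar\<close> is updated innermost, then
  \<open>narr\<close>, then \<open>rarr\<close>. Symbolic execution produces updates in program
  order, and the result has to match the stores that the proofs define explicitly.\<close>

lemma store_update_order [simp]:
  "\<sigma>\<lparr>narr := f, nvar := g\<rparr> = \<sigma>\<lparr>nvar := g, narr := f\<rparr>"
  "\<sigma>\<lparr>rarr := h, nvar := g\<rparr> = \<sigma>\<lparr>nvar := g, rarr := h\<rparr>"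
  "\<sigma>\<lparr>rarr := h, narr := f\<rparr> = \<sigma>\<lparr>narr := f, rarr := h\<rparr>"
  by (cases \<sigma>; simp)+

section \<open>Fibonacci heaps\<close>

definition kids :: "nat \<Rightarrow> (nat \<Rightarrow> nat) \<Rightarrow> nat \<Rightarrow> nat set" where
  "kids N par p = {x. x < N \<and> par x = p}"

text \<open>The forest has elements \<open>0, \<dots>, N - 1\<close> and the four virtual nodes \<open>N\<close> and \<open>N + 1\<close> (whose
  children are the roots of the two heaps), \<open>N + 2\<close> (roots already bucketed during a
  consolidation) and \<open>N + 3\<close> (elements that are in neither heap). The children of \<open>p\<close> are listed in
  \<open>ch\<close> from index \<open>p * (N + 4)\<close> on, and \<open>pos x\<close> is the offset of \<open>x\<close> in the list of its parent.\<close>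

definition child_lists ::
  "nat \<Rightarrow> (nat \<Rightarrow> nat) \<Rightarrow> (nat \<Rightarrow> nat) \<Rightarrow> (nat \<Rightarrow> nat) \<Rightarrow> (nat \<Rightarrow> nat) \<Rightarrow> bool" where
  "child_lists N par ch pos deg \<longleftrightarrow>
     (\<forall>x<N. par x < N + 4 \<and> pos x < deg (par x) \<and> ch (par x * (N + 4) + pos x) = x) \<and>
     (\<forall>p<N + 4. \<forall>i<deg p. ch (p * (N + 4) + i) < N \<and> par (ch (p * (N + 4) + i)) = p \<and>
                           pos (ch (p * (N + 4) + i)) = i)"

lemma finite_kids [simp]: "finite (kids N par p)"
  by (simp add: kids_def)

text \<open>\<open>pos\<close> inverts the enumeration of the list of \<open>p\<close>, so the
  stored length is the true number of children.\<close>

lemma child_lists_deg: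
  assumes "child_lists N par ch pos deg" "p < N + 4"
  shows "deg p = card (kids N par p)"
proof -
  have "bij_betw (\<lambda>i. ch (p * (N + 4) + i)) {..<deg p} (kids N par p)"
    using assms unfolding child_lists_def kids_def
    by (intro bij_betwI[of _ _ _ pos]) auto
  then show ?thesis
    using bij_betw_same_card by fastforce
qed

lemma card_kids_le: "card (kids N par p) \<le> N"
proof -
  have "kids N par p \<subseteq> {..<N}" by (auto simp: kids_def)
  then show ?thesis using card_mono[of "{..<N}"] by fastforce
qed

lemma slot_inject:
  assumes "i < M" "j < (M::nat)"
  shows "p * M + i = q * M + j \<longleftrightarrow> p = q \<and> i = j"
proof
  assume eq: "p * M + i = q * M + j"
  have "(p * M + i) div M = p" "(q * M + j) div M = q" using assms by auto
  then show "p = q \<and> i = j" using eq by auto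
qed auto

text \<open>Removal fills the gap with the last child \<open>l\<close>, insertion appends, so the
  position of \<open>x\<close> does not affect the cost. If \<open>x\<close> is itself the last
  child, the later update of \<open>pos x\<close> overrides the earlier one, and the slot that still
  contains \<open>x\<close> lies beyond the shortened list.\<close>

lemma child_lists_move:
  assumes cl: "child_lists N par ch pos deg" and x: "x < N" and q: "q < N + 4" and qp: "q \<noteq> par x"
    and l: "l = ch (par x * (N + 4) + (deg (par x) - 1))"
  shows "child_lists N (par(x := q))
    (ch(par x * (N + 4) + pos x := l, q * (N + 4) + deg q := x))
    (pos(l := pos x, x := deg q))
    (deg(par x := deg (par x) - 1, q := deg q + 1))"
proof -
  define M where "M = N + 4"
  define p where "p = par x"
  \<comment> \<open>Appending stays inside the row of \<open>q\<close>: at most \<open>N\<close>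
    elements can be children, and a row has \<open>N + 4\<close> slots.\<close>
  have le: "deg r < M" if "r < M" for r
    using child_lists_deg[OF cl, of r] card_kids_le[of N par r] that by (simp add: M_def)
  have 1: "\<And>z. z < N \<Longrightarrow> par z < M \<and> pos z < deg (par z) \<and> ch (par z * M + pos z) = z"
    and 2: "\<And>r i. r < M \<Longrightarrow> i < deg r \<Longrightarrow> ch (r * M + i) < N \<and> par (ch (r * M + i)) = r \<and> pos (ch (r * M + i)) = i"
    using cl unfolding child_lists_def M_def by auto
  have p: "p < M" "pos x < deg p" "ch (p * M + pos x) = x" "q \<noteq> p" "q < M"
    using 1[OF x] qp q by (auto simp: p_def M_def)
  have l': "l < N" "par l = p" "pos l = deg p - 1"
    using 2[OF p(1), of "deg p - 1"] p l by (auto simp: p_def M_def)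
  have inj: "r * M + i = s * M + j \<longleftrightarrow> r = s \<and> i = j" if "i < M" "j < M" for r s i j
    using slot_inject that by blast
  define ch' where "ch' = ch(p * M + pos x := l, q * M + deg q := x)"
  define pos' where "pos' = pos(l := pos x, x := deg q)"
  define deg' where "deg' = deg(p := deg p - 1, q := deg q + 1)"
  have ch': "ch' (r * M + i) = (if r = q \<and> i = deg q then x else if r = p \<and> i = pos x then l else ch (r * M + i))"
    if "i < M" for r i
    using inj[OF that le[OF p(5)]] inj[OF that, of "pos x"] le[OF p(1)] p by (auto simp: ch'_def)
  have A: "(par(x := q)) z < M \<and> pos' z < deg' ((par(x := q)) z) \<and> ch' ((par(x := q)) z * M + pos' z) = z"
    if z: "z < N" for z
  proof -
    consider "z = x" | "z = l" "z \<noteq> x" | "z \<noteq> l" "z \<noteq> x" by blast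
    then show ?thesis
    proof cases
      case 1
      then show ?thesis using p ch'[OF le[OF p(5)]] by (simp add: pos'_def deg'_def)
    next
      case 2
      have ne: "pos x \<noteq> deg p - 1" using 2 l p by (auto simp: p_def M_def)
      then have "pos x < deg p - 1" using p by simp
      moreover have "pos x < M" using p le[OF p(1)] by simp
      ultimately show ?thesis using 2 l' p ch'[of "pos x" p] by (simp add: pos'_def deg'_def)
    next
      case 3
      have z1: "par z < M" "pos z < deg (par z)" "ch (par z * M + pos z) = z" using 1[OF z] by auto
      have "pos z < M" using z1 le[of "par z"] by simp
      have "pos z \<noteq> pos x" if "par z = p" using z1 p 3 that by metis
      moreover have "pos z \<noteq> deg p - 1" if "par z = p" using z1 l 3 that by (metis M_def p_def)
      ultimately show ?thesis
        using 3 z1 p ch'[OF \<open>pos z < M\<close>, of "par z"] by (auto simp: pos'_def deg'_def)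
    qed
  qed
  have B: "ch' (r * M + i) < N \<and> (par(x := q)) (ch' (r * M + i)) = r \<and> pos' (ch' (r * M + i)) = i"
    if r: "r < M" and i: "i < deg' r" for r i
  proof -
    have iM: "i < M"
      using i le[OF r] le[OF p(5)] le[OF p(1)] p child_lists_deg[OF cl, of q] card_kids_le[of N par q] q
      by (auto simp: deg'_def M_def split: if_splits)
    consider "r = q" "i = deg q" | "r = p" "i = pos x" | "\<not> (r = q \<and> i = deg q)" "\<not> (r = p \<and> i = pos x)" by blast
    then show ?thesis
    proof cases
      case 1
      then show ?thesis using ch'[OF iM, of r] x by (simp add: pos'_def)
    next
      case 2
      have "pos x \<noteq> deg p - 1" using i 2 p by (auto simp: deg'_def)
      then have "l \<noteq> x" using l' by auto
      then show ?thesis using 2 p l' ch'[OF iM, of r] by (simp add: pos'_def)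
    next
      case 3
      have id: "i < deg r" using i 3 p by (auto simp: deg'_def split: if_splits)
      note k = 2[OF r id]
      have "ch (r * M + i) \<noteq> x" using k 3 by (auto simp: p_def)
      moreover have "ch (r * M + i) \<noteq> l"
        using k l' i p by (auto simp: deg'_def split: if_splits)
      ultimately show ?thesis using ch'[OF iM, of r] 3 k by (auto simp: pos'_def)
    qed
  qed
  show ?thesis
    using A B unfolding child_lists_def ch'_def pos'_def deg'_def p_def M_def by simp
qed

lemma kids_upd:
  "x < N \<Longrightarrow> q \<noteq> par x \<Longrightarrow> kids N (par(x := q)) p =
    (if p = q then insert x (kids N par q) else if p = par x then kids N par p - {x} else kids N par p)"
  by (auto simp: kids_def)

lemma card_kids_upd:
  assumes "x < N" "q \<noteq> par x"
  shows "card (kids N (par(x := q)) p) =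
    (if p = q then Suc (card (kids N par q)) else if p = par x then card (kids N par p) - 1 else card (kids N par p))"
proof -
  have "x \<in> kids N par (par x)" "x \<notin> kids N par q" using assms by (auto simp: kids_def)
  then show ?thesis unfolding kids_upd[where par=par, OF assms] by auto
qed

text \<open>The degree condition says that the children of \<open>p\<close> can be enumerated as \<open>c\<^sub>0, c\<^sub>1, \<dots>\<close> such that
  \<open>c\<^sub>i\<close> has degree at least \<open>i\<close>, or \<open>i - 1\<close> if it is marked; stating it by counting makes it
  independent of the order in which the children were linked. The elements of \<open>E\<close> are exempt from
  it while a cascade of cuts is running.\<close>

definition fib_heap ::
  "nat \<Rightarrow> nat set \<Rightarrow> (nat \<Rightarrow> nat) \<Rightarrow> (nat \<Rightarrow> nat) \<Rightarrow> (nat \<Rightarrow> real) \<Rightarrow> bool" where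
  "fib_heap n E par mk key \<longleftrightarrow> (let N = n + n in
     (\<forall>x<N. par x < N \<longrightarrow> key (par x) \<le> key x) \<and>
     (\<exists>h :: nat \<Rightarrow> nat. \<forall>x<N. par x < N \<longrightarrow> h x < h (par x)) \<and>
     (\<forall>p<N. \<forall>j. card {c \<in> kids N par p - E. card (kids N par c) + mk c < j} \<le> j) \<and>
     (\<forall>x. mk x \<le> 1) \<and>
     (\<forall>x<N. par x < N \<longrightarrow> (x < n \<longleftrightarrow> par x < n) \<and> par (par x) \<noteq> N + 3) \<and>
     (\<forall>x<N. (par x = N \<longrightarrow> x < n) \<and> (par x = N + 1 \<longrightarrow> \<not> x < n)))"

lemma fib_heapD:
  assumes "fib_heap n E par mk key" "N = n + n"
  shows "\<And>x. x < N \<Longrightarrow> par x < N \<Longrightarrow> key (par x) \<le> key x"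
    and "\<exists>h :: nat \<Rightarrow> nat. \<forall>x<N. par x < N \<longrightarrow> h x < h (par x)"
    and "\<And>p j. p < N \<Longrightarrow> card {c \<in> kids N par p - E. card (kids N par c) + mk c < j} \<le> j"
    and "\<And>x. mk x \<le> 1"
    and "\<And>x. x < N \<Longrightarrow> par x < N \<Longrightarrow> x < n \<longleftrightarrow> par x < n"
    and "\<And>x. x < N \<Longrightarrow> par x < N \<Longrightarrow> par (par x) \<noteq> N + 3"
    and "\<And>x. x < N \<Longrightarrow> par x = N \<Longrightarrow> x < n"
    and "\<And>x. x < N \<Longrightarrow> par x = N + 1 \<Longrightarrow> \<not> x < n"
  using assms unfolding fib_heap_def Let_def by auto

lemma fib_heapI:
  assumes "N = n + n"
    and "\<And>x. x < N \<Longrightarrow> par x < N \<Longrightarrow> key (par x) \<le> key x"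
    and "\<exists>h :: nat \<Rightarrow> nat. \<forall>x<N. par x < N \<longrightarrow> h x < h (par x)"
    and "\<And>p j. p < N \<Longrightarrow> card {c \<in> kids N par p - E. card (kids N par c) + mk c < j} \<le> j"
    and "\<And>x. mk x \<le> 1"
    and "\<And>x. x < N \<Longrightarrow> par x < N \<Longrightarrow> x < n \<longleftrightarrow> par x < n"
    and "\<And>x. x < N \<Longrightarrow> par x < N \<Longrightarrow> par (par x) \<noteq> N + 3"
    and "\<And>x. x < N \<Longrightarrow> par x = N \<Longrightarrow> x < n"
    and "\<And>x. x < N \<Longrightarrow> par x = N + 1 \<Longrightarrow> \<not> x < n"
  shows "fib_heap n E par mk key"
  using assms unfolding fib_heap_def Let_def by blast

text \<open>At \<open>j = k + 1\<close> the degree condition allows at most \<open>k + 1\<close>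
  children whose degree plus mark is below \<open>k + 1\<close>. Any other child has degree at least
  \<open>k\<close>, since a mark counts for at most 1. Children of different parents are different,
  which yields the factor 2.\<close>

lemma fib_heap_degree_halving:
  assumes fh: "fib_heap n {} par mk key" and N: "N = n + n"
  shows "2 * card {x. x < N \<and> k + 3 \<le> card (kids N par x)} \<le> card {x. x < N \<and> k \<le> card (kids N par x)}"
proof -
  define A where "A k = {x. x < N \<and> k \<le> card (kids N par x)}" for k
  have fin: "finite (A k)" for k by (simp add: A_def)
  have two: "2 \<le> card (kids N par p \<inter> A k)" if p: "p \<in> A (k + 3)" for p
  proof -
    have pN: "p < N" "k + 3 \<le> card (kids N par p)" using p by (simp_all add: A_def)
    define small where "small = {c \<in> kids N par p - {}. card (kids N par c) + mk c < k + 1}"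
    have "card small \<le> k + 1"
      unfolding small_def by (rule fib_heapD(3)[OF fh N pN(1)])
    moreover have "kids N par p \<subseteq> small \<union> (kids N par p \<inter> A k)"
    proof
      fix c assume c: "c \<in> kids N par p"
      then have "c < N" by (simp add: kids_def)
      moreover have "mk c \<le> 1" by (rule fib_heapD(4)[OF fh N])
      ultimately show "c \<in> small \<union> (kids N par p \<inter> A k)"
        using c unfolding small_def A_def by (cases "k \<le> card (kids N par c)") auto
    qed
    then have "card (kids N par p) \<le> card (small \<union> (kids N par p \<inter> A k))"
      by (rule card_mono[rotated]) (simp add: small_def)
    then have "card (kids N par p) \<le> card small + card (kids N par p \<inter> A k)"
      using card_Un_le[of small "kids N par p \<inter> A k"] by linarith
    ultimately show ?thesis using pN by linarith
  qed
  have "card (A (k + 3)) * 2 \<le> (\<Sum>p\<in>A (k + 3). card (kids N par p \<inter> A k))"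
    using sum_bounded_below[of "A (k + 3)" 2 "\<lambda>p. card (kids N par p \<inter> A k)", OF two]
    by simp
  also have "\<dots> = card (\<Union>p\<in>A (k + 3). kids N par p \<inter> A k)"
  proof (rule card_UN_disjoint[symmetric])
    show "\<forall>p\<in>A (k + 3). \<forall>q\<in>A (k + 3). p \<noteq> q \<longrightarrow> (kids N par p \<inter> A k) \<inter> (kids N par q \<inter> A k) = {}"
      by (auto simp: kids_def)
  qed (simp_all add: fin)
  also have "\<dots> \<le> card (A k)"
    by (rule card_mono[OF fin]) blast
  finally show ?thesis by (simp add: A_def)
qed

text \<open>Iterating the halving leaves at most \<open>N / 2^j\<close> elements of degree at least
  \<open>3 * j\<close>. If \<open>j\<close> is a third of the degree of \<open>x\<close>, then
  \<open>x\<close> is one of them, so \<open>j\<close> is at most \<open>K\<close>. This takes the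
  place of the usual estimate of subtree sizes by Fibonacci numbers.\<close>

lemma fib_heap_degree_bound:
  assumes fh: "fib_heap n {} par mk key" and N: "N = n + n" and x: "x < N" and K: "N < 2 ^ Suc K"
  shows "card (kids N par x) \<le> 3 * K + 2"
proof -
  have *: "2 ^ j * card {x. x < N \<and> 3 * j \<le> card (kids N par x)} \<le> N" for j
  proof (induction j)
    case 0
    then show ?case by simp
  next
    case (Suc j)
    have "2 * card {x. x < N \<and> 3 * Suc j \<le> card (kids N par x)} \<le> card {x. x < N \<and> 3 * j \<le> card (kids N par x)}"
      using fib_heap_degree_halving[OF fh N, of "3 * j"] by (simp only: mult_Suc_right add.commute)
    from mult_le_mono2[OF this, of "2 ^ j"]
    have "2 ^ Suc j * card {x. x < N \<and> 3 * Suc j \<le> card (kids N par x)}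
        \<le> 2 ^ j * card {x. x < N \<and> 3 * j \<le> card (kids N par x)}"
      by (simp only: power_Suc mult.assoc mult.left_commute)
    then show ?case using Suc by linarith
  qed
  define j where "j = card (kids N par x) div 3"
  define B where "B = {x. x < N \<and> 3 * j \<le> card (kids N par x)}"
  have "x \<in> B" "finite B" using x by (auto simp: j_def B_def)
  then have "0 < card B" by (auto simp: card_gt_0_iff)
  then have "2 ^ j * 1 \<le> 2 ^ j * card B" by (intro mult_le_mono2) linarith
  then have "(2::nat) ^ j \<le> N" using *[of j] unfolding B_def by linarith
  then have "(2::nat) ^ j < 2 ^ Suc K" using K by linarith
  then have "j < Suc K" by (rule power_less_imp_less_exp[rotated]) simp
  then show ?thesis unfolding j_def by linarith
qed

text \<open>The height function certifies that the parent relation is acyclic, and it is bounded on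
  the finitely many elements, so climbing ends at a root. On the way keys do not grow, and the side
  does not change.\<close>

lemma fib_heap_root:
  assumes fh: "fib_heap n E par mk key" and N: "N = n + n" and x: "x < N" "par x \<noteq> N + 3"
  obtains r where "r < N" "N \<le> par r" "par r \<noteq> N + 3" "key r \<le> key x" "r < n \<longleftrightarrow> x < n"
proof -
  obtain h :: "nat \<Rightarrow> nat" where h: "\<And>x. x < N \<Longrightarrow> par x < N \<Longrightarrow> h x < h (par x)"
    using fib_heapD(2)[OF fh N] by auto
  define m where "m = Max (h ` {..<N})"
  have m: "h x \<le> m" if "x < N" for x using that by (auto simp: m_def)
  have "\<exists>r<N. N \<le> par r \<and> par r \<noteq> N + 3 \<and> key r \<le> key x \<and> (r < n \<longleftrightarrow> x < n)"
    using x
  proof (induction "m - h x" arbitrary: x rule: less_induct)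
    case less
    show ?case
    proof (cases "par x < N")
      case True
      have "m - h (par x) < m - h x"
        using h[OF less.prems(1) True] m[OF True] by linarith
      from less.hyps[OF this True fib_heapD(6)[OF fh N less.prems(1) True]]
      obtain r where "r < N" "N \<le> par r" "par r \<noteq> N + 3" "key r \<le> key (par x)" "r < n \<longleftrightarrow> par x < n"
        by blast
      then show ?thesis
        using fib_heapD(1,5)[OF fh N less.prems(1) True] by (intro exI[of _ r]) auto
    next
      case False
      then show ?thesis using less.prems by (intro exI[of _ x]) auto
    qed
  qed
  then show ?thesis using that by blast
qed

section \<open>Linking, cutting, marking and changing keys\<close>

lemma fib_heap_link:
  assumes fh: "fib_heap n {} par mk key" and N: "N = n + n"
    and l: "l < N" "N \<le> par l" and w: "w < N" "N \<le> par w" "par w \<noteq> N + 3" "l \<noteq> w"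
    and deg: "card (kids N par l) = card (kids N par w)" and key: "key w \<le> key l"
    and side: "l < n \<longleftrightarrow> w < n"
  shows "fib_heap n {} (par(l := w)) (mk(l := 0)) key"
proof (rule fib_heapI[OF N])
  let ?par = "par(l := w)" and ?mk = "mk(l := 0)"
  note D = fib_heapD[OF fh N]
  have lw: "w \<noteq> par l" using l w by auto
  show "key (?par x) \<le> key x" if "x < N" "?par x < N" for x
    using that key D(1)[of x] by (auto split: if_splits)
  obtain h :: "nat \<Rightarrow> nat" where h: "\<And>x. x < N \<Longrightarrow> par x < N \<Longrightarrow> h x < h (par x)"
    using D(2) by auto
  \<comment> \<open>\<open>w\<close> is a root, so its height can be raised above that of
    \<open>l\<close> without affecting the other inequalities.\<close>
  have "(h(w := h w + h l + 1)) x < (h(w := h w + h l + 1)) (?par x)" if "x < N" "?par x < N" for x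
    using that h[of x] w by (cases "x = l") (auto split: if_splits)
  then show "\<exists>h :: nat \<Rightarrow> nat. \<forall>x<N. ?par x < N \<longrightarrow> h x < h (?par x)"
    by (intro exI[of _ "h(w := h w + h l + 1)"]) simp
  show "?mk x \<le> 1" for x using D(4) by simp
  show "x < n \<longleftrightarrow> ?par x < n" if "x < N" "?par x < N" for x
    using that D(5)[of x] side by (auto split: if_splits)
  show "?par (?par x) \<noteq> N + 3" if "x < N" "?par x < N" for x
    using that D(6)[of x] w l by (auto split: if_splits)
  show "x < n" if "x < N" "?par x = N" for x using that D(7)[of x] w by (auto split: if_splits)
  show "\<not> x < n" if "x < N" "?par x = N + 1" for x using that D(8)[of x] w by (auto split: if_splits)
  show "card {c \<in> kids N ?par p - {}. card (kids N ?par c) + ?mk c < j} \<le> j" (is "card ?S \<le> j")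
    if p: "p < N" for p j
  \<comment> \<open>Before linking, both roots have the same degree \<open>d\<close>. For
    \<open>j > d\<close> the \<open>d + 1\<close> children of \<open>w\<close> cannot exceed the
    bound; for \<open>j \<le> d\<close> the new child has degree at least \<open>j\<close> and is
    not counted.\<close>
  proof (cases "p = w \<and> card (kids N par w) < j")
    case True
    then have "card ?S \<le> card (kids N ?par w)"
      by (intro card_mono) auto
    then show ?thesis using True card_kids_upd[where par=par, OF l(1) lw, of w] by simp
  next
    case False
    have mono: "card (kids N par c) \<le> card (kids N ?par c)" if "c < N" for c
      by (rule card_mono) (use that l in \<open>auto simp: kids_def\<close>)
    have "?S \<subseteq> {c \<in> kids N par p - {}. card (kids N par c) + mk c < j}"
    proof
      fix c assume c: "c \<in> ?S"
      then have c': "c < N" "?par c = p" "card (kids N ?par c) + ?mk c < j"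
        by (simp_all add: kids_def)
      have "c \<noteq> l"
      proof
        assume "c = l"
        then have "p = w" "card (kids N ?par l) < j" using c' by simp_all
        then show False using False mono[OF l(1)] deg by simp
      qed
      then have "par c = p" "card (kids N ?par c) + mk c < j" using c' by simp_all
      then show "c \<in> {c \<in> kids N par p - {}. card (kids N par c) + mk c < j}"
        using mono[OF c'(1)] c'(1) by (simp add: kids_def)
    qed
    then have "card ?S \<le> card {c \<in> kids N par p - {}. card (kids N par c) + mk c < j}"
      by (intro card_mono) auto
    then show ?thesis using D(3)[OF p, of j] by linarith
  qed
qed

text \<open>Cutting off \<open>y\<close> takes it out of the sets that are counted, but
  \<open>par y\<close> loses a child and may have become too small for its own parent; hence it is
  the new exempt element. The old exemption concerned \<open>y\<close>, which is now a root.\<close>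

lemma fib_heap_cut:
  assumes fh: "fib_heap n E par mk key" and N: "N = n + n" and E: "E \<subseteq> {y}"
    and y: "y < N" "par y < N" and q: "q = (if y < n then N else N + 1)"
  shows "fib_heap n {par y} (par(y := q)) mk key"
proof (rule fib_heapI[OF N])
  let ?par = "par(y := q)"
  note D = fib_heapD[OF fh N]
  have qN: "N \<le> q" "q \<noteq> N + 3" "q \<noteq> par y" using q y by auto
  show "key (?par x) \<le> key x" if "x < N" "?par x < N" for x
    using that D(1)[of x] qN by (auto split: if_splits)
  obtain h :: "nat \<Rightarrow> nat" where h: "\<And>x. x < N \<Longrightarrow> par x < N \<Longrightarrow> h x < h (par x)"
    using D(2) by auto
  then have "h x < h (?par x)" if "x < N" "?par x < N" for x
    using that qN by (auto split: if_splits)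
  then show "\<exists>h :: nat \<Rightarrow> nat. \<forall>x<N. ?par x < N \<longrightarrow> h x < h (?par x)"
    by (intro exI[of _ h]) simp
  show "mk x \<le> 1" for x using D(4) by simp
  show "x < n \<longleftrightarrow> ?par x < n" if "x < N" "?par x < N" for x
    using that D(5)[of x] qN by (auto split: if_splits)
  show "?par (?par x) \<noteq> N + 3" if "x < N" "?par x < N" for x
    using that D(6)[of x] qN by (auto split: if_splits)
  show "x < n" if "x < N" "?par x = N" for x using that D(7)[of x] q by (auto split: if_splits)
  show "\<not> x < n" if "x < N" "?par x = N + 1" for x using that D(8)[of x] q by (auto split: if_splits)
  show "card {c \<in> kids N ?par p - {par y}. card (kids N ?par c) + mk c < j} \<le> j" (is "card ?S \<le> j")
    if p: "p < N" for p j
  proof -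
    have "?S \<subseteq> {c \<in> kids N par p - E. card (kids N par c) + mk c < j}"
    proof
      fix c assume c: "c \<in> ?S"
      then have "c \<noteq> y" "c < N" "par c = p" "c \<noteq> par y" "c \<noteq> q"
        using p qN by (auto simp: kids_def split: if_splits)
      then show "c \<in> {c \<in> kids N par p - E. card (kids N par c) + mk c < j}"
        using c E card_kids_upd[where par=par, OF y(1) qN(3), of c] by (auto simp: kids_def)
    qed
    then have "card ?S \<le> card {c \<in> kids N par p - E. card (kids N par c) + mk c < j}"
      by (intro card_mono) auto
    then show ?thesis using D(3)[OF p, of j] by linarith
  qed
qed

lemma fib_heap_mark:
  assumes fh: "fib_heap n E par mk key"
  shows "fib_heap n E par (mk(p := 1)) key"
proof -
  define N where N: "N = n + n"
  note D = fib_heapD[OF fh N]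
  have "card {c \<in> kids N par q - E. card (kids N par c) + (mk(p := 1)) c < j} \<le> j" (is "card ?S \<le> j")
    if "q < N" for q j
  proof -
    have "?S \<subseteq> {c \<in> kids N par q - E. card (kids N par c) + mk c < j}"
      using D(4)[of p] by (auto split: if_splits)
    then have "card ?S \<le> card {c \<in> kids N par q - E. card (kids N par c) + mk c < j}"
      by (intro card_mono) auto
    then show ?thesis using D(3)[OF that, of j] by linarith
  qed
  note deg = this
  have mk: "(mk(p := 1)) x \<le> 1" for x using D(4) by simp
  show ?thesis by (rule fib_heapI[OF N]) (fact D deg mk)+
qed

text \<open>For \<open>par y\<close> the lost child and the new mark cancel in the degree condition.
  No exemption is left, and a cascade can stop here.\<close>

lemma fib_heap_cut_unmarked:
  assumes fh: "fib_heap n E par mk key" and N: "N = n + n" and E: "E \<subseteq> {y}"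
    and y: "y < N" "par y < N" and q: "q = (if y < n then N else N + 1)" and unmarked: "mk (par y) = 0"
  shows "fib_heap n {} (par(y := q)) (mk(par y := 1)) key"
proof -
  let ?par = "par(y := q)" and ?mk = "mk(par y := 1)"
  note D = fib_heapD[OF fh N]
  note D' = fib_heapD[OF fib_heap_mark[OF fib_heap_cut[OF fh N E y q], of "par y"] N]
  have qN: "N \<le> q" "q \<noteq> par y" using q y by auto
  show ?thesis
  proof (rule fib_heapI[OF N])
    show "card {c \<in> kids N ?par p - {}. card (kids N ?par c) + ?mk c < j} \<le> j" (is "card ?S \<le> j")
      if p: "p < N" for p j
    proof -
      have "y \<in> kids N par (par y)" using y by (auto simp: kids_def)
      \<comment> \<open>\<open>y\<close> is a child of its parent, so the truncated subtraction
        \<open>card - 1\<close> really decreases by one.\<close>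
      then have pos: "0 < card (kids N par (par y))" by (auto simp: card_gt_0_iff)
      have "?S \<subseteq> {c \<in> kids N par p - E. card (kids N par c) + mk c < j}"
      proof
        fix c assume c: "c \<in> ?S"
        then have "c \<noteq> y" "c < N" "par c = p" "c \<noteq> q"
          using p qN by (auto simp: kids_def split: if_splits)
        then show "c \<in> {c \<in> kids N par p - E. card (kids N par c) + mk c < j}"
          using c E card_kids_upd[where par=par, OF y(1) qN(2), of c] pos unmarked
          by (auto simp: kids_def split: if_splits)
      qed
      then have "card ?S \<le> card {c \<in> kids N par p - E. card (kids N par c) + mk c < j}"
        by (intro card_mono) auto
      then show ?thesis using D(3)[OF p, of j] by linarith
    qed
  qed (fact D')+
qed

lemma fib_heap_exempt_mono:
  assumes fh: "fib_heap n E par mk key" and "E \<subseteq> E'"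
  shows "fib_heap n E' par mk key"
proof -
  define N where N: "N = n + n"
  note D = fib_heapD[OF fh N]
  have deg: "card {c \<in> kids N par p - E'. card (kids N par c) + mk c < j} \<le> j" (is "card ?S \<le> j") if "p < N" for p j
  proof -
    have "?S \<subseteq> {c \<in> kids N par p - E. card (kids N par c) + mk c < j}"
      using assms(2) by blast
    then have "card ?S \<le> card {c \<in> kids N par p - E. card (kids N par c) + mk c < j}"
      by (intro card_mono) auto
    then show ?thesis using D(3)[OF that, of j] by linarith
  qed
  show ?thesis by (rule fib_heapI[OF N]) (fact D deg)+
qed

text \<open>An exemption concerns an element in its role as a child of another element, and a root
  has no such role.\<close>

lemma fib_heap_exempt_root:
  assumes fh: "fib_heap n E par mk key" and "E \<subseteq> {y}" "n + n \<le> par y"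
  shows "fib_heap n {} par mk key"
proof -
  have "kids (n + n) par p - E = kids (n + n) par p - {}" if "p < n + n" for p
    using assms that by (auto simp: kids_def)
  then show ?thesis
    using fh unfolding fib_heap_def Let_def by auto
qed

text \<open>Virtual nodes carry no degree condition, so only the side conditions are affected. What
  is sent to \<open>N + 3\<close> must be childless, so that nothing hangs below an element outside
  both heaps.\<close>

lemma fib_heap_move_root:
  assumes fh: "fib_heap n E par mk key" and N: "N = n + n"
    and x: "x < N" "N \<le> par x" and q: "N \<le> q" "q = N \<longrightarrow> x < n" "q = N + 1 \<longrightarrow> \<not> x < n"
    and trash: "q = N + 3 \<longrightarrow> kids N par x = {}"
  shows "fib_heap n E (par(x := q)) mk key"
proof -
  let ?par = "par(x := q)"
  have kids: "kids N ?par p = kids N par p" if "p < N" for p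
    using that x q by (auto simp: kids_def)
  have 1: "?par (?par z) \<noteq> N + 3" if "z < N" "?par z < N" for z
    using that fib_heapD(6)[OF fh N, of z] q trash by (auto simp: kids_def split: if_splits)
  have 2: "card {c \<in> kids N ?par p - E. card (kids N ?par c) + mk c < j} \<le> j" if "p < N" for p j
  proof -
    have "{c \<in> kids N ?par p - E. card (kids N ?par c) + mk c < j}
        = {c \<in> kids N par p - E. card (kids N par c) + mk c < j}"
    proof (rule Collect_cong)
      show "(c \<in> kids N ?par p - E \<and> card (kids N ?par c) + mk c < j) =
          (c \<in> kids N par p - E \<and> card (kids N par c) + mk c < j)" for c
        using kids[OF that] kids[of c] by (cases "c < N") (auto simp: kids_def)
    qed
    then show ?thesis using fib_heapD(3)[OF fh N that, of j] by simp
  qed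
  have 3: "\<exists>h :: nat \<Rightarrow> nat. \<forall>z<N. ?par z < N \<longrightarrow> h z < h (?par z)"
  proof -
    obtain h :: "nat \<Rightarrow> nat" where "\<And>x. x < N \<Longrightarrow> par x < N \<Longrightarrow> h x < h (par x)"
      using fib_heapD(2)[OF fh N] by auto
    then show ?thesis using q by (intro exI[of _ h]) auto
  qed
  have 4: "key (?par z) \<le> key z" "z < n \<longleftrightarrow> ?par z < n" if "z < N" "?par z < N" for z
    using that q fib_heapD(1,5)[OF fh N, of z] by (auto split: if_splits)
  have 5: "?par z = N \<Longrightarrow> z < n" "?par z = N + 1 \<Longrightarrow> \<not> z < n" if "z < N" for z
    using that q fib_heapD(7,8)[OF fh N, of z] by (auto split: if_splits)
  show ?thesis by (rule fib_heapI[OF N]) (fact 1 2 3 4 5 fib_heapD(4)[OF fh N])+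
qed

text \<open>The key of a root is compared with those of its children only. A key is therefore
  decreased only after the element has been cut out, and it can be chosen freely when a childless
  element enters a heap.\<close>

lemma fib_heap_key:
  assumes fh: "fib_heap n E par mk key" and N: "N = n + n" and x: "N \<le> par x"
    and k: "k \<le> key x \<or> kids N par x = {}"
  shows "fib_heap n E par mk (key(x := k))"
proof (rule fib_heapI[OF N])
  note D = fib_heapD[OF fh N]
  show "(key(x := k)) (par z) \<le> (key(x := k)) z" if "z < N" "par z < N" for z
    using that D(1)[OF that] x k by (auto simp: kids_def)
qed (fact fib_heapD[OF fh N])+

text \<open>Marks on roots are left out: \<open>cascade\<close> marks every parent that it reaches,
  even a root, and such marks must not be charged for.\<close>

definition marked :: "nat \<Rightarrow> (nat \<Rightarrow> nat) \<Rightarrow> (nat \<Rightarrow> nat) \<Rightarrow> nat set" where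
  "marked N par mk = {x. x < N \<and> par x < N \<and> mk x \<noteq> 0}"

lemma finite_marked [simp]: "finite (marked N par mk)"
  by (simp add: marked_def)

section \<open>Heap operations on the machine\<close>

abbreviation seq :: "com \<Rightarrow> com \<Rightarrow> com" (infixr \<open>;;\<close> 60) where
  "P ;; Q \<equiv> Seq P Q"

text \<open>\<open>base\<close> holds the row starts \<open>p * (N + 4)\<close>, which the machine
  cannot compute by multiplication. The old degree is decremented before the last slot is read, and
  the new one is incremented only after it has served as the insertion index.\<close>

definition move :: com where
  "move =
     NAssign ''mp'' (NArr ''par'' (NVar ''mx'')) ;;
     NArrAssign ''deg'' (NVar ''mp'') (NMinus (NArr ''deg'' (NVar ''mp'')) (NConst 1)) ;;
     NAssign ''ml'' (NArr ''ch'' (NPlus (NArr ''base'' (NVar ''mp'')) (NArr ''deg'' (NVar ''mp'')))) ;;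
     NArrAssign ''ch'' (NPlus (NArr ''base'' (NVar ''mp'')) (NArr ''pos'' (NVar ''mx''))) (NVar ''ml'') ;;
     NArrAssign ''pos'' (NVar ''ml'') (NArr ''pos'' (NVar ''mx'')) ;;
     NArrAssign ''ch'' (NPlus (NArr ''base'' (NVar ''mq'')) (NArr ''deg'' (NVar ''mq''))) (NVar ''mx'') ;;
     NArrAssign ''pos'' (NVar ''mx'') (NArr ''deg'' (NVar ''mq'')) ;;
     NArrAssign ''par'' (NVar ''mx'') (NVar ''mq'') ;;
     NArrAssign ''deg'' (NVar ''mq'') (NPlus (NArr ''deg'' (NVar ''mq'')) (NConst 1))"

definition forest_store :: "nat \<Rightarrow> store \<Rightarrow> bool" where
  "forest_store n \<sigma> \<longleftrightarrow> nvar \<sigma> ''N'' = n + n \<and>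
     (\<forall>p<n + n + 4. narr \<sigma> ''base'' p = p * (n + n + 4)) \<and>
     child_lists (n + n) (narr \<sigma> ''par'') (narr \<sigma> ''ch'') (narr \<sigma> ''pos'') (narr \<sigma> ''deg'')"

lemma forest_store_cong:
  assumes "nvar \<sigma>' ''N'' = nvar \<sigma> ''N''" "narr \<sigma>' ''base'' = narr \<sigma> ''base''"
    "narr \<sigma>' ''par'' = narr \<sigma> ''par''" "narr \<sigma>' ''ch'' = narr \<sigma> ''ch''"
    "narr \<sigma>' ''pos'' = narr \<sigma> ''pos''" "narr \<sigma>' ''deg'' = narr \<sigma> ''deg''"
  shows "forest_store n \<sigma>' = forest_store n \<sigma>"
  unfolding forest_store_def assms ..

lemma forest_storeD:
  assumes "forest_store n \<sigma>" "N = n + n"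
  shows "nvar \<sigma> ''N'' = N"
    and "p < N + 4 \<Longrightarrow> narr \<sigma> ''base'' p = p * (N + 4)"
    and "p < N + 4 \<Longrightarrow> narr \<sigma> ''deg'' p = card (kids N (narr \<sigma> ''par'') p)"
    and "x < N \<Longrightarrow> narr \<sigma> ''par'' x < N + 4"
    and "p < N + 4 \<Longrightarrow> i < card (kids N (narr \<sigma> ''par'') p) \<Longrightarrow>
      narr \<sigma> ''ch'' (narr \<sigma> ''base'' p + i) \<in> kids N (narr \<sigma> ''par'') p"
  using assms child_lists_deg[of N "narr \<sigma> ''par''" "narr \<sigma> ''ch''" "narr \<sigma> ''pos''" "narr \<sigma> ''deg''" p]
  unfolding forest_store_def child_lists_def kids_def by auto

lemma move_mods [simp]:
  "nvar_mods move = {''mp'', ''ml''}" "narr_mods move = {''deg'', ''ch'', ''pos'', ''par''}" "rarr_mods move = {}"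
  by (auto simp: move_def)

lemma wp_move:
  assumes "forest_store n \<sigma>" and N: "N = n + n" and x: "nvar \<sigma> ''mx'' = x" "x < N"
    and q: "nvar \<sigma> ''mq'' = q" "q < N + 4" "q \<noteq> narr \<sigma> ''par'' x"
  shows "wp move (\<lambda>t \<sigma>'. t \<le> 60 \<and> forest_store n \<sigma>' \<and> narr \<sigma>' ''par'' = (narr \<sigma> ''par'')(x := q) \<and>
    unmodified move \<sigma> \<sigma>') \<sigma>"
proof -
  have cl: "child_lists N (narr \<sigma> ''par'') (narr \<sigma> ''ch'') (narr \<sigma> ''pos'') (narr \<sigma> ''deg'')"
    using assms(1) unfolding forest_store_def N by blast
  have b: "\<forall>p<N + 4. narr \<sigma> ''base'' p = p * (N + 4)"
    using assms(1) unfolding forest_store_def N by blast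
  have p: "narr \<sigma> ''par'' x < N + 4"
    using forest_storeD(4)[OF assms(1) N x(2)] .
  show ?thesis
    apply (rule wp_frame[where Q="\<lambda>t \<sigma>'. t \<le> 60 \<and> forest_store n \<sigma>' \<and> narr \<sigma>' ''par'' = (narr \<sigma> ''par'')(x := q)"])
     apply (simp add: wp_simps move_def x q)
     apply (simp add: forest_store_def flip: N)
    using child_lists_move[OF cl x(2) q(2,3) refl] b p x q forest_storeD(1)[OF assms(1) N]
     apply (simp add: fun_upd_twist)
    apply simp
    done
qed

text \<open>The potential of Fibonacci heaps, roots plus twice the marked elements, scaled by 1000
  so that it dominates the cost of an elementary heap step. Bucketed roots count as roots; elements
  outside both heaps do not.\<close>

definition potential :: "nat \<Rightarrow> store \<Rightarrow> nat" where
  "potential n \<sigma> = (let N = n + n; par = narr \<sigma> ''par'' in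
     1000 * (card (kids N par N) + card (kids N par (N + 1)) + card (kids N par (N + 2)))
     + 2000 * card (marked N par (narr \<sigma> ''mk'')))"

lemma potential_cong:
  "narr \<sigma>' ''par'' = narr \<sigma> ''par'' \<Longrightarrow> narr \<sigma>' ''mk'' = narr \<sigma> ''mk'' \<Longrightarrow> potential n \<sigma>' = potential n \<sigma>"
  by (simp add: potential_def)

text \<open>\<open>u\<close> becomes a root, so its mark no longer counts; the parent can contribute
  a new one only if it was unmarked.\<close>

lemma card_marked_cut:
  assumes "u < N" "par u < N" "mk u \<noteq> 0" "N \<le> q"
  shows "card (marked N (par(u := q)) (mk(par u := 1))) + (if mk (par u) = 0 then 0 else 1) \<le> card (marked N par mk)"
proof -
  let ?M = "marked N par mk" and ?M' = "marked N (par(u := q)) (mk(par u := 1))"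
  have u: "u \<in> ?M" using assms by (simp add: marked_def)
  then have c: "card (?M - {u}) + 1 = card ?M" using card_Suc_Diff1[of ?M u] by simp
  show ?thesis
  proof (cases "mk (par u) = 0")
    case True
    have "?M' \<subseteq> insert (par u) (?M - {u})" using assms by (auto simp: marked_def split: if_splits)
    then have "card ?M' \<le> card (insert (par u) (?M - {u}))" by (intro card_mono) auto
    also have "\<dots> \<le> card (?M - {u}) + 1" by (simp add: card_insert_if)
    finally show ?thesis using c True by simp
  next
    case False
    have "?M' \<subseteq> ?M - {u}" using assms False by (auto simp: marked_def split: if_splits)
    then have "card ?M' \<le> card (?M - {u})" by (intro card_mono) auto
    then show ?thesis using c False by simp
  qed
qed

lemma card_marked_insert: "card (marked N par (mk(u := 1))) \<le> card (marked N par mk) + 1"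
proof -
  have "card (marked N par (mk(u := 1))) \<le> card (insert u (marked N par mk))"
    by (intro card_mono) (auto simp: marked_def split: if_splits)
  also have "\<dots> \<le> card (marked N par mk) + 1" by (simp add: card_insert_if)
  finally show ?thesis .
qed

section \<open>Cascading cuts\<close>

definition cascade_test :: bexp where
  "cascade_test = BAnd (NLess (NConst 0) (NVar ''go'')) (NLess (NArr ''par'' (NVar ''u'')) (NVar ''N''))"

definition cascade_body :: com where
  "cascade_body =
     NAssign ''up'' (NArr ''par'' (NVar ''u'')) ;;
     NAssign ''mx'' (NVar ''u'') ;;
     NAssign ''mq'' (NVar ''R'') ;;
     move ;;
     NAssign ''go'' (NArr ''mk'' (NVar ''up'')) ;;
     NArrAssign ''mk'' (NVar ''up'') (NConst 1) ;;
     NAssign ''u'' (NVar ''up'')"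

text \<open>Marking \<open>u\<close> beforehand lets the requested cut and the subsequent ones share
  a loop body. \<open>go\<close> is the mark that the parent had before the cut, so the loop climbs
  through marked elements and ends after marking an unmarked one, or at a root.\<close>

definition cascade :: com where
  "cascade =
     NArrAssign ''mk'' (NVar ''u'') (NConst 1) ;;
     NAssign ''go'' (NConst 1) ;;
     While cascade_test cascade_body"

lemma cascade_mods [simp]:
  "nvar_mods cascade = {''mp'', ''ml'', ''go'', ''u'', ''up'', ''mx'', ''mq''}"
  "narr_mods cascade = {''deg'', ''ch'', ''pos'', ''par'', ''mk''}" "rarr_mods cascade = {}"
  by (auto simp: cascade_def cascade_body_def)

text \<open>As long as \<open>go\<close> is positive, the current \<open>u\<close> may violate the
  degree condition and is exempt from it. From the first iteration on, \<open>x\<close> is a root.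
  The other clauses say that no element enters or leaves a heap.\<close>

definition cascade_inv :: "nat \<Rightarrow> (nat \<Rightarrow> nat) \<Rightarrow> (nat \<Rightarrow> real) \<Rightarrow> nat \<Rightarrow> nat \<Rightarrow> store \<Rightarrow> bool" where
  "cascade_inv n par0 key R x \<sigma> \<longleftrightarrow> (let N = n + n; par = narr \<sigma> ''par''; u = nvar \<sigma> ''u''; go = nvar \<sigma> ''go'' in
     forest_store n \<sigma> \<and> nvar \<sigma> ''R'' = R \<and> R = (if x < n then N else N + 1) \<and> x < N \<and>
     u < N \<and> (u < n \<longleftrightarrow> x < n) \<and> fib_heap n (if 0 < go then {u} else {}) par (narr \<sigma> ''mk'') key \<and>
     (0 < go \<longrightarrow> narr \<sigma> ''mk'' u \<noteq> 0) \<and> (0 < go \<and> u = x \<or> N \<le> par x) \<and>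
     (\<forall>z<N. par z = N + 3 \<longleftrightarrow> par0 z = N + 3) \<and>
     kids N par (N + 2) = kids N par0 (N + 2))"

text \<open>The extra 2000 pays for an iteration that meets an unmarked parent: there the mark
  released by \<open>u\<close> may reappear on the parent, whereas otherwise it is freed for
  good.\<close>

definition cascade_pot :: "nat \<Rightarrow> store \<Rightarrow> nat" where
  "cascade_pot n \<sigma> = potential n \<sigma> + (if 0 < nvar \<sigma> ''go'' then 2000 else 0)"

lemma wp_cascade_body:
  assumes inv: "cascade_inv n par0 key R x \<sigma>" and test: "bval cascade_test \<sigma>"
  shows "wp cascade_body (\<lambda>t \<sigma>'. cascade_inv n par0 key R x \<sigma>' \<and>
    1 + bcost cascade_test + t + cascade_pot n \<sigma>' \<le> cascade_pot n \<sigma>) \<sigma>"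
proof -
  define N where N: "N = n + n"
  define par where "par = narr \<sigma> ''par''"
  define mk where "mk = narr \<sigma> ''mk''"
  define u where "u = nvar \<sigma> ''u''"
  note inv' = inv[unfolded cascade_inv_def Let_def, folded N par_def mk_def u_def]
  have go: "0 < nvar \<sigma> ''go''" and pu: "par u < N"
    using test inv' forest_storeD(1)[OF _ N, of \<sigma>] by (auto simp: cascade_test_def par_def u_def)
  have i: "forest_store n \<sigma>" "nvar \<sigma> ''R'' = R" "R = (if x < n then N else N + 1)" "x < N" "u < N"
    "u < n \<longleftrightarrow> x < n" "mk u \<noteq> 0" "u = x \<or> N \<le> par x" "\<forall>z<N. par z = N + 3 \<longleftrightarrow> par0 z = N + 3"
    "kids N par (N + 2) = kids N par0 (N + 2)"
    and fh: "fib_heap n {u} par mk key"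
    using inv' go by auto
  have R: "R < N + 4" "R \<noteq> par u" "N \<le> R" "R \<noteq> N + 2" "R \<noteq> N + 3" using i pu by auto
  have Ru: "R = (if u < n then N else N + 1)" using i by simp
  define par' where "par' = par(u := R)"
  define mk' where "mk' = mk(par u := 1)"
  have side: "par u < n \<longleftrightarrow> x < n" using fib_heapD(5)[OF fh N i(5) pu] i(6) by simp
  \<comment> \<open>A marked parent inherits the exemption and is treated next; at an unmarked one
    the new mark makes up for the lost child.\<close>
  have fh': "fib_heap n (if 0 < mk (par u) then {par u} else {}) par' mk' key"
    using fib_heap_cut_unmarked[OF fh N _ i(5) pu Ru] fib_heap_mark[OF fib_heap_cut[OF fh N _ i(5) pu Ru]]
    by (auto simp: par'_def mk'_def)
  have xroot: "N \<le> par' x" using i(8) R(3) by (auto simp: par'_def)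
  have trash: "\<forall>z<N. par' z = N + 3 \<longleftrightarrow> par0 z = N + 3" using i(9) i(9)[rule_format, OF i(5)] R(5) pu by (simp add: par'_def)
  have kR: "card (kids N par' R) = card (kids N par R) + 1"
    using card_kids_upd[where par=par, OF i(5) R(2)] by (simp add: par'_def)
  have kO: "kids N par' q = kids N par q" if "q \<noteq> R" "N \<le> q" for q
    using that pu by (auto simp: kids_def par'_def)
  have roots: "card (kids N par' N) + card (kids N par' (N + 1)) + card (kids N par' (N + 2))
      = card (kids N par N) + card (kids N par (N + 1)) + card (kids N par (N + 2)) + 1"
    using kR kO[of N] kO[of "N + 1"] kO[of "N + 2"] i(3) by (auto split: if_splits)
  have marks: "card (marked N par' mk') + (if mk (par u) = 0 then 0 else 1) \<le> card (marked N par mk)"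
    unfolding par'_def mk'_def by (rule card_marked_cut[where par=par and mk=mk, OF i(5) pu i(7) R(3)])
  \<comment> \<open>The new root costs 1000, while a mark or the credit of \<open>go\<close>
    releases 2000. The remaining 1000 pays for the iteration.\<close>
  have pots: "1000 * (card (kids N par' N) + card (kids N par' (N + 1)) + card (kids N par' (N + 2)))
       + 2000 * card (marked N par' mk') + (if 0 < mk (par u) then 2000 else 0) + 1000
     \<le> cascade_pot n \<sigma>"
    using roots marks go
    by (simp add: cascade_pot_def potential_def Let_def flip: N par_def mk_def split: if_splits)
  define \<sigma>1 where "\<sigma>1 = \<sigma>\<lparr>nvar := (nvar \<sigma>)(''up'' := par u, ''mx'' := u, ''mq'' := R)\<rparr>"
  have "wp move (\<lambda>t \<sigma>'. t \<le> 60 \<and> forest_store n \<sigma>' \<and> narr \<sigma>' ''par'' = (narr \<sigma>1 ''par'')(u := R) \<and>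
      unmodified move \<sigma>1 \<sigma>') \<sigma>1"
    by (rule wp_move[OF _ N]) (use i(1,5) R in \<open>simp_all add: \<sigma>1_def par_def forest_store_def\<close>)
  then have "wp move (\<lambda>t \<sigma>'. wp (NAssign ''go'' (NArr ''mk'' (NVar ''up'')) ;;
     NArrAssign ''mk'' (NVar ''up'') (NConst 1) ;;
     NAssign ''u'' (NVar ''up'')) (\<lambda>t' \<sigma>'. cascade_inv n par0 key R x \<sigma>' \<and>
    1 + bcost cascade_test + (7 + t + t') + cascade_pot n \<sigma>' \<le> cascade_pot n \<sigma>) \<sigma>') \<sigma>1"
  proof (rule wp_mono)
    fix t :: nat and \<sigma>'
    assume *: "t \<le> 60 \<and> forest_store n \<sigma>' \<and> narr \<sigma>' ''par'' = (narr \<sigma>1 ''par'')(u := R) \<and> unmodified move \<sigma>1 \<sigma>'"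
    then have um: "unmodified move \<sigma>1 \<sigma>'" by blast
    define \<sigma>2 where "\<sigma>2 = \<sigma>'\<lparr>nvar := (nvar \<sigma>')(''go'' := mk (par u), ''u'' := par u),
      narr := (narr \<sigma>')(''mk'' := mk')\<rparr>"
    have up: "nvar \<sigma>' ''up'' = par u" "nvar \<sigma>' ''R'' = R" "narr \<sigma>' ''mk'' = mk"
      using unmodifiedD(1)[OF um, of "''up''"] unmodifiedD(1)[OF um, of "''R''"] unmodifiedD(2)[OF um, of "''mk''"] i(2)
      by (simp_all add: \<sigma>1_def mk_def)
    have 2: "narr \<sigma>2 ''par'' = par'" "narr \<sigma>2 ''mk'' = mk'" "nvar \<sigma>2 ''u'' = par u" "nvar \<sigma>2 ''go'' = mk (par u)"
      "nvar \<sigma>2 ''R'' = R"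
      using * up by (simp_all add: \<sigma>2_def \<sigma>1_def par'_def par_def)
    have fs2: "forest_store n \<sigma>2"
      using * forest_store_cong[of \<sigma>2 \<sigma>' n] by (simp add: \<sigma>2_def)
    have "cascade_inv n par0 key R x \<sigma>2"
      unfolding cascade_inv_def Let_def 2 N[symmetric]
      using fs2 i(3,4) pu side fh' xroot trash kO[of "N + 2"] R(4) i(10)
      by (simp add: mk'_def)
    moreover have "cascade_pot n \<sigma>2 + 1000 \<le> cascade_pot n \<sigma>"
      unfolding cascade_pot_def[of n \<sigma>2] potential_def Let_def 2 N[symmetric] using pots by simp
    ultimately show "wp (NAssign ''go'' (NArr ''mk'' (NVar ''up'')) ;;
     NArrAssign ''mk'' (NVar ''up'') (NConst 1) ;;
     NAssign ''u'' (NVar ''up'')) (\<lambda>t' \<sigma>'. cascade_inv n par0 key R x \<sigma>' \<and>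
    1 + bcost cascade_test + (7 + t + t') + cascade_pot n \<sigma>' \<le> cascade_pot n \<sigma>) \<sigma>'"
      using * by (simp add: wp_simps up \<sigma>2_def cascade_test_def mk'_def)
  qed
  then show ?thesis
    unfolding cascade_body_def wp_simps(1-5)
    by (simp add: \<sigma>1_def i(2) flip: par_def u_def) (erule wp_mono, simp)
qed

text \<open>The surcharge consists of 2000 for the artificial mark on \<open>x\<close>, 2000 for the
  credit of \<open>go\<close>, and a rest for the instructions outside the loop body.\<close>

lemma wp_cascade:
  assumes fs: "forest_store n \<sigma>" and N: "N = n + n" and u: "nvar \<sigma> ''u'' = x" "x < N"
    and R: "nvar \<sigma> ''R'' = (if x < n then N else N + 1)"
    and fh: "fib_heap n {} (narr \<sigma> ''par'') (narr \<sigma> ''mk'') key"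
  shows "wp cascade (\<lambda>t \<sigma>'. forest_store n \<sigma>' \<and> fib_heap n {} (narr \<sigma>' ''par'') (narr \<sigma>' ''mk'') key \<and>
    N \<le> narr \<sigma>' ''par'' x \<and>
    (\<forall>z<N. narr \<sigma>' ''par'' z = N + 3 \<longleftrightarrow> narr \<sigma> ''par'' z = N + 3) \<and>
    kids N (narr \<sigma>' ''par'') (N + 2) = kids N (narr \<sigma> ''par'') (N + 2) \<and>
    t + potential n \<sigma>' \<le> potential n \<sigma> + 4100 \<and> unmodified cascade \<sigma> \<sigma>') \<sigma>"
  (is "wp cascade ?Q \<sigma>")
proof -
  define \<sigma>1 where "\<sigma>1 = \<sigma>\<lparr>narr := (narr \<sigma>)(''mk'' := (narr \<sigma> ''mk'')(x := 1)), nvar := (nvar \<sigma>)(''go'' := 1)\<rparr>"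
  let ?inv = "cascade_inv n (narr \<sigma> ''par'') key (nvar \<sigma> ''R'') x"
  have 1: "narr \<sigma>1 ''par'' = narr \<sigma> ''par''" "narr \<sigma>1 ''mk'' = (narr \<sigma> ''mk'')(x := 1)" "nvar \<sigma>1 ''go'' = 1"
    "nvar \<sigma>1 ''u'' = x" "nvar \<sigma>1 ''R'' = nvar \<sigma> ''R''" "forest_store n \<sigma>1"
    using fs u by (simp_all add: \<sigma>1_def forest_store_def)
  have "fib_heap n {x} (narr \<sigma> ''par'') ((narr \<sigma> ''mk'')(x := 1)) key"
    using fib_heap_exempt_mono[OF fib_heap_mark[OF fh]] by blast
  then have inv: "?inv \<sigma>1"
    unfolding cascade_inv_def Let_def 1 N[symmetric] using 1(6) R u by simp
  have pot: "cascade_pot n \<sigma>1 \<le> potential n \<sigma> + 4000"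
    unfolding cascade_pot_def potential_def Let_def 1 using card_marked_insert[of "n + n" "narr \<sigma> ''par''" "narr \<sigma> ''mk''" x]
    by simp
  have "wp (While cascade_test cascade_body) (\<lambda>t \<sigma>'. ?inv \<sigma>' \<and> \<not> bval cascade_test \<sigma>' \<and>
      t + cascade_pot n \<sigma>' \<le> cascade_pot n \<sigma>1 + 1 + bcost cascade_test) \<sigma>1"
    by (rule wp_While[where \<Phi>="cascade_pot n", OF wp_cascade_body inv])
  then have "wp (While cascade_test cascade_body) (\<lambda>t \<sigma>'. forest_store n \<sigma>' \<and>
      fib_heap n {} (narr \<sigma>' ''par'') (narr \<sigma>' ''mk'') key \<and>
    N \<le> narr \<sigma>' ''par'' x \<and>
    (\<forall>z<N. narr \<sigma>' ''par'' z = N + 3 \<longleftrightarrow> narr \<sigma> ''par'' z = N + 3) \<and>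
    kids N (narr \<sigma>' ''par'') (N + 2) = kids N (narr \<sigma> ''par'') (N + 2) \<and>
    5 + t + potential n \<sigma>' \<le> potential n \<sigma> + 4100) \<sigma>1"
  proof (rule wp_mono)
    fix t :: nat and \<sigma>'
    assume *: "?inv \<sigma>' \<and> \<not> bval cascade_test \<sigma>' \<and>
      t + cascade_pot n \<sigma>' \<le> cascade_pot n \<sigma>1 + 1 + bcost cascade_test"
    then have i: "forest_store n \<sigma>'" "fib_heap n (if 0 < nvar \<sigma>' ''go'' then {nvar \<sigma>' ''u''} else {}) (narr \<sigma>' ''par'') (narr \<sigma>' ''mk'') key"
      "0 < nvar \<sigma>' ''go'' \<and> nvar \<sigma>' ''u'' = x \<or> N \<le> narr \<sigma>' ''par'' x"
      "\<forall>z<N. narr \<sigma>' ''par'' z = N + 3 \<longleftrightarrow> narr \<sigma> ''par'' z = N + 3"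
      "kids N (narr \<sigma>' ''par'') (N + 2) = kids N (narr \<sigma> ''par'') (N + 2)"
      unfolding cascade_inv_def Let_def N[symmetric] by blast+
    \<comment> \<open>Either the cascade ended with an unmarked parent, which leaves no exemption,
      or the exempt \<open>u\<close> is a root, where the exemption is vacuous.\<close>
    have exit: "nvar \<sigma>' ''go'' = 0 \<or> N \<le> narr \<sigma>' ''par'' (nvar \<sigma>' ''u'')"
      using * forest_storeD(1)[OF i(1) N] by (auto simp: cascade_test_def)
    then have "fib_heap n {} (narr \<sigma>' ''par'') (narr \<sigma>' ''mk'') key"
      using i(2) fib_heap_exempt_root[OF i(2)] N by (cases "nvar \<sigma>' ''go'' = 0") auto
    moreover have "N \<le> narr \<sigma>' ''par'' x" using exit i(3) by auto
    moreover have "5 + t + potential n \<sigma>' \<le> potential n \<sigma> + 4100"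
      using * pot by (simp add: cascade_pot_def cascade_test_def)
    ultimately show "forest_store n \<sigma>' \<and>
      fib_heap n {} (narr \<sigma>' ''par'') (narr \<sigma>' ''mk'') key \<and>
    N \<le> narr \<sigma>' ''par'' x \<and>
    (\<forall>z<N. narr \<sigma>' ''par'' z = N + 3 \<longleftrightarrow> narr \<sigma> ''par'' z = N + 3) \<and>
    kids N (narr \<sigma>' ''par'') (N + 2) = kids N (narr \<sigma> ''par'') (N + 2) \<and>
    5 + t + potential n \<sigma>' \<le> potential n \<sigma> + 4100"
      using i by blast
  qed
  then have "wp cascade (\<lambda>t \<sigma>'. forest_store n \<sigma>' \<and> fib_heap n {} (narr \<sigma>' ''par'') (narr \<sigma>' ''mk'') key \<and>
    N \<le> narr \<sigma>' ''par'' x \<and>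
    (\<forall>z<N. narr \<sigma>' ''par'' z = N + 3 \<longleftrightarrow> narr \<sigma> ''par'' z = N + 3) \<and>
    kids N (narr \<sigma>' ''par'') (N + 2) = kids N (narr \<sigma> ''par'') (N + 2) \<and>
    t + potential n \<sigma>' \<le> potential n \<sigma> + 4100) \<sigma>"
    by (simp add: cascade_def wp_simps \<sigma>1_def u(1))
  then show ?thesis
    by (rule wp_frame) blast
qed

section \<open>Consolidation with buckets indexed by degree\<close>

definition consolidating ::
  "nat \<Rightarrow> nat \<Rightarrow> (nat \<Rightarrow> nat) \<Rightarrow> (nat \<Rightarrow> nat) \<Rightarrow> (nat \<Rightarrow> real) \<Rightarrow> (nat \<Rightarrow> nat) \<Rightarrow> bool" where
  "consolidating n R par mk key B \<longleftrightarrow> (let N = n + n in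
     fib_heap n {} par mk key \<and> (\<forall>x\<in>kids N par (N + 2). x < n \<longleftrightarrow> R = N) \<and>
     (\<forall>d. B d \<noteq> 0 \<longrightarrow> (\<exists>v. B d = Suc v \<and> v \<in> kids N par (N + 2) \<and> card (kids N par v) = d)) \<and>
     (\<forall>v\<in>kids N par (N + 2). B (card (kids N par v)) = Suc v))"

lemma consolidatingD:
  assumes "consolidating n R par mk key B" "N = n + n"
  shows "fib_heap n {} par mk key"
    and "\<And>x. x \<in> kids N par (N + 2) \<Longrightarrow> x < n \<longleftrightarrow> R = N"
    and "\<And>d v. B d = Suc v \<Longrightarrow> v \<in> kids N par (N + 2) \<and> card (kids N par v) = d"
    and "\<And>v. v \<in> kids N par (N + 2) \<Longrightarrow> B (card (kids N par v)) = Suc v"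
proof -
  note * = assms(1)[unfolded consolidating_def Let_def, folded assms(2)]
  show "fib_heap n {} par mk key" using * by blast
  show "x < n \<longleftrightarrow> R = N" if "x \<in> kids N par (N + 2)" for x using * that by blast
  show "v \<in> kids N par (N + 2) \<and> card (kids N par v) = d" if "B d = Suc v" for d v
  proof -
    have "B d \<noteq> 0" using that by simp
    then obtain w where "B d = Suc w" "w \<in> kids N par (N + 2)" "card (kids N par w) = d" using * by blast
    then show ?thesis using that by simp
  qed
  show "B (card (kids N par v)) = Suc v" if "v \<in> kids N par (N + 2)" for v using * that by blast
qed

lemma consolidatingI:
  assumes "N = n + n" "fib_heap n {} par mk key"
    and "\<And>x. x \<in> kids N par (N + 2) \<Longrightarrow> x < n \<longleftrightarrow> R = N"
    and "\<And>d v. B d = Suc v \<Longrightarrow> v \<in> kids N par (N + 2) \<and> card (kids N par v) = d"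
    and "\<And>v. v \<in> kids N par (N + 2) \<Longrightarrow> B (card (kids N par v)) = Suc v"
  shows "consolidating n R par mk key B"
proof -
  \<comment> \<open>Buckets contain \<open>Suc v\<close>, because 0, the initial content of memory,
    means empty.\<close>
  have "\<exists>v. B d = Suc v \<and> v \<in> kids N par (N + 2) \<and> card (kids N par v) = d" if "B d \<noteq> 0" for d
    using assms(4)[of d "B d - 1"] that by (intro exI[of _ "B d - 1"]) simp
  then show ?thesis
    using assms(2,3,5) unfolding consolidating_def Let_def assms(1)[symmetric] by blast
qed

lemma kids_side:
  assumes "fib_heap n E par mk key" "N = n + n" "R = N \<or> R = N + 1" "u \<in> kids N par R"
  shows "u < n \<longleftrightarrow> R = N"
  using fib_heapD(7,8)[OF assms(1,2), of u] assms(3,4) by (auto simp: kids_def)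

lemma consolidating_bucket:
  assumes con: "consolidating n R par mk key B" and N: "N = n + n" and R: "R = N \<or> R = N + 1"
    and u: "u \<in> kids N par R" and B: "B (card (kids N par u)) = 0"
  shows "consolidating n R (par(u := N + 2)) mk key (B(card (kids N par u) := Suc u))"
proof -
  note D = consolidatingD[OF con N]
  have u': "u < N" "par u = R" "N + 2 \<noteq> par u" using u R by (auto simp: kids_def)
  have k: "kids N (par(u := N + 2)) (N + 2) = insert u (kids N par (N + 2))"
    using kids_upd[where par=par, OF u'(1,3), of "N + 2"] by simp
  have kk: "kids N (par(u := N + 2)) v = kids N par v" if "v < N" for v
    using kids_upd[where par=par, OF u'(1,3), of v] that u' R by auto
  show ?thesis
  proof (rule consolidatingI[OF N])
    show "fib_heap n {} (par(u := N + 2)) mk key"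
      using fib_heap_move_root[OF D(1) N u'(1), of "N + 2"] u' R by auto
    show "x < n \<longleftrightarrow> R = N" if "x \<in> kids N (par(u := N + 2)) (N + 2)" for x
      using that D(2) kids_side[OF D(1) N R u] unfolding k by blast
    show "v \<in> kids N (par(u := N + 2)) (N + 2) \<and> card (kids N (par(u := N + 2)) v) = d"
      if "(B(card (kids N par u) := Suc u)) d = Suc v" for d v
    proof (cases "d = card (kids N par u)")
      case True
      then show ?thesis using that k kk[OF u'(1)] by simp
    next
      case False
      then have v: "v \<in> kids N par (N + 2) \<and> card (kids N par v) = d" using that D(3) by simp
      then have "v < N" by (simp add: kids_def)
      then show ?thesis using v k kk by simp
    qed
    show "(B(card (kids N par u) := Suc u)) (card (kids N (par(u := N + 2)) v)) = Suc v"
      if "v \<in> kids N (par(u := N + 2)) (N + 2)" for v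
    proof (cases "v = u")
      case True
      then show ?thesis using kk[OF u'(1)] by simp
    next
      case False
      then have v: "v \<in> kids N par (N + 2)" using that k by simp
      then have "v < N" by (simp add: kids_def)
      then show ?thesis using D(4)[OF v] kk[of v] B by auto
    qed
  qed
qed

lemma consolidating_pick:
  assumes con: "consolidating n R par mk key B" and N: "N = n + n" and R: "R = N \<or> R = N + 1"
    and u: "u \<in> kids N par R" and B: "B (card (kids N par u)) = Suc v"
  shows "v < N" "par v = N + 2" "u < N" "par u = R" "u \<noteq> v" "card (kids N par u) = card (kids N par v)"
    "u < n \<longleftrightarrow> v < n" "v < n \<longleftrightarrow> R = N"
proof -
  note D = consolidatingD[OF con N]
  have v: "v \<in> kids N par (N + 2)" "card (kids N par v) = card (kids N par u)" using D(3)[OF B] by auto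
  then show "v < N" "par v = N + 2" "u < N" "par u = R" "u \<noteq> v" "card (kids N par u) = card (kids N par v)"
    using u R by (auto simp: kids_def)
  show "v < n \<longleftrightarrow> R = N" using D(2)[OF v(1)] .
  then show "u < n \<longleftrightarrow> v < n" using kids_side[OF D(1) N R u] by simp
qed

text \<open>Both outcomes of a comparison take \<open>v\<close> out of the bucketed roots and touch the child lists of
  \<open>u\<close> and \<open>v\<close> only.\<close>

lemma consolidating_unbucket:
  assumes con: "consolidating n R par mk key B" and N: "N = n + n" and R: "R = N \<or> R = N + 1"
    and u: "u \<in> kids N par R" and B: "B (card (kids N par u)) = Suc v"
    and fh: "fib_heap n {} par' mk' key"
    and k: "kids N par' (N + 2) = kids N par (N + 2) - {v}"
    and kk: "\<And>w. w < N \<Longrightarrow> w \<noteq> u \<Longrightarrow> w \<noteq> v \<Longrightarrow> kids N par' w = kids N par w"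
  shows "consolidating n R par' mk' key (B(card (kids N par u) := 0))"
proof (rule consolidatingI[OF N fh])
  note D = consolidatingD[OF con N]
  note P = consolidating_pick[OF con N R u B]
  show "x < n \<longleftrightarrow> R = N" if "x \<in> kids N par' (N + 2)" for x
    using that D(2) unfolding k by blast
  show "w \<in> kids N par' (N + 2) \<and> card (kids N par' w) = d"
    if "(B(card (kids N par u) := 0)) d = Suc w" for d w
  proof -
    have d: "d \<noteq> card (kids N par u)" "B d = Suc w" using that by (auto split: if_splits)
    then have w: "w \<in> kids N par (N + 2)" "card (kids N par w) = d" using D(3) by auto
    then have "w \<noteq> v" using d P(6) by auto
    moreover have "w < N" "w \<noteq> u" using w P(4) R by (auto simp: kids_def)
    ultimately show ?thesis using w k kk by simp
  qed
  show "(B(card (kids N par u) := 0)) (card (kids N par' w)) = Suc w" if "w \<in> kids N par' (N + 2)" for w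
  proof -
    have w: "w \<in> kids N par (N + 2)" "w \<noteq> v" using that k by auto
    then have "w < N" "w \<noteq> u" using P(4) R by (auto simp: kids_def)
    then have eq: "kids N par' w = kids N par w" using kk w by simp
    have "card (kids N par w) \<noteq> card (kids N par u)" using D(4)[OF w(1)] B w(2) by auto
    then show ?thesis using D(4)[OF w(1)] eq by simp
  qed
qed

text \<open>\<open>u\<close> stays among the unprocessed roots, to be examined again with its new
  degree; only \<open>v\<close> leaves, together with its bucket entry.\<close>

lemma consolidating_lose:
  assumes con: "consolidating n R par mk key B" and N: "N = n + n" and R: "R = N \<or> R = N + 1"
    and u: "u \<in> kids N par R" and B: "B (card (kids N par u)) = Suc v" and key: "key u \<le> key v"
  shows "consolidating n R (par(v := u)) (mk(v := 0)) key (B(card (kids N par u) := 0))"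
proof (rule consolidating_unbucket[OF con N R u B])
  note P = consolidating_pick[OF con N R u B]
  have uv: "u \<noteq> par v" using P by auto
  show "fib_heap n {} (par(v := u)) (mk(v := 0)) key"
    by (rule fib_heap_link[OF consolidatingD(1)[OF con N] N]) (use P R key in auto)
  show "kids N (par(v := u)) (N + 2) = kids N par (N + 2) - {v}"
    using kids_upd[where par=par, OF P(1) uv, of "N + 2"] P by simp
  show "kids N (par(v := u)) w = kids N par w" if "w < N" "w \<noteq> u" "w \<noteq> v" for w
    using kids_upd[where par=par, OF P(1) uv, of w] that P by simp
qed

text \<open>The bucketed root \<open>v\<close> gains a child and no longer fits its bucket, so it
  goes back to the unprocessed roots in place of \<open>u\<close>.\<close>

lemma consolidating_win:
  assumes con: "consolidating n R par mk key B" and N: "N = n + n" and R: "R = N \<or> R = N + 1"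
    and u: "u \<in> kids N par R" and B: "B (card (kids N par u)) = Suc v" and key: "key v \<le> key u"
  shows "consolidating n R (par(u := v, v := R)) (mk(u := 0)) key (B(card (kids N par u) := 0))"
proof (rule consolidating_unbucket[OF con N R u B])
  note P = consolidating_pick[OF con N R u B]
  have "fib_heap n {} (par(u := v)) (mk(u := 0)) key"
    by (rule fib_heap_link[OF consolidatingD(1)[OF con N] N]) (use P R key in auto)
  then show "fib_heap n {} (par(u := v, v := R)) (mk(u := 0)) key"
    by (rule fib_heap_move_root[OF _ N P(1)]) (use P R in auto)
  show "kids N (par(u := v, v := R)) (N + 2) = kids N par (N + 2) - {v}"
    using P R by (auto simp: kids_def)
  show "kids N (par(u := v, v := R)) w = kids N par w" if "w < N" "w \<noteq> u" "w \<noteq> v" for w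
    using P R that by (auto simp: kids_def)
qed

lemma consolidating_return:
  assumes con: "consolidating n R par mk key B" and N: "N = n + n" and R: "R = N \<or> R = N + 1"
    and v: "v \<in> kids N par (N + 2)"
  shows "consolidating n R (par(v := R)) mk key (B(card (kids N par v) := 0))"
proof (rule consolidatingI[OF N])
  note D = consolidatingD[OF con N]
  have v': "v < N" "par v = N + 2" "R \<noteq> par v" using v R by (auto simp: kids_def)
  have k: "kids N (par(v := R)) (N + 2) = kids N par (N + 2) - {v}"
    using kids_upd[where par=par, OF v'(1,3), of "N + 2"] v' by simp
  have kk: "kids N (par(v := R)) w = kids N par w" if "w < N" for w
    using kids_upd[where par=par, OF v'(1,3), of w] that v' R by auto
  show "fib_heap n {} (par(v := R)) mk key"
    by (rule fib_heap_move_root[OF D(1) N v'(1)]) (use v' R D(2)[OF v] in auto)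
  show "x < n \<longleftrightarrow> R = N" if "x \<in> kids N (par(v := R)) (N + 2)" for x
    using that D(2) unfolding k by blast
  show "w \<in> kids N (par(v := R)) (N + 2) \<and> card (kids N (par(v := R)) w) = d"
    if "(B(card (kids N par v) := 0)) d = Suc w" for d w
  proof -
    have d: "d \<noteq> card (kids N par v)" "B d = Suc w" using that by (auto split: if_splits)
    then have w: "w \<in> kids N par (N + 2)" "card (kids N par w) = d" using D(3) by auto
    then have "w \<noteq> v" "w < N" using d by (auto simp: kids_def)
    then show ?thesis using w k kk by simp
  qed
  show "(B(card (kids N par v) := 0)) (card (kids N (par(v := R)) w)) = Suc w"
    if "w \<in> kids N (par(v := R)) (N + 2)" for w
  proof -
    have w: "w \<in> kids N par (N + 2)" "w \<noteq> v" using that k by auto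
    then have "w < N" by (auto simp: kids_def)
    then have eq: "kids N (par(v := R)) w = kids N par w" using kk by simp
    have "card (kids N par w) \<noteq> card (kids N par v)" using D(4)[OF w(1)] D(4)[OF v] w(2) by auto
    then show ?thesis using D(4)[OF w(1)] eq by simp
  qed
qed

text \<open>Bucketed roots have distinct degrees between 0 and \<open>3 * K + 2\<close>. Together
  with the degree of the extracted element, this is the source of the logarithm in the cost of an
  extraction.\<close>

lemma consolidating_card_le:
  assumes con: "consolidating n R par mk key B" and N: "N = n + n" and K: "N < 2 ^ Suc K"
  shows "card (kids N par (N + 2)) \<le> 3 * K + 3"
proof -
  note D = consolidatingD[OF con N]
  have "inj_on (\<lambda>v. card (kids N par v)) (kids N par (N + 2))"
    by (rule inj_onI) (metis D(4) Suc_inject)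
  moreover have "(\<lambda>v. card (kids N par v)) ` kids N par (N + 2) \<subseteq> {..3 * K + 2}"
    using fib_heap_degree_bound[OF D(1) N _ K] by (auto simp: kids_def)
  ultimately have "card (kids N par (N + 2)) \<le> card {..3 * K + 2}"
    by (metis card_image card_mono finite_atMost)
  then show ?thesis by simp
qed

text \<open>What an extraction from heap \<open>R\<close> respects until its last move. Between two
  states without bucketed roots, only the number of roots of \<open>R\<close> can then raise the
  potential. Transitivity carries the relation through all three loops.\<close>

definition preserves ::
  "nat \<Rightarrow> nat \<Rightarrow> (nat \<Rightarrow> nat) \<Rightarrow> (nat \<Rightarrow> nat) \<Rightarrow> (nat \<Rightarrow> nat) \<Rightarrow> (nat \<Rightarrow> nat) \<Rightarrow> bool" where
  "preserves n R par mk par' mk' \<longleftrightarrow> (let N = n + n in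
     (\<forall>z<N. par' z = N + 3 \<longleftrightarrow> par z = N + 3) \<and>
     kids N par' (if R = N then N + 1 else N) = kids N par (if R = N then N + 1 else N) \<and>
     card (marked N par' mk') \<le> card (marked N par mk))"

lemma preserves_refl: "preserves n R par mk par mk"
  by (simp add: preserves_def Let_def)

lemma preserves_trans:
  "preserves n R par mk par' mk' \<Longrightarrow> preserves n R par' mk' par'' mk'' \<Longrightarrow> preserves n R par mk par'' mk''"
  by (simp add: preserves_def Let_def)

lemma preserves_move_root:
  assumes N: "N = n + n" and R: "R = N \<or> R = N + 1"
    and x: "x < N" "par x = R \<or> par x = N + 2" and q: "q = R \<or> q = N + 2"
  shows "preserves n R par mk (par(x := q)) mk"
proof -
  have "marked N (par(x := q)) mk = marked N par mk" using assms by (auto simp: marked_def)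
  moreover have "kids N (par(x := q)) (if R = N then N + 1 else N) = kids N par (if R = N then N + 1 else N)"
    using assms by (auto simp: kids_def)
  moreover have "\<forall>z<N. (par(x := q)) z = N + 3 \<longleftrightarrow> par z = N + 3"
    using assms by auto
  ultimately show ?thesis unfolding preserves_def Let_def N[symmetric] by simp
qed

text \<open>The linked element stops being a root, whereupon an old mark would start to count;
  clearing the mark keeps the set of marked elements.\<close>

lemma preserves_link:
  assumes N: "N = n + n" and R: "R = N \<or> R = N + 1"
    and x: "x < N" "par x = R \<or> par x = N + 2" and w: "w < N"
  shows "preserves n R par mk (par(x := w)) (mk(x := 0))"
proof -
  have "marked N (par(x := w)) (mk(x := 0)) = marked N par mk" using assms by (auto simp: marked_def)
  moreover have "kids N (par(x := w)) (if R = N then N + 1 else N) = kids N par (if R = N then N + 1 else N)"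
    using assms by (auto simp: kids_def)
  moreover have "\<forall>z<N. (par(x := w)) z = N + 3 \<longleftrightarrow> par z = N + 3"
    using assms by auto
  ultimately show ?thesis unfolding preserves_def Let_def N[symmetric] by simp
qed

lemma preserves_cut:
  assumes N: "N = n + n" and R: "R = N \<or> R = N + 1" and x: "x < N" "par x < N"
  shows "preserves n R par mk (par(x := R)) mk"
proof -
  have "marked N (par(x := R)) mk \<subseteq> marked N par mk" using assms by (auto simp: marked_def)
  then have "card (marked N (par(x := R)) mk) \<le> card (marked N par mk)" by (intro card_mono) auto
  moreover have "kids N (par(x := R)) (if R = N then N + 1 else N) = kids N par (if R = N then N + 1 else N)"
    using assms by (auto simp: kids_def)
  moreover have "\<forall>z<N. (par(x := R)) z = N + 3 \<longleftrightarrow> par z = N + 3"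
    using assms by auto
  ultimately show ?thesis unfolding preserves_def Let_def N[symmetric] by simp
qed

definition last_child :: "nexp \<Rightarrow> nexp" where
  "last_child p = NArr ''ch'' (NPlus (NArr ''base'' p) (NMinus (NArr ''deg'' p) (NConst 1)))"

lemma last_child_cost [simp]: "ncost (last_child p) = 6 + 2 * ncost p"
  by (simp add: last_child_def)

lemma last_child_val:
  assumes "forest_store n \<sigma>" "N = n + n" "nval p \<sigma> = r" "r < N + 4" "kids N (narr \<sigma> ''par'') r \<noteq> {}"
  shows "nval (last_child p) \<sigma> \<in> kids N (narr \<sigma> ''par'') r"
proof -
  have "0 < card (kids N (narr \<sigma> ''par'') r)" using assms(5) by (simp add: card_gt_0_iff)
  then show ?thesis
    using forest_storeD(5)[OF assms(1,2,4), of "card (kids N (narr \<sigma> ''par'') r) - 1"]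
      forest_storeD(3)[OF assms(1,2,4)] assms(3)
    by (simp add: last_child_def)
qed

definition consolidate_body :: com where
  "consolidate_body =
     NAssign ''v1'' (last_child (NVar ''R'')) ;;
     NAssign ''d'' (NArr ''deg'' (NVar ''v1'')) ;;
     If (NLess (NConst 0) (NArr ''B'' (NVar ''d'')))
       (NAssign ''v2'' (NMinus (NArr ''B'' (NVar ''d'')) (NConst 1)) ;;
        NArrAssign ''B'' (NVar ''d'') (NConst 0) ;;
        If (RLess (RArr ''key'' (NVar ''v2'')) (RArr ''key'' (NVar ''v1'')))
          (NArrAssign ''mk'' (NVar ''v1'') (NConst 0) ;;
           NAssign ''mx'' (NVar ''v1'') ;; NAssign ''mq'' (NVar ''v2'') ;; move ;;
           NAssign ''mx'' (NVar ''v2'') ;; NAssign ''mq'' (NVar ''R'') ;; move)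
          (NArrAssign ''mk'' (NVar ''v2'') (NConst 0) ;;
           NAssign ''mx'' (NVar ''v2'') ;; NAssign ''mq'' (NVar ''v1'') ;; move))
       (NArrAssign ''B'' (NVar ''d'') (NPlus (NVar ''v1'') (NConst 1)) ;;
        NAssign ''mx'' (NVar ''v1'') ;; NAssign ''mq'' (NPlus (NVar ''N'') (NConst 2)) ;; move)"

definition consolidate_test :: bexp where
  "consolidate_test = NLess (NConst 0) (NArr ''deg'' (NVar ''R''))"

definition consolidate_inv ::
  "nat \<Rightarrow> nat \<Rightarrow> (nat \<Rightarrow> nat) \<Rightarrow> (nat \<Rightarrow> nat) \<Rightarrow> (nat \<Rightarrow> real) \<Rightarrow> store \<Rightarrow> bool" where
  "consolidate_inv n R par0 mk0 key \<sigma> \<longleftrightarrow> forest_store n \<sigma> \<and> nvar \<sigma> ''R'' = R \<and> rarr \<sigma> ''key'' = key \<and>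
     consolidating n R (narr \<sigma> ''par'') (narr \<sigma> ''mk'') key (narr \<sigma> ''B'') \<and>
     preserves n R par0 mk0 (narr \<sigma> ''par'') (narr \<sigma> ''mk'')"

text \<open>An unprocessed root weighs 2 and a bucketed one 1. Putting a root into a bucket loses
  one unit, and so does every link, which empties a bucket and keeps the number of unprocessed
  roots.\<close>

definition consolidate_pot :: "nat \<Rightarrow> store \<Rightarrow> nat" where
  "consolidate_pot n \<sigma> = 300 * (2 * card (kids (n + n) (narr \<sigma> ''par'') (nvar \<sigma> ''R''))
     + card (kids (n + n) (narr \<sigma> ''par'') (n + n + 2)))"

lemma wp_consolidate_body:
  assumes inv: "consolidate_inv n R par0 mk0 key \<sigma>" and test: "bval consolidate_test \<sigma>"
    and R: "R = n + n \<or> R = n + n + 1"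
  shows "wp consolidate_body (\<lambda>t \<sigma>'. consolidate_inv n R par0 mk0 key \<sigma>' \<and>
    1 + bcost consolidate_test + t + consolidate_pot n \<sigma>' \<le> consolidate_pot n \<sigma>) \<sigma>"
proof -
  define N where N: "N = n + n"
  define par where "par = narr \<sigma> ''par''"
  define mk where "mk = narr \<sigma> ''mk''"
  define B where "B = narr \<sigma> ''B''"
  have i: "forest_store n \<sigma>" "nvar \<sigma> ''R'' = R" "rarr \<sigma> ''key'' = key"
    and con: "consolidating n R par mk key B" and pres: "preserves n R par0 mk0 par mk"
    using inv unfolding consolidate_inv_def par_def mk_def B_def by auto
  have NN: "nvar \<sigma> ''N'' = N" using forest_storeD(1)[OF i(1) N] .
  have R': "R = N \<or> R = N + 1" "R < N + 4" using R N by auto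
  have "0 < card (kids N par R)"
    using test forest_storeD(3)[OF i(1) N R'(2)] i(2) by (simp add: consolidate_test_def par_def)
  then have ne: "kids N par R \<noteq> {}" by auto
  define u where "u = nval (last_child (NVar ''R'')) \<sigma>"
  have u: "u \<in> kids N par R"
    using last_child_val[OF i(1) N _ R'(2), of "NVar ''R''"] ne i(2) by (simp add: u_def par_def)
  then have uN: "u < N" "par u = R" by (auto simp: kids_def)
  define d where "d = card (kids N par u)"
  have du: "narr \<sigma> ''deg'' u = d" using forest_storeD(3)[OF i(1) N, of u] uN by (simp add: d_def par_def)
  show ?thesis
  proof (cases "B d")
    case 0
    have con': "consolidating n R (par(u := N + 2)) mk key (B(d := Suc u))"
      unfolding d_def by (rule consolidating_bucket[OF con N R'(1) u]) (use 0 d_def in simp)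
    have pres': "preserves n R par0 mk0 (par(u := N + 2)) mk"
      by (rule preserves_trans[OF pres preserves_move_root[OF N R'(1) uN(1)]]) (use uN in auto)
    have c: "card (kids N (par(u := N + 2)) R) + 1 = card (kids N par R)"
      "card (kids N (par(u := N + 2)) (N + 2)) = card (kids N par (N + 2)) + 1"
      using card_kids_upd[where par=par, OF uN(1), of "N + 2"] uN R'(1) \<open>0 < card (kids N par R)\<close> by auto
    define \<sigma>1 where "\<sigma>1 = \<sigma>\<lparr>nvar := (nvar \<sigma>)(''v1'' := u, ''d'' := d, ''mx'' := u, ''mq'' := N + 2),
        narr := (narr \<sigma>)(''B'' := B(d := Suc u))\<rparr>"
    have "wp move (\<lambda>t \<sigma>'. t \<le> 60 \<and> forest_store n \<sigma>' \<and> narr \<sigma>' ''par'' = (narr \<sigma>1 ''par'')(u := N + 2) \<and>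
      unmodified move \<sigma>1 \<sigma>') \<sigma>1"
      by (rule wp_move[OF _ N]) (use i(1) uN R' forest_store_cong[of \<sigma>1 \<sigma> n] in \<open>auto simp: \<sigma>1_def par_def\<close>)
    then have "wp move (\<lambda>t \<sigma>'. consolidate_inv n R par0 mk0 key \<sigma>' \<and>
        t + 100 + consolidate_pot n \<sigma>' \<le> consolidate_pot n \<sigma>) \<sigma>1"
    proof (rule wp_mono)
      fix t :: nat and \<sigma>'
      assume *: "t \<le> 60 \<and> forest_store n \<sigma>' \<and> narr \<sigma>' ''par'' = (narr \<sigma>1 ''par'')(u := N + 2) \<and>
        unmodified move \<sigma>1 \<sigma>'"
      note um = unmodifiedD[of move \<sigma>1 \<sigma>', simplified]
      have 2: "narr \<sigma>' ''par'' = par(u := N + 2)" "narr \<sigma>' ''mk'' = mk" "narr \<sigma>' ''B'' = B(d := Suc u)"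
        "nvar \<sigma>' ''R'' = R" "rarr \<sigma>' ''key'' = key" "forest_store n \<sigma>'"
        using * um i by (simp_all add: \<sigma>1_def par_def mk_def)
      show "consolidate_inv n R par0 mk0 key \<sigma>' \<and> t + 100 + consolidate_pot n \<sigma>' \<le> consolidate_pot n \<sigma>"
        unfolding consolidate_inv_def consolidate_pot_def 2 i(2) N[symmetric] par_def[symmetric]
        using con' pres' c 2(6) * by simp
    qed
    then show ?thesis
      using 0 by (simp add: consolidate_body_def wp_simps du \<sigma>1_def NN consolidate_test_def flip: u_def B_def) (erule wp_mono, simp)
  next
    case (Suc v)
    then have Bd: "B (card (kids N par u)) = Suc v" by (simp add: d_def)
    note P = consolidating_pick[OF con N R'(1) u Bd]
    show ?thesis
    proof (cases "key v < key u")
      case False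
      have con': "consolidating n R (par(v := u)) (mk(v := 0)) key (B(d := 0))"
        unfolding d_def by (rule consolidating_lose[OF con N R'(1) u Bd]) (use False in simp)
      have pres': "preserves n R par0 mk0 (par(v := u)) (mk(v := 0))"
        by (rule preserves_trans[OF pres preserves_link[OF N R'(1) P(1)]]) (use P in auto)
      have uv: "u \<noteq> par v" using P by auto
      have "v \<in> kids N par (N + 2)" using P by (simp add: kids_def)
      then have "0 < card (kids N par (N + 2))" by (auto simp: card_gt_0_iff)
      then have c: "card (kids N (par(v := u)) R) = card (kids N par R)"
        "card (kids N (par(v := u)) (N + 2)) + 1 = card (kids N par (N + 2))"
        using card_kids_upd[where par=par, OF P(1) uv] P R'(1) by auto
      define \<sigma>1 where "\<sigma>1 = \<sigma>\<lparr>nvar := (nvar \<sigma>)(''v1'' := u, ''d'' := d, ''v2'' := v, ''mx'' := v, ''mq'' := u),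
        narr := (narr \<sigma>)(''B'' := B(d := 0), ''mk'' := mk(v := 0))\<rparr>"
      have "wp move (\<lambda>t \<sigma>'. t \<le> 60 \<and> forest_store n \<sigma>' \<and> narr \<sigma>' ''par'' = (narr \<sigma>1 ''par'')(v := u) \<and>
        unmodified move \<sigma>1 \<sigma>') \<sigma>1"
        by (rule wp_move[OF _ N]) (use i(1) P uv forest_store_cong[of \<sigma>1 \<sigma> n] in \<open>auto simp: \<sigma>1_def par_def\<close>)
      then have "wp move (\<lambda>t \<sigma>'. consolidate_inv n R par0 mk0 key \<sigma>' \<and>
        t + 100 + consolidate_pot n \<sigma>' \<le> consolidate_pot n \<sigma>) \<sigma>1"
      proof (rule wp_mono)
        fix t :: nat and \<sigma>'
        assume *: "t \<le> 60 \<and> forest_store n \<sigma>' \<and> narr \<sigma>' ''par'' = (narr \<sigma>1 ''par'')(v := u) \<and>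
          unmodified move \<sigma>1 \<sigma>'"
        note um = unmodifiedD[of move \<sigma>1 \<sigma>', simplified]
        have 2: "narr \<sigma>' ''par'' = par(v := u)" "narr \<sigma>' ''mk'' = mk(v := 0)" "narr \<sigma>' ''B'' = B(d := 0)"
          "nvar \<sigma>' ''R'' = R" "rarr \<sigma>' ''key'' = key" "forest_store n \<sigma>'"
          using * um i by (simp_all add: \<sigma>1_def par_def mk_def)
        show "consolidate_inv n R par0 mk0 key \<sigma>' \<and> t + 100 + consolidate_pot n \<sigma>' \<le> consolidate_pot n \<sigma>"
          unfolding consolidate_inv_def consolidate_pot_def 2 i(2) N[symmetric] par_def[symmetric]
          using con' pres' c 2(6) * by simp
      qed
      then show ?thesis
        using Suc False by (simp add: consolidate_body_def wp_simps du i(3) \<sigma>1_def consolidate_test_def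
            flip: u_def B_def mk_def) (erule wp_mono, simp)
    next
      case True
      have con': "consolidating n R (par(u := v, v := R)) (mk(u := 0)) key (B(d := 0))"
        unfolding d_def by (rule consolidating_win[OF con N R'(1) u Bd]) (use True in simp)
      \<comment> \<open>The second move starts from the forest that the first one leaves, so its
        side condition speaks of \<open>par(u := v)\<close>.\<close>
      have vR: "v \<noteq> par u" "R \<noteq> (par(u := v)) v" using P R'(1) by auto
      have pres1: "preserves n R par0 mk0 (par(u := v)) (mk(u := 0))"
        by (rule preserves_trans[OF pres preserves_link[OF N R'(1) P(3)]]) (use P in auto)
      have pres': "preserves n R par0 mk0 (par(u := v, v := R)) (mk(u := 0))"
        by (rule preserves_trans[OF pres1 preserves_move_root[OF N R'(1) P(1)]]) (use P in auto)
      have "v \<in> kids N par (N + 2)" using P by (simp add: kids_def)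
      then have "0 < card (kids N par (N + 2))" by (auto simp: card_gt_0_iff)
      then have c: "card (kids N (par(u := v, v := R)) R) = card (kids N par R)"
        "card (kids N (par(u := v, v := R)) (N + 2)) + 1 = card (kids N par (N + 2))"
        using card_kids_upd[where par=par, OF P(3) vR(1)] card_kids_upd[where par="par(u := v)", OF P(1) vR(2)]
          P R'(1) \<open>0 < card (kids N par R)\<close> by auto
      define \<sigma>1 where "\<sigma>1 = \<sigma>\<lparr>nvar := (nvar \<sigma>)(''v1'' := u, ''d'' := d, ''v2'' := v, ''mx'' := u, ''mq'' := v),
        narr := (narr \<sigma>)(''B'' := B(d := 0), ''mk'' := mk(u := 0))\<rparr>"
      have "wp move (\<lambda>t \<sigma>'. t \<le> 60 \<and> forest_store n \<sigma>' \<and> narr \<sigma>' ''par'' = (narr \<sigma>1 ''par'')(u := v) \<and>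
        unmodified move \<sigma>1 \<sigma>') \<sigma>1"
        by (rule wp_move[OF _ N]) (use i(1) P vR forest_store_cong[of \<sigma>1 \<sigma> n] in \<open>auto simp: \<sigma>1_def par_def\<close>)
      then have "wp move (\<lambda>t \<sigma>'. wp (NAssign ''mx'' (NVar ''v2'') ;; NAssign ''mq'' (NVar ''R'') ;; move)
         (\<lambda>t' \<sigma>'. consolidate_inv n R par0 mk0 key \<sigma>' \<and>
        (t + t') + 100 + consolidate_pot n \<sigma>' \<le> consolidate_pot n \<sigma>) \<sigma>') \<sigma>1"
      proof (rule wp_mono)
        fix t :: nat and \<sigma>'
        assume *: "t \<le> 60 \<and> forest_store n \<sigma>' \<and> narr \<sigma>' ''par'' = (narr \<sigma>1 ''par'')(u := v) \<and>
          unmodified move \<sigma>1 \<sigma>'"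
        note um = unmodifiedD[of move \<sigma>1 \<sigma>', simplified]
        have 2: "narr \<sigma>' ''par'' = par(u := v)" "narr \<sigma>' ''mk'' = mk(u := 0)" "narr \<sigma>' ''B'' = B(d := 0)"
          "nvar \<sigma>' ''R'' = R" "nvar \<sigma>' ''v2'' = v" "rarr \<sigma>' ''key'' = key" "forest_store n \<sigma>'"
          using * um i by (simp_all add: \<sigma>1_def par_def mk_def)
        define \<sigma>2 where "\<sigma>2 = \<sigma>'\<lparr>nvar := (nvar \<sigma>')(''mx'' := v, ''mq'' := R)\<rparr>"
        have "wp move (\<lambda>t \<sigma>'. t \<le> 60 \<and> forest_store n \<sigma>' \<and> narr \<sigma>' ''par'' = (narr \<sigma>2 ''par'')(v := R) \<and>
          unmodified move \<sigma>2 \<sigma>') \<sigma>2"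
          by (rule wp_move[OF _ N]) (use 2 P(1) R'(2) vR(2) forest_store_cong[of \<sigma>2 \<sigma>' n] in \<open>auto simp: \<sigma>2_def\<close>)
        then have "wp move (\<lambda>t' \<sigma>'. consolidate_inv n R par0 mk0 key \<sigma>' \<and>
          (t + (4 + t')) + 100 + consolidate_pot n \<sigma>' \<le> consolidate_pot n \<sigma>) \<sigma>2"
        proof (rule wp_mono)
          fix t' :: nat and \<sigma>''
          assume **: "t' \<le> 60 \<and> forest_store n \<sigma>'' \<and> narr \<sigma>'' ''par'' = (narr \<sigma>2 ''par'')(v := R) \<and>
            unmodified move \<sigma>2 \<sigma>''"
          note um' = unmodifiedD[of move \<sigma>2 \<sigma>'', simplified]
          have 3: "narr \<sigma>'' ''par'' = par(u := v, v := R)" "narr \<sigma>'' ''mk'' = mk(u := 0)" "narr \<sigma>'' ''B'' = B(d := 0)"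
            "nvar \<sigma>'' ''R'' = R" "rarr \<sigma>'' ''key'' = key" "forest_store n \<sigma>''"
            using ** um' 2 by (simp_all add: \<sigma>2_def)
          show "consolidate_inv n R par0 mk0 key \<sigma>'' \<and> (t + (4 + t')) + 100 + consolidate_pot n \<sigma>'' \<le> consolidate_pot n \<sigma>"
            unfolding consolidate_inv_def consolidate_pot_def 3 i(2) N[symmetric] par_def[symmetric]
            using con' pres' c 3(6) * ** by simp
        qed
        then show "wp (NAssign ''mx'' (NVar ''v2'') ;; NAssign ''mq'' (NVar ''R'') ;; move)
         (\<lambda>t' \<sigma>'. consolidate_inv n R par0 mk0 key \<sigma>' \<and>
        (t + t') + 100 + consolidate_pot n \<sigma>' \<le> consolidate_pot n \<sigma>) \<sigma>'"
          by (simp add: wp_simps 2 \<sigma>2_def)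
      qed
      then show ?thesis
        using Suc True by (simp add: consolidate_body_def wp_simps du i(3) \<sigma>1_def consolidate_test_def
            flip: u_def B_def mk_def) (erule wp_mono, simp add: wp_simps, erule wp_mono, simp)
    qed
  qed
qed

section \<open>Extraction of a minimum\<close>

definition collect_body :: com where
  "collect_body =
     NAssign ''v1'' (last_child (NPlus (NVar ''N'') (NConst 2))) ;;
     NArrAssign ''B'' (NArr ''deg'' (NVar ''v1'')) (NConst 0) ;;
     If (RLess (RArr ''key'' (NVar ''v1'')) (RArr ''key'' (NVar ''x'')))
       (NAssign ''x'' (NVar ''v1'')) (NAssign ''x'' (NVar ''x'')) ;;
     NAssign ''mx'' (NVar ''v1'') ;; NAssign ''mq'' (NVar ''R'') ;; move"

definition collect_test :: bexp where
  "collect_test = NLess (NConst 0) (NArr ''deg'' (NPlus (NVar ''N'') (NConst 2)))"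

text \<open>\<open>x\<close> is compared only with the roots already returned to \<open>R\<close>,
  and it may itself still be bucketed; once no bucketed root is left, it is a minimal root.
  \<open>k\<close> is the number of roots left by the consolidation.\<close>

definition collect_inv ::
  "nat \<Rightarrow> nat \<Rightarrow> (nat \<Rightarrow> nat) \<Rightarrow> (nat \<Rightarrow> nat) \<Rightarrow> (nat \<Rightarrow> real) \<Rightarrow> nat \<Rightarrow> store \<Rightarrow> bool" where
  "collect_inv n R par0 mk0 key k \<sigma> \<longleftrightarrow> (let N = n + n; par = narr \<sigma> ''par''; x = nvar \<sigma> ''x'' in
     consolidate_inv n R par0 mk0 key \<sigma> \<and> x \<in> kids N par R \<union> kids N par (N + 2) \<and>
     (\<forall>z\<in>kids N par R. key x \<le> key z) \<and> card (kids N par R) + card (kids N par (N + 2)) = k)"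

definition collect_pot :: "nat \<Rightarrow> store \<Rightarrow> nat" where
  "collect_pot n \<sigma> = 150 * card (kids (n + n) (narr \<sigma> ''par'') (n + n + 2))"

lemma wp_collect_body:
  assumes inv: "collect_inv n R par0 mk0 key k \<sigma>" and test: "bval collect_test \<sigma>"
    and R: "R = n + n \<or> R = n + n + 1"
  shows "wp collect_body (\<lambda>t \<sigma>'. collect_inv n R par0 mk0 key k \<sigma>' \<and>
    1 + bcost collect_test + t + collect_pot n \<sigma>' \<le> collect_pot n \<sigma>) \<sigma>"
proof -
  define N where N: "N = n + n"
  define par where "par = narr \<sigma> ''par''"
  define mk where "mk = narr \<sigma> ''mk''"
  define B where "B = narr \<sigma> ''B''"
  define x where "x = nvar \<sigma> ''x''"
  have i: "forest_store n \<sigma>" "nvar \<sigma> ''R'' = R" "rarr \<sigma> ''key'' = key"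
    and con: "consolidating n R par mk key B" and pres: "preserves n R par0 mk0 par mk"
    and x: "x \<in> kids N par R \<union> kids N par (N + 2)" "\<forall>z\<in>kids N par R. key x \<le> key z"
    and k: "card (kids N par R) + card (kids N par (N + 2)) = k"
    using inv unfolding collect_inv_def consolidate_inv_def Let_def par_def mk_def B_def x_def N by auto
  have NN: "nvar \<sigma> ''N'' = N" using forest_storeD(1)[OF i(1) N] .
  have R': "R = N \<or> R = N + 1" "R < N + 4" using R N by auto
  have pos: "0 < card (kids N par (N + 2))"
    using test forest_storeD(3)[OF i(1) N, of "N + 2"] NN by (simp add: collect_test_def par_def)
  then have ne: "kids N par (N + 2) \<noteq> {}" by auto
  define v where "v = nval (last_child (NPlus (NVar ''N'') (NConst 2))) \<sigma>"
  have v: "v \<in> kids N par (N + 2)"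
    using last_child_val[OF i(1) N, of "NPlus (NVar ''N'') (NConst 2)" "N + 2"] ne NN by (simp add: v_def par_def)
  then have vN: "v < N" "par v = N + 2" "R \<noteq> par v" using R' by (auto simp: kids_def)
  define d where "d = card (kids N par v)"
  have dv: "narr \<sigma> ''deg'' v = d" using forest_storeD(3)[OF i(1) N, of v] vN by (simp add: d_def par_def)
  \<comment> \<open>The branch that keeps \<open>x\<close> assigns it to itself, so both branches
    have the same cost and the same effect, namely assigning \<open>x'\<close>.\<close>
  define x' where "x' = (if key v < key x then v else x)"
  have con': "consolidating n R (par(v := R)) mk key (B(d := 0))"
    unfolding d_def by (rule consolidating_return[OF con N R'(1) v])
  have pres': "preserves n R par0 mk0 (par(v := R)) mk"
    by (rule preserves_trans[OF pres preserves_move_root[OF N R'(1) vN(1)]]) (use vN in auto)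
  have kk: "kids N (par(v := R)) R = insert v (kids N par R)" "kids N (par(v := R)) (N + 2) = kids N par (N + 2) - {v}"
    using kids_upd[where par=par, OF vN(1,3)] vN R' by auto
  have c: "card (kids N (par(v := R)) R) = card (kids N par R) + 1"
    "card (kids N (par(v := R)) (N + 2)) + 1 = card (kids N par (N + 2))"
    using card_kids_upd[where par=par, OF vN(1,3)] vN R'(1) pos by auto
  have x'1: "x' \<in> kids N (par(v := R)) R \<union> kids N (par(v := R)) (N + 2)"
    unfolding kk x'_def using x(1) by auto
  have x'2: "\<forall>z\<in>kids N (par(v := R)) R. key x' \<le> key z"
    unfolding kk x'_def using x(2) by (auto intro: order_trans less_imp_le)
  define \<sigma>1 where "\<sigma>1 = \<sigma>\<lparr>nvar := (nvar \<sigma>)(''v1'' := v, ''x'' := x', ''mx'' := v, ''mq'' := R),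
      narr := (narr \<sigma>)(''B'' := B(d := 0))\<rparr>"
  have "wp move (\<lambda>t \<sigma>'. t \<le> 60 \<and> forest_store n \<sigma>' \<and> narr \<sigma>' ''par'' = (narr \<sigma>1 ''par'')(v := R) \<and>
    unmodified move \<sigma>1 \<sigma>') \<sigma>1"
    by (rule wp_move[OF _ N]) (use i(1) vN R' forest_store_cong[of \<sigma>1 \<sigma> n] in \<open>auto simp: \<sigma>1_def par_def\<close>)
  then have "wp move (\<lambda>t \<sigma>'. collect_inv n R par0 mk0 key k \<sigma>' \<and>
      t + 80 + collect_pot n \<sigma>' \<le> collect_pot n \<sigma>) \<sigma>1"
  proof (rule wp_mono)
    fix t :: nat and \<sigma>'
    assume *: "t \<le> 60 \<and> forest_store n \<sigma>' \<and> narr \<sigma>' ''par'' = (narr \<sigma>1 ''par'')(v := R) \<and>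
      unmodified move \<sigma>1 \<sigma>'"
    note um = unmodifiedD[of move \<sigma>1 \<sigma>', simplified]
    have 2: "narr \<sigma>' ''par'' = par(v := R)" "narr \<sigma>' ''mk'' = mk" "narr \<sigma>' ''B'' = B(d := 0)"
      "nvar \<sigma>' ''R'' = R" "nvar \<sigma>' ''x'' = x'" "rarr \<sigma>' ''key'' = key" "forest_store n \<sigma>'"
      using * um i by (simp_all add: \<sigma>1_def par_def mk_def)
    show "collect_inv n R par0 mk0 key k \<sigma>' \<and> t + 80 + collect_pot n \<sigma>' \<le> collect_pot n \<sigma>"
      unfolding collect_inv_def Let_def consolidate_inv_def collect_pot_def 2 N[symmetric] par_def[symmetric]
      using con' pres' c k x'1 x'2 2(7) * by simp
  qed
  then show ?thesis
    by (simp add: collect_body_def wp_simps dv \<sigma>1_def i(2,3) collect_test_def x'_def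
        flip: v_def B_def x_def) (intro conjI impI; simp; erule wp_mono; simp)
qed

text \<open>The children of the minimum become roots without a mark on \<open>x\<close>, as
  \<open>x\<close> is about to leave the heap.\<close>

definition expose_body :: com where
  "expose_body = NAssign ''mx'' (last_child (NVar ''x'')) ;; NAssign ''mq'' (NVar ''R'') ;; move"

definition expose_test :: bexp where
  "expose_test = NLess (NConst 0) (NArr ''deg'' (NVar ''x''))"

definition expose_inv ::
  "nat \<Rightarrow> nat \<Rightarrow> (nat \<Rightarrow> nat) \<Rightarrow> (nat \<Rightarrow> nat) \<Rightarrow> (nat \<Rightarrow> real) \<Rightarrow> nat \<Rightarrow> nat \<Rightarrow> store \<Rightarrow> bool" where
  "expose_inv n R par0 mk0 key x k \<sigma> \<longleftrightarrow> (let N = n + n; par = narr \<sigma> ''par'' in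
     forest_store n \<sigma> \<and> nvar \<sigma> ''R'' = R \<and> nvar \<sigma> ''x'' = x \<and> x < N \<and> par x = R \<and>
     fib_heap n {} par (narr \<sigma> ''mk'') key \<and> preserves n R par0 mk0 par (narr \<sigma> ''mk'') \<and>
     kids N par (N + 2) = {} \<and> card (kids N par R) + card (kids N par x) = k)"

definition expose_pot :: "nat \<Rightarrow> nat \<Rightarrow> store \<Rightarrow> nat" where
  "expose_pot n x \<sigma> = 100 * card (kids (n + n) (narr \<sigma> ''par'') x)"

lemma wp_expose_body:
  assumes inv: "expose_inv n R par0 mk0 key x k \<sigma>" and test: "bval expose_test \<sigma>"
    and R: "R = n + n \<or> R = n + n + 1"
  shows "wp expose_body (\<lambda>t \<sigma>'. expose_inv n R par0 mk0 key x k \<sigma>' \<and>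
    1 + bcost expose_test + t + expose_pot n x \<sigma>' \<le> expose_pot n x \<sigma>) \<sigma>"
proof -
  define N where N: "N = n + n"
  define par where "par = narr \<sigma> ''par''"
  define mk where "mk = narr \<sigma> ''mk''"
  have i: "forest_store n \<sigma>" "nvar \<sigma> ''R'' = R" "nvar \<sigma> ''x'' = x" "x < N" "par x = R"
    and fh: "fib_heap n {} par mk key" and pres: "preserves n R par0 mk0 par mk"
    and rp: "kids N par (N + 2) = {}"
    and k: "card (kids N par R) + card (kids N par x) = k"
    using inv unfolding expose_inv_def Let_def par_def mk_def N by auto
  have R': "R = N \<or> R = N + 1" "R < N + 4" using R N by auto
  have pos: "0 < card (kids N par x)"
    using test forest_storeD(3)[OF i(1) N, of x] i(3,4) by (simp add: expose_test_def par_def)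
  then have ne: "kids N par x \<noteq> {}" by auto
  define v where "v = nval (last_child (NVar ''x'')) \<sigma>"
  have v: "v \<in> kids N par x"
    using last_child_val[OF i(1) N, of "NVar ''x''" x] ne i(3,4) by (simp add: v_def par_def)
  then have vN: "v < N" "par v = x" "R \<noteq> par v" "par v < N" using R' i(4) by (auto simp: kids_def)
  have Rv: "R = (if v < n then N else N + 1)"
    using fib_heapD(5)[OF fh N vN(1,4)] fib_heapD(7,8)[OF fh N i(4)] i(5) R'(1) vN(2) by auto
  have vx: "v \<noteq> x" using vN(2) i(4,5) R'(1) by auto
  have fh1: "fib_heap n {x} (par(v := R)) mk key"
    using fib_heap_cut[OF fh N _ vN(1,4) Rv] vN(2) by simp
  have fh': "fib_heap n {} (par(v := R)) mk key"
    by (rule fib_heap_exempt_root[OF fh1 subset_refl]) (use vx i(5) R in auto)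
  have pres': "preserves n R par0 mk0 (par(v := R)) mk"
    by (rule preserves_trans[OF pres preserves_cut[where par=par, OF N R'(1) vN(1,4)]])
  have c: "card (kids N (par(v := R)) R) = card (kids N par R) + 1"
    "card (kids N (par(v := R)) x) + 1 = card (kids N par x)"
    using card_kids_upd[where par=par, OF vN(1,3)] vN R'(1) i(4) pos by auto
  have rp': "kids N (par(v := R)) (N + 2) = {}"
    using rp R'(1) by (auto simp: kids_def)
  define \<sigma>1 where "\<sigma>1 = \<sigma>\<lparr>nvar := (nvar \<sigma>)(''mx'' := v, ''mq'' := R)\<rparr>"
  have "wp move (\<lambda>t \<sigma>'. t \<le> 60 \<and> forest_store n \<sigma>' \<and> narr \<sigma>' ''par'' = (narr \<sigma>1 ''par'')(v := R) \<and>
    unmodified move \<sigma>1 \<sigma>') \<sigma>1"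
    by (rule wp_move[OF _ N]) (use i(1) vN R' forest_store_cong[of \<sigma>1 \<sigma> n] in \<open>auto simp: \<sigma>1_def par_def\<close>)
  then have "wp move (\<lambda>t \<sigma>'. expose_inv n R par0 mk0 key x k \<sigma>' \<and>
      t + 40 + expose_pot n x \<sigma>' \<le> expose_pot n x \<sigma>) \<sigma>1"
  proof (rule wp_mono)
    fix t :: nat and \<sigma>'
    assume *: "t \<le> 60 \<and> forest_store n \<sigma>' \<and> narr \<sigma>' ''par'' = (narr \<sigma>1 ''par'')(v := R) \<and>
      unmodified move \<sigma>1 \<sigma>'"
    note um = unmodifiedD[of move \<sigma>1 \<sigma>', simplified]
    have 2: "narr \<sigma>' ''par'' = par(v := R)" "narr \<sigma>' ''mk'' = mk"
      "nvar \<sigma>' ''R'' = R" "nvar \<sigma>' ''x'' = x" "forest_store n \<sigma>'"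
      using * um i by (simp_all add: \<sigma>1_def par_def mk_def)
    show "expose_inv n R par0 mk0 key x k \<sigma>' \<and> t + 40 + expose_pot n x \<sigma>' \<le> expose_pot n x \<sigma>"
      unfolding expose_inv_def Let_def expose_pot_def 2 N[symmetric] par_def[symmetric]
      using fh' pres' c k rp' i(4,5) vx 2(5) * by simp
  qed
  then show ?thesis
    by (simp add: expose_body_def wp_simps \<sigma>1_def i(2) expose_test_def flip: v_def) (erule wp_mono, simp)
qed

text \<open>No pointer to a minimal root is maintained. Consolidating before the minimum is known
  leaves logarithmically many roots to search. The children of the extracted element add
  logarithmically many roots, and these are left for a later extraction to link.\<close>

definition pop :: com where
  "pop =
     While consolidate_test consolidate_body ;;
     NAssign ''x'' (last_child (NPlus (NVar ''N'') (NConst 2))) ;;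
     While collect_test collect_body ;;
     While expose_test expose_body ;;
     NAssign ''mx'' (NVar ''x'') ;; NAssign ''mq'' (NPlus (NVar ''N'') (NConst 3)) ;; move"

lemma pop_mods [simp]:
  "nvar_mods pop = {''v1'', ''v2'', ''d'', ''mx'', ''mq'', ''mp'', ''ml'', ''x''}"
  "narr_mods pop = {''deg'', ''ch'', ''pos'', ''par'', ''mk'', ''B''}" "rarr_mods pop = {}"
  by (auto simp: pop_def consolidate_body_def collect_body_def expose_body_def)

definition heap_store :: "nat \<Rightarrow> store \<Rightarrow> bool" where
  "heap_store n \<sigma> \<longleftrightarrow> forest_store n \<sigma> \<and>
     fib_heap n {} (narr \<sigma> ''par'') (narr \<sigma> ''mk'') (rarr \<sigma> ''key'') \<and>
     kids (n + n) (narr \<sigma> ''par'') (n + n + 2) = {} \<and> (\<forall>d. narr \<sigma> ''B'' d = 0)"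

lemma potential_preserves:
  assumes pres: "preserves n R (narr \<sigma> ''par'') (narr \<sigma> ''mk'') par mk" and N: "N = n + n"
    and R: "R = N \<or> R = N + 1" and "kids N (narr \<sigma> ''par'') (N + 2) = {}" "kids N par (N + 2) = {}"
  shows "1000 * (card (kids N par N) + card (kids N par (N + 1)) + card (kids N par (N + 2)))
      + 2000 * card (marked N par mk) + 1000 * card (kids N (narr \<sigma> ''par'') R)
    \<le> potential n \<sigma> + 1000 * card (kids N par R)"
proof -
  have *: "kids N par (if R = N then N + 1 else N) = kids N (narr \<sigma> ''par'') (if R = N then N + 1 else N)"
    "card (marked N par mk) \<le> card (marked N (narr \<sigma> ''par'') (narr \<sigma> ''mk''))"
    using pres unfolding preserves_def Let_def N by auto
  show ?thesis
  proof (cases "R = N")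
    case True
    then show ?thesis
      unfolding potential_def Let_def N[symmetric] using * assms(4,5) by simp
  next
    case False
    then have "R = N + 1" using R by simp
    then show ?thesis
      unfolding potential_def Let_def N[symmetric] using * assms(4,5) by simp
  qed
qed

text \<open>Each initial root of \<open>R\<close> releases 1000 units, of which its consolidation
  uses 600. The surcharge covers the rest: the two later loops, and the potential of the at most
  \<open>6 * K + 5\<close> roots that remain.\<close>

lemma wp_pop:
  assumes hs: "heap_store n \<sigma>" and N: "N = n + n" and R: "nvar \<sigma> ''R'' = R" "R = N \<or> R = N + 1"
    and ne: "kids N (narr \<sigma> ''par'') R \<noteq> {}" and K: "N < 2 ^ Suc K"
  shows "wp pop (\<lambda>t \<sigma>'. heap_store n \<sigma>' \<and> nvar \<sigma>' ''x'' < N \<and> narr \<sigma> ''par'' (nvar \<sigma>' ''x'') \<noteq> N + 3 \<and>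
     (nvar \<sigma>' ''x'' < n \<longleftrightarrow> R = N) \<and>
     (\<forall>z<N. narr \<sigma> ''par'' z \<noteq> N + 3 \<longrightarrow> (z < n \<longleftrightarrow> R = N) \<longrightarrow> rarr \<sigma> ''key'' (nvar \<sigma>' ''x'') \<le> rarr \<sigma> ''key'' z) \<and>
     (\<forall>z<N. narr \<sigma>' ''par'' z = N + 3 \<longleftrightarrow> narr \<sigma> ''par'' z = N + 3 \<or> z = nvar \<sigma>' ''x'') \<and>
     t + potential n \<sigma>' \<le> potential n \<sigma> + 10000 * (K + 1) \<and> unmodified pop \<sigma> \<sigma>') \<sigma>"
proof -
  define par where "par = narr \<sigma> ''par''"
  define mk where "mk = narr \<sigma> ''mk''"
  define key where "key = rarr \<sigma> ''key''"
  have fs: "forest_store n \<sigma>" and fh: "fib_heap n {} par mk key" and rp: "kids N par (N + 2) = {}"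
    and B: "\<And>d. narr \<sigma> ''B'' d = 0"
    using hs unfolding heap_store_def par_def mk_def key_def N by auto
  have Rn: "R = n + n \<or> R = n + n + 1" using R N by simp
  have R4: "R < N + 4" using R(2) by auto
  have "consolidating n R par mk key (narr \<sigma> ''B'')"
    by (rule consolidatingI[OF N fh]) (use rp B in auto)
  then have inv0: "consolidate_inv n R par mk key \<sigma>"
    unfolding consolidate_inv_def using fs R(1) preserves_refl by (simp add: par_def mk_def key_def)
  obtain z0 where z0: "z0 \<in> kids N par R" using ne unfolding par_def by blast
  have z0': "z0 < N" "par z0 \<noteq> N + 3" "z0 < n \<longleftrightarrow> R = N"
    using z0 R(2) kids_side[OF fh N R(2) z0] by (auto simp: kids_def)
  have main: "wp pop (\<lambda>t \<sigma>'. heap_store n \<sigma>' \<and> nvar \<sigma>' ''x'' < N \<and> par (nvar \<sigma>' ''x'') \<noteq> N + 3 \<and>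
     (nvar \<sigma>' ''x'' < n \<longleftrightarrow> R = N) \<and>
     (\<forall>z<N. par z \<noteq> N + 3 \<longrightarrow> (z < n \<longleftrightarrow> R = N) \<longrightarrow> key (nvar \<sigma>' ''x'') \<le> key z) \<and>
     (\<forall>z<N. narr \<sigma>' ''par'' z = N + 3 \<longleftrightarrow> par z = N + 3 \<or> z = nvar \<sigma>' ''x'') \<and>
     t + potential n \<sigma>' \<le> potential n \<sigma> + 10000 * (K + 1)) \<sigma>"
    (is "wp pop ?Q \<sigma>")
    unfolding pop_def wp_Seq[of "While consolidate_test consolidate_body"]
  proof (rule wp_mono[OF wp_While[where \<Phi>="consolidate_pot n", OF wp_consolidate_body[OF _ _ Rn] inv0]])
    fix t1 \<sigma>1
    assume 1: "consolidate_inv n R par mk key \<sigma>1 \<and> \<not> bval consolidate_test \<sigma>1 \<and>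
      t1 + consolidate_pot n \<sigma>1 \<le> consolidate_pot n \<sigma> + 1 + bcost consolidate_test"
    define par1 where "par1 = narr \<sigma>1 ''par''"
    have fs1: "forest_store n \<sigma>1" and R1: "nvar \<sigma>1 ''R'' = R" and key1: "rarr \<sigma>1 ''key'' = key"
      and con1: "consolidating n R par1 (narr \<sigma>1 ''mk'') key (narr \<sigma>1 ''B'')"
      and pres1: "preserves n R par mk par1 (narr \<sigma>1 ''mk'')"
      using 1 unfolding consolidate_inv_def par1_def by auto
    note N1 = forest_storeD(1)[OF fs1 N]
    have "card (kids N par1 R) = 0"
      using 1 forest_storeD(3)[OF fs1 N R4] R1 by (simp add: consolidate_test_def par1_def)
    then have empty1: "kids N par1 R = {}" by simp
    define k where "k = card (kids N par1 (N + 2))"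
    have k: "k \<le> 3 * K + 3" unfolding k_def by (rule consolidating_card_le[OF con1 N K])
    have t1: "t1 + 300 * k \<le> 600 * card (kids N par R) + 5"
      using 1 R1 R(1) rp empty1
      by (simp add: consolidate_pot_def consolidate_test_def k_def par_def par1_def flip: N)
    \<comment> \<open>\<open>z0\<close> was in heap \<open>R\<close> and still lies below some root
      of the same side. No unprocessed root is left, so this root is bucketed.\<close>
    have ne1: "kids N par1 (N + 2) \<noteq> {}"
    proof -
      have "par1 z0 \<noteq> N + 3" using pres1 z0' unfolding preserves_def Let_def N by auto
      then obtain r where r: "r < N" "N \<le> par1 r" "par1 r \<noteq> N + 3" "r < n \<longleftrightarrow> z0 < n"
        using fib_heap_root[OF consolidatingD(1)[OF con1 N] N z0'(1)] by metis
      have "par1 r < N + 4" unfolding par1_def by (rule forest_storeD(4)[OF fs1 N r(1)])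
      then have "par1 r = N \<or> par1 r = N + 1 \<or> par1 r = N + 2" using r by linarith
      moreover have "par1 r \<noteq> R" using empty1 r(1) by (auto simp: kids_def)
      ultimately have "par1 r = N + 2"
        using fib_heapD(7,8)[OF consolidatingD(1)[OF con1 N] N r(1)] r(4) z0'(3) R(2) by auto
      then show ?thesis using r(1) by (auto simp: kids_def)
    qed
    define x1 where "x1 = nval (last_child (NPlus (NVar ''N'') (NConst 2))) \<sigma>1"
    define \<sigma>2 where "\<sigma>2 = \<sigma>1\<lparr>nvar := (nvar \<sigma>1)(''x'' := x1)\<rparr>"
    have x1: "x1 \<in> kids N par1 (N + 2)"
      unfolding x1_def par1_def by (rule last_child_val[OF fs1 N]) (use N1 ne1 in \<open>simp_all add: par1_def\<close>)
    have inv2: "collect_inv n R par mk key k \<sigma>2"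
      using fs1 R1 key1 con1 pres1 x1 empty1 forest_store_cong[of \<sigma>2 \<sigma>1 n]
      unfolding collect_inv_def Let_def consolidate_inv_def
      by (simp add: \<sigma>2_def k_def par1_def flip: N)
    have "wp (While collect_test collect_body ;; While expose_test expose_body ;;
       NAssign ''mx'' (NVar ''x'') ;; NAssign ''mq'' (NPlus (NVar ''N'') (NConst 3)) ;; move)
      (\<lambda>t. ?Q (t1 + (13 + t))) \<sigma>2"
      unfolding wp_Seq[of "While collect_test collect_body"]
    proof (rule wp_mono[OF wp_While[where \<Phi>="collect_pot n", OF wp_collect_body[OF _ _ Rn] inv2]])
      fix t2 \<sigma>3
      assume 3: "collect_inv n R par mk key k \<sigma>3 \<and> \<not> bval collect_test \<sigma>3 \<and>
        t2 + collect_pot n \<sigma>3 \<le> collect_pot n \<sigma>2 + 1 + bcost collect_test"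
      define par3 where "par3 = narr \<sigma>3 ''par''"
      define x where "x = nvar \<sigma>3 ''x''"
      have fs3: "forest_store n \<sigma>3" and R3: "nvar \<sigma>3 ''R'' = R" and key3: "rarr \<sigma>3 ''key'' = key"
        and con3: "consolidating n R par3 (narr \<sigma>3 ''mk'') key (narr \<sigma>3 ''B'')"
        and pres3: "preserves n R par mk par3 (narr \<sigma>3 ''mk'')"
        and x3: "x \<in> kids N par3 R \<union> kids N par3 (N + 2)" "\<forall>z\<in>kids N par3 R. key x \<le> key z"
        and k3: "card (kids N par3 R) + card (kids N par3 (N + 2)) = k"
        using 3 unfolding collect_inv_def Let_def consolidate_inv_def par3_def x_def N by auto
      note N3 = forest_storeD(1)[OF fs3 N]
      note fh3 = consolidatingD(1)[OF con3 N]
      have "card (kids N par3 (N + 2)) = 0"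
        using 3 forest_storeD(3)[OF fs3 N, of "N + 2"] N3 by (simp add: collect_test_def par3_def)
      then have rp3: "kids N par3 (N + 2) = {}" by simp
      have B3: "narr \<sigma>3 ''B'' d = 0" for d
        using consolidatingD(3)[OF con3 N, of d] rp3 by (cases "narr \<sigma>3 ''B'' d") auto
      have xR: "x < N" "par3 x = R" using x3(1) rp3 by (auto simp: kids_def)
      have dx: "card (kids N par3 x) \<le> 3 * K + 2" by (rule fib_heap_degree_bound[OF fh3 N xR(1) K])
      have t2: "t2 \<le> 150 * k + 10"
        using 3 by (simp add: collect_pot_def collect_test_def k_def par1_def \<sigma>2_def N)
      have side: "x < n \<longleftrightarrow> R = N"
        by (rule kids_side[OF fh3 N R(2)]) (use xR in \<open>simp add: kids_def\<close>)
      have trash3: "\<forall>z<N. par3 z = N + 3 \<longleftrightarrow> par z = N + 3"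
        using pres3 unfolding preserves_def Let_def N by blast
      have xin: "par x \<noteq> N + 3" using trash3 xR R(2) by auto
      \<comment> \<open>\<open>z\<close> need not be a root, but the root above it has a key at most
        that of \<open>z\<close> and belongs to \<open>R\<close>, where \<open>x\<close> is
        minimal.\<close>
      have min: "key x \<le> key z" if z: "z < N" "par z \<noteq> N + 3" "z < n \<longleftrightarrow> R = N" for z
      proof -
        have "par3 z \<noteq> N + 3" using trash3 z by auto
        then obtain r where r: "r < N" "N \<le> par3 r" "par3 r \<noteq> N + 3" "key r \<le> key z" "r < n \<longleftrightarrow> z < n"
          using fib_heap_root[OF fh3 N z(1)] by metis
        have "par3 r < N + 4" unfolding par3_def by (rule forest_storeD(4)[OF fs3 N r(1)])
        then have "par3 r = N \<or> par3 r = N + 1 \<or> par3 r = N + 2" using r by linarith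
        moreover have "par3 r \<noteq> N + 2" using rp3 r(1) by (auto simp: kids_def)
        ultimately have "par3 r = R"
          using fib_heapD(7,8)[OF fh3 N r(1)] r(5) z(3) R(2) by auto
        then have "key x \<le> key r" using x3(2) r(1) by (auto simp: kids_def)
        then show ?thesis using r(4) by linarith
      qed
      define k' where "k' = card (kids N par3 R) + card (kids N par3 x)"
      have k': "k' \<le> 6 * K + 5" using k k3 dx by (simp add: k'_def)
      have inv3: "expose_inv n R par mk key x k' \<sigma>3"
        unfolding expose_inv_def Let_def par3_def[symmetric] N[symmetric]
        using fs3 R3 xR fh3 pres3 rp3 by (simp add: x_def k'_def)
      show "wp (While expose_test expose_body ;; NAssign ''mx'' (NVar ''x'') ;;
          NAssign ''mq'' (NPlus (NVar ''N'') (NConst 3)) ;; move) (\<lambda>u. ?Q (t1 + (13 + (t2 + u)))) \<sigma>3"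
        unfolding wp_Seq[of "While expose_test expose_body"]
      proof (rule wp_frame[OF wp_While[where \<Phi>="expose_pot n x", OF wp_expose_body[OF _ _ Rn] inv3]])
        fix t3 \<sigma>4
        assume 4: "expose_inv n R par mk key x k' \<sigma>4 \<and> \<not> bval expose_test \<sigma>4 \<and>
          t3 + expose_pot n x \<sigma>4 \<le> expose_pot n x \<sigma>3 + 1 + bcost expose_test"
          and um4: "unmodified (While expose_test expose_body) \<sigma>3 \<sigma>4"
        define par4 where "par4 = narr \<sigma>4 ''par''"
        define mk4 where "mk4 = narr \<sigma>4 ''mk''"
        have fs4: "forest_store n \<sigma>4" and x4: "nvar \<sigma>4 ''x'' = x" "par4 x = R"
          and fh4: "fib_heap n {} par4 mk4 key"
          and pres4: "preserves n R par mk par4 mk4"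
          and rp4: "kids N par4 (N + 2) = {}"
          and k4: "card (kids N par4 R) + card (kids N par4 x) = k'"
          using 4 unfolding expose_inv_def Let_def par4_def mk4_def N by auto
        have key4: "rarr \<sigma>4 ''key'' = key" and B4: "narr \<sigma>4 ''B'' = narr \<sigma>3 ''B''"
          using unmodifiedD(2)[OF um4, of "''B''"] unmodifiedD(3)[OF um4, of "''key''"] key3
          by (simp_all add: expose_body_def)
        note N4 = forest_storeD(1)[OF fs4 N]
        have "card (kids N par4 x) = 0"
          using 4 forest_storeD(3)[OF fs4 N, of x] x4 xR by (simp add: expose_test_def par4_def)
        then have ex4: "kids N par4 x = {}" by simp
        have t3: "t3 \<le> 100 * (3 * K + 2) + 10"
          using 4 dx by (simp add: expose_pot_def expose_test_def par3_def flip: N)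
        define par5 where "par5 = par4(x := N + 3)"
        have fh5: "fib_heap n {} par5 mk4 key"
          unfolding par5_def by (rule fib_heap_move_root[OF fh4 N xR(1)]) (use x4 R(2) ex4 in auto)
        have rp5: "kids N par5 (N + 2) = {}" using rp4 by (auto simp: kids_def par5_def)
        have tr5: "\<forall>z<N. par5 z = N + 3 \<longleftrightarrow> par z = N + 3 \<or> z = x"
          using pres4 unfolding preserves_def Let_def N[symmetric] by (auto simp: par5_def)
        have "kids N par5 N \<subseteq> kids N par4 N" "kids N par5 (N + 1) \<subseteq> kids N par4 (N + 1)"
          "marked N par5 mk4 \<subseteq> marked N par4 mk4"
          by (auto simp: kids_def par5_def marked_def)
        then have le5: "card (kids N par5 N) \<le> card (kids N par4 N)" "card (kids N par5 (N + 1)) \<le> card (kids N par4 (N + 1))"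
          "card (marked N par5 mk4) \<le> card (marked N par4 mk4)"
          by (auto intro!: card_mono)
        have "1000 * (card (kids N par4 N) + card (kids N par4 (N + 1)) + card (kids N par4 (N + 2)))
            + 2000 * card (marked N par4 mk4) + 1000 * card (kids N par R)
          \<le> potential n \<sigma> + 1000 * card (kids N par4 R)"
          using potential_preserves[OF pres4[unfolded par_def mk_def] N R(2)] rp rp4 by (simp add: par_def)
        then have pot5: "1000 * (card (kids N par5 N) + card (kids N par5 (N + 1)) + card (kids N par5 (N + 2)))
            + 2000 * card (marked N par5 mk4) + (t1 + t2 + t3 + 100) \<le> potential n \<sigma> + 10000 * (K + 1)"
          using le5 rp4 rp5 k4 k' k t1 t2 t3 by simp
        define \<sigma>5 where "\<sigma>5 = \<sigma>4\<lparr>nvar := (nvar \<sigma>4)(''mx'' := x, ''mq'' := N + 3)\<rparr>"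
        have "wp move (\<lambda>t \<sigma>'. t \<le> 60 \<and> forest_store n \<sigma>' \<and> narr \<sigma>' ''par'' = (narr \<sigma>5 ''par'')(x := N + 3) \<and>
          unmodified move \<sigma>5 \<sigma>') \<sigma>5"
          by (rule wp_move[OF _ N]) (use fs4 xR x4 R(2) forest_store_cong[of \<sigma>5 \<sigma>4 n] in \<open>auto simp: \<sigma>5_def par4_def\<close>)
        then have "wp move (\<lambda>u. ?Q (t1 + (13 + (t2 + (t3 + (6 + u)))))) \<sigma>5"
        proof (rule wp_mono)
          fix t :: nat and \<sigma>'
          assume *: "t \<le> 60 \<and> forest_store n \<sigma>' \<and> narr \<sigma>' ''par'' = (narr \<sigma>5 ''par'')(x := N + 3) \<and>
            unmodified move \<sigma>5 \<sigma>'"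
          note um = unmodifiedD[of move \<sigma>5 \<sigma>', simplified]
          have 5: "narr \<sigma>' ''par'' = par5" "narr \<sigma>' ''mk'' = mk4" "narr \<sigma>' ''B'' = narr \<sigma>3 ''B''"
            "nvar \<sigma>' ''x'' = x" "rarr \<sigma>' ''key'' = key" "forest_store n \<sigma>'"
            using * um x4 key4 B4 by (simp_all add: \<sigma>5_def par5_def par4_def mk4_def)
          have "heap_store n \<sigma>'"
            unfolding heap_store_def 5 N[symmetric] using 5(6) fh5 rp5 B3 by simp
          moreover have "t1 + (13 + (t2 + (t3 + (6 + t)))) + potential n \<sigma>' \<le> potential n \<sigma> + 10000 * (K + 1)"
            unfolding potential_def[of n \<sigma>'] Let_def 5 N[symmetric] using pot5 * by simp
          ultimately show "?Q (t1 + (13 + (t2 + (t3 + (6 + t))))) \<sigma>'"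
            unfolding 5 using xR(1) xin side min tr5 by blast
        qed
        then show "wp (NAssign ''mx'' (NVar ''x'') ;; NAssign ''mq'' (NPlus (NVar ''N'') (NConst 3)) ;; move)
            (\<lambda>u. ?Q (t1 + (13 + (t2 + (t3 + u))))) \<sigma>4"
          by (simp add: wp_simps x4(1) N4 \<sigma>5_def)
      qed
    qed
    then show "wp (NAssign ''x'' (last_child (NPlus (NVar ''N'') (NConst 2))) ;;
        While collect_test collect_body ;; While expose_test expose_body ;;
       NAssign ''mx'' (NVar ''x'') ;; NAssign ''mq'' (NPlus (NVar ''N'') (NConst 3)) ;; move)
      (\<lambda>u. ?Q (t1 + u)) \<sigma>1"
      unfolding wp_Seq[of "NAssign ''x'' (last_child (NPlus (NVar ''N'') (NConst 2)))"] wp_NAssign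
      by (simp add: \<sigma>2_def flip: x1_def)
  qed
  then show ?thesis
    unfolding par_def key_def by (rule wp_frame) blast
qed

section \<open>Scanning the arcs of a node\<close>

text \<open>Every arc is stored twice, as an arc between the elements of the out-heap and, reversed,
  between those of the in-heap, so that the same code serves both cases of the procedure.\<close>

definition queued ::
  "nat \<Rightarrow> (nat \<Rightarrow> nat) \<Rightarrow> (nat \<Rightarrow> real) \<Rightarrow> (nat \<Rightarrow> nat) \<Rightarrow> nat set \<Rightarrow> (nat \<Rightarrow> nat) \<Rightarrow> (nat \<Rightarrow> real) \<Rightarrow> bool" where
  "queued N tgt val visited F par key \<longleftrightarrow> (\<forall>u<N. visited u = 0 \<longrightarrow>
     (par u \<noteq> N + 3 \<longleftrightarrow> (\<exists>f\<in>F. tgt f = u)) \<and>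
     (par u \<noteq> N + 3 \<longrightarrow> (\<exists>f\<in>F. tgt f = u \<and> key u = val f)) \<and>
     (\<forall>f\<in>F. tgt f = u \<longrightarrow> key u \<le> val f))"

lemma queued_insert:
  assumes "queued N tgt val visited F par key" "par (tgt e) = N + 3" "q \<noteq> N + 3"
  shows "queued N tgt val visited (insert e F) (par(tgt e := q)) (key(tgt e := val e))"
  using assms unfolding queued_def by auto

text \<open>A cascade of cuts rearranges the forest, so the new parents are known only up to
  membership in a heap; \<open>queued\<close> depends on nothing more.\<close>

lemma queued_decrease:
  assumes Q: "queued N tgt val visited F par key" and e: "tgt e < N" "visited (tgt e) = 0" "par (tgt e) \<noteq> N + 3"
    and less: "val e < key (tgt e)" and par': "\<forall>z<N. par' z = N + 3 \<longleftrightarrow> par z = N + 3"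
  shows "queued N tgt val visited (insert e F) par' (key(tgt e := val e))"
  unfolding queued_def
proof (intro allI impI)
  fix u assume u: "u < N" "visited u = 0"
  have *: "(par u \<noteq> N + 3 \<longleftrightarrow> (\<exists>f\<in>F. tgt f = u)) \<and>
     (par u \<noteq> N + 3 \<longrightarrow> (\<exists>f\<in>F. tgt f = u \<and> key u = val f)) \<and>
     (\<forall>f\<in>F. tgt f = u \<longrightarrow> key u \<le> val f)"
    using Q u unfolding queued_def by blast
  have p: "par' u = N + 3 \<longleftrightarrow> par u = N + 3" using par' u by blast
  show "(par' u \<noteq> N + 3 \<longleftrightarrow> (\<exists>f\<in>insert e F. tgt f = u)) \<and>
     (par' u \<noteq> N + 3 \<longrightarrow> (\<exists>f\<in>insert e F. tgt f = u \<and> (key(tgt e := val e)) u = val f)) \<and>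
     (\<forall>f\<in>insert e F. tgt f = u \<longrightarrow> (key(tgt e := val e)) u \<le> val f)"
  proof (cases "u = tgt e")
    case True
    then show ?thesis using * p e less by force
  next
    case False
    then show ?thesis using * p by auto
  qed
qed

text \<open>Serves both the arcs into visited elements, about which \<open>queued\<close> is silent,
  and the arcs that do not improve a key.\<close>

lemma queued_keep:
  assumes Q: "queued N tgt val visited F par key" and e: "tgt e < N"
    "visited (tgt e) = 0 \<longrightarrow> par (tgt e) \<noteq> N + 3 \<and> key (tgt e) \<le> val e"
  shows "queued N tgt val visited (insert e F) par key"
  unfolding queued_def
proof (intro allI impI)
  fix u assume u: "u < N" "visited u = 0"
  have *: "(par u \<noteq> N + 3 \<longleftrightarrow> (\<exists>f\<in>F. tgt f = u)) \<and>
     (par u \<noteq> N + 3 \<longrightarrow> (\<exists>f\<in>F. tgt f = u \<and> key u = val f)) \<and>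
     (\<forall>f\<in>F. tgt f = u \<longrightarrow> key u \<le> val f)"
    using Q u unfolding queued_def by blast
  show "(par u \<noteq> N + 3 \<longleftrightarrow> (\<exists>f\<in>insert e F. tgt f = u)) \<and>
     (par u \<noteq> N + 3 \<longrightarrow> (\<exists>f\<in>insert e F. tgt f = u \<and> key u = val f)) \<and>
     (\<forall>f\<in>insert e F. tgt f = u \<longrightarrow> key u \<le> val f)"
    using * e u by (cases "u = tgt e") auto
qed

text \<open>A linked list in which \<open>Suc f\<close> points to \<open>f\<close> and 0 is the null
  pointer, in keeping with memory that is initially 0.\<close>

fun chain :: "(nat \<Rightarrow> nat) \<Rightarrow> nat \<Rightarrow> nat list \<Rightarrow> bool" where
  "chain nxt p [] \<longleftrightarrow> p = 0"
| "chain nxt p (f # fs) \<longleftrightarrow> p = Suc f \<and> chain nxt (nxt f) fs"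

text \<open>Reals live in arrays only, so cell 0 of \<open>nk\<close> acts as the variable for the
  candidate key. \<open>kx\<close> remembers the element because \<open>cascade\<close> overwrites
  \<open>u\<close>.\<close>

definition scan_body :: com where
  "scan_body =
     NAssign ''e'' (NMinus (NVar ''f'') (NConst 1)) ;;
     NAssign ''u'' (NArr ''tgt'' (NVar ''e'')) ;;
     NAssign ''f'' (NArr ''nxt'' (NVar ''e'')) ;;
     If (NLess (NConst 0) (NArr ''visited'' (NVar ''u''))) Skip
       (RArrAssign ''nk'' (NConst 0) (RPlus (RArr ''cst'' (NVar ''e'')) (RArr ''y'' (NVar ''q''))) ;;
        If (NLess (NArr ''par'' (NVar ''u'')) (NPlus (NVar ''N'') (NConst 3)))
          (If (RLess (RArr ''nk'' (NConst 0)) (RArr ''key'' (NVar ''u'')))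
            (NAssign ''kx'' (NVar ''u'') ;; cascade ;;
             RArrAssign ''key'' (NVar ''kx'') (RArr ''nk'' (NConst 0))) Skip)
          (RArrAssign ''key'' (NVar ''u'') (RArr ''nk'' (NConst 0)) ;;
           NAssign ''mx'' (NVar ''u'') ;; NAssign ''mq'' (NVar ''R'') ;; move))"

definition scan_test :: bexp where
  "scan_test = NLess (NConst 0) (NVar ''f'')"

text \<open>\<open>F\<close> collects the arcs already scanned, \<open>fs\<close> those still in the
  list. The last clause, that visited elements neither enter nor leave a heap, is what limits each
  element to a single extraction.\<close>

definition scan_inv ::
  "nat \<Rightarrow> nat \<Rightarrow> (nat \<Rightarrow> nat) \<Rightarrow> (nat \<Rightarrow> nat) \<Rightarrow> (nat \<Rightarrow> real) \<Rightarrow> (nat \<Rightarrow> nat) \<Rightarrow> (nat \<Rightarrow> real) \<Rightarrow>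
     (nat \<Rightarrow> nat) \<Rightarrow> nat \<Rightarrow> nat set \<Rightarrow> nat list \<Rightarrow> store \<Rightarrow> bool" where
  "scan_inv n H src tgt cst visited y par0 q F fs \<sigma> \<longleftrightarrow> (let N = n + n in
     heap_store n \<sigma> \<and> (\<forall>f<H. narr \<sigma> ''tgt'' f = tgt f \<and> rarr \<sigma> ''cst'' f = cst f) \<and>
     narr \<sigma> ''visited'' = visited \<and> rarr \<sigma> ''y'' = y \<and> nvar \<sigma> ''q'' = q \<and>
     nvar \<sigma> ''R'' = (if q < n then N else N + 1) \<and>
     chain (narr \<sigma> ''nxt'') (nvar \<sigma> ''f'') fs \<and> (\<forall>f\<in>set fs. f < H \<and> src f = q) \<and>
     queued N tgt (\<lambda>f. cst f + y (src f)) visited F (narr \<sigma> ''par'') (rarr \<sigma> ''key'') \<and>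
     (\<forall>u<N. visited u \<noteq> 0 \<longrightarrow> (narr \<sigma> ''par'' u = N + 3 \<longleftrightarrow> par0 u = N + 3)))"

text \<open>The allowance of 5000 is dictated by the most expensive outcome, a decreased key, for
  which the cascade alone may take 4100.\<close>

lemma wp_scan_body:
  assumes inv: "scan_inv n H src tgt cst visited y par0 q F (e # fs) \<sigma>"
    and sides: "tgt e < n + n" "tgt e < n \<longleftrightarrow> src e < n"
  shows "wp scan_body (\<lambda>t \<sigma>'. scan_inv n H src tgt cst visited y par0 q (insert e F) fs \<sigma>' \<and>
    t + potential n \<sigma>' \<le> potential n \<sigma> + 5000) \<sigma>"
proof -
  define N where N: "N = n + n"
  define par where "par = narr \<sigma> ''par''"
  define mk where "mk = narr \<sigma> ''mk''"
  define key where "key = rarr \<sigma> ''key''"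
  define R where "R = (if q < n then N else N + 1)"
  define u where "u = tgt e"
  let ?val = "\<lambda>f. cst f + y (src f)"
  note inv' = inv[unfolded scan_inv_def Let_def, folded N par_def key_def, folded R_def]
  have hs: "heap_store n \<sigma>" and st: "\<forall>f<H. narr \<sigma> ''tgt'' f = tgt f \<and> rarr \<sigma> ''cst'' f = cst f"
    and vis: "narr \<sigma> ''visited'' = visited" and y: "rarr \<sigma> ''y'' = y" and q: "nvar \<sigma> ''q'' = q"
    and R: "nvar \<sigma> ''R'' = R" and f: "nvar \<sigma> ''f'' = Suc e"
    and ch: "chain (narr \<sigma> ''nxt'') (narr \<sigma> ''nxt'' e) fs" and fs: "\<forall>f\<in>set fs. f < H \<and> src f = q"
    and e: "e < H" "src e = q"
    and Q: "queued N tgt ?val visited F par key"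
    and par0: "\<forall>u<N. visited u \<noteq> 0 \<longrightarrow> (par u = N + 3 \<longleftrightarrow> par0 u = N + 3)"
    using inv' by auto
  have te: "narr \<sigma> ''tgt'' e = u" "rarr \<sigma> ''cst'' e = cst e" using st e by (auto simp: u_def)
  have u: "u < N" "u < n \<longleftrightarrow> q < n" using sides e by (auto simp: u_def N)
  have hs': "forest_store n \<sigma>" "fib_heap n {} par mk key" "kids N par (N + 2) = {}" "\<And>d. narr \<sigma> ''B'' d = 0"
    using hs unfolding heap_store_def N par_def mk_def key_def by auto
  note NN = forest_storeD(1)[OF hs'(1) N]
  have p4: "par u < N + 4" unfolding par_def by (rule forest_storeD(4)[OF hs'(1) N u(1)])
  have Ru: "R = (if u < n then N else N + 1)" using u by (simp add: R_def)
  have R': "R < N + 4" "R \<noteq> N + 3" "R \<noteq> N + 2" "N \<le> R" by (auto simp: R_def)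
  define \<sigma>0 where "\<sigma>0 = \<sigma>\<lparr>nvar := (nvar \<sigma>)(''e'' := e, ''u'' := u, ''f'' := narr \<sigma> ''nxt'' e)\<rparr>"
  define \<sigma>1 where "\<sigma>1 = \<sigma>0\<lparr>rarr := (rarr \<sigma>)(''nk'' := (rarr \<sigma> ''nk'')(0 := ?val e))\<rparr>"
  let ?post = "\<lambda>t \<sigma>'. scan_inv n H src tgt cst visited y par0 q (insert e F) fs \<sigma>' \<and>
    t + potential n \<sigma>' \<le> potential n \<sigma> + 5000"
  let ?rest = "If (NLess (NArr ''par'' (NVar ''u'')) (NPlus (NVar ''N'') (NConst 3)))
          (If (RLess (RArr ''nk'' (NConst 0)) (RArr ''key'' (NVar ''u'')))
            (NAssign ''kx'' (NVar ''u'') ;; cascade ;;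
             RArrAssign ''key'' (NVar ''kx'') (RArr ''nk'' (NConst 0))) Skip)
          (RArrAssign ''key'' (NVar ''u'') (RArr ''nk'' (NConst 0)) ;;
           NAssign ''mx'' (NVar ''u'') ;; NAssign ''mq'' (NVar ''R'') ;; move)"
  \<comment> \<open>All outcomes for an arc (skipped, inserted, decreased, kept) end here; they
    differ only in the heap and in the keys.\<close>
  have fin: "scan_inv n H src tgt cst visited y par0 q (insert e F) fs \<sigma>'"
    if "heap_store n \<sigma>'" "queued N tgt ?val visited (insert e F) (narr \<sigma>' ''par'') (rarr \<sigma>' ''key'')"
      "\<forall>z<N. visited z \<noteq> 0 \<longrightarrow> (narr \<sigma>' ''par'' z = N + 3 \<longleftrightarrow> par z = N + 3)"
      "narr \<sigma>' ''tgt'' = narr \<sigma> ''tgt''" "narr \<sigma>' ''visited'' = narr \<sigma> ''visited''" "narr \<sigma>' ''nxt'' = narr \<sigma> ''nxt''"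
      "rarr \<sigma>' ''cst'' = rarr \<sigma> ''cst''" "rarr \<sigma>' ''y'' = rarr \<sigma> ''y''"
      "nvar \<sigma>' ''q'' = nvar \<sigma> ''q''" "nvar \<sigma>' ''R'' = nvar \<sigma> ''R''" "nvar \<sigma>' ''f'' = narr \<sigma> ''nxt'' e" for \<sigma>'
    unfolding scan_inv_def Let_def N[symmetric] R_def[symmetric] that(4-11) vis y q R
    using that(1-3) st ch fs par0 by simp
  have rest: "wp ?rest (\<lambda>t. ?post (60 + t)) \<sigma>1" if vu: "visited u = 0"
  proof (cases "par u < N + 3")
    case False
    then have pu: "par u = N + 3" using p4 by linarith
    \<comment> \<open>An element outside both heaps has no children, so its key can be set to any
      value.\<close>
    have ku: "kids N par u = {}"
      using fib_heapD(6)[OF hs'(2) N] pu u(1) by (auto simp: kids_def)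
    define key' where "key' = key(u := ?val e)"
    have fh1: "fib_heap n {} par mk key'"
      unfolding key'_def by (rule fib_heap_key[OF hs'(2) N]) (use pu ku in auto)
    have fh2: "fib_heap n {} (par(u := R)) mk key'"
      by (rule fib_heap_move_root[OF fh1 N u(1)]) (use pu R' Ru in auto)
    have rp: "kids N (par(u := R)) (N + 2) = {}" using hs'(3) R' by (auto simp: kids_def)
    have Q': "queued N tgt ?val visited (insert e F) (par(u := R)) key'"
      unfolding key'_def u_def by (rule queued_insert[OF Q]) (use pu R' in \<open>auto simp: u_def\<close>)
    have vis': "\<forall>z<N. visited z \<noteq> 0 \<longrightarrow> ((par(u := R)) z = N + 3 \<longleftrightarrow> par z = N + 3)"
      using vu by auto
    have up: "R \<noteq> par u" using pu R' by simp
    have "card (kids N (par(u := R)) N) + card (kids N (par(u := R)) (N + 1)) + card (kids N (par(u := R)) (N + 2))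
        = card (kids N par N) + card (kids N par (N + 1)) + card (kids N par (N + 2)) + 1"
      using card_kids_upd[where par=par, OF u(1) up] pu by (auto simp: R_def)
    moreover have "marked N (par(u := R)) mk = marked N par mk" using pu R' by (auto simp: marked_def)
    ultimately have pot: "1000 * (card (kids N (par(u := R)) N) + card (kids N (par(u := R)) (N + 1)) + card (kids N (par(u := R)) (N + 2)))
        + 2000 * card (marked N (par(u := R)) mk) = potential n \<sigma> + 1000"
      unfolding potential_def Let_def N[symmetric] par_def[symmetric] mk_def[symmetric] by simp
    define \<sigma>2 where "\<sigma>2 = \<sigma>1\<lparr>nvar := (nvar \<sigma>1)(''mx'' := u, ''mq'' := R), rarr := (rarr \<sigma>1)(''key'' := key')\<rparr>"
    have "wp move (\<lambda>t \<sigma>'. t \<le> 60 \<and> forest_store n \<sigma>' \<and> narr \<sigma>' ''par'' = (narr \<sigma>2 ''par'')(u := R) \<and>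
      unmodified move \<sigma>2 \<sigma>') \<sigma>2"
      by (rule wp_move[OF _ N]) (use hs'(1) u R' up forest_store_cong[of \<sigma>2 \<sigma> n] in \<open>auto simp: \<sigma>2_def \<sigma>1_def \<sigma>0_def par_def\<close>)
    then have "wp move (\<lambda>t. ?post (100 + t)) \<sigma>2"
    proof (rule wp_mono)
      fix t :: nat and \<sigma>'
      assume *: "t \<le> 60 \<and> forest_store n \<sigma>' \<and> narr \<sigma>' ''par'' = (narr \<sigma>2 ''par'')(u := R) \<and> unmodified move \<sigma>2 \<sigma>'"
      note um = unmodifiedD[of move \<sigma>2 \<sigma>', simplified]
      have 3: "narr \<sigma>' ''par'' = par(u := R)" "narr \<sigma>' ''mk'' = mk" "narr \<sigma>' ''B'' = narr \<sigma> ''B''" "rarr \<sigma>' ''key'' = key'"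
        using * um by (simp_all add: \<sigma>2_def \<sigma>1_def \<sigma>0_def par_def mk_def)
      have 4: "narr \<sigma>' ''tgt'' = narr \<sigma> ''tgt''" "narr \<sigma>' ''visited'' = narr \<sigma> ''visited''" "narr \<sigma>' ''nxt'' = narr \<sigma> ''nxt''"
          "rarr \<sigma>' ''cst'' = rarr \<sigma> ''cst''" "rarr \<sigma>' ''y'' = rarr \<sigma> ''y''"
          "nvar \<sigma>' ''q'' = nvar \<sigma> ''q''" "nvar \<sigma>' ''R'' = nvar \<sigma> ''R''" "nvar \<sigma>' ''f'' = narr \<sigma> ''nxt'' e"
        using * um by (simp_all add: \<sigma>2_def \<sigma>1_def \<sigma>0_def)
      have "heap_store n \<sigma>'"
        unfolding heap_store_def 3 N[symmetric] using * fh2 rp hs'(4) by simp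
      then have "scan_inv n H src tgt cst visited y par0 q (insert e F) fs \<sigma>'"
        by (rule fin) (use Q' vis' 4 in \<open>simp_all add: 3\<close>)
      moreover have "100 + t + potential n \<sigma>' \<le> potential n \<sigma> + 5000"
        unfolding potential_def[of n \<sigma>'] Let_def 3 N[symmetric] using pot * by simp
      ultimately show "?post (100 + t) \<sigma>'" by blast
    qed
    then show ?thesis
      using False R NN
      by (simp add: wp_simps \<sigma>2_def \<sigma>1_def \<sigma>0_def key'_def flip: par_def key_def) (erule wp_mono, simp)
  next
    case True
    show ?thesis
    proof (cases "?val e < key u")
      case False
      have "queued N tgt ?val visited (insert e F) par key"
        by (rule queued_keep[OF Q]) (use u(1) True False in \<open>auto simp: u_def\<close>)
      moreover have "heap_store n \<sigma>1"
        using hs forest_store_cong[of \<sigma>1 \<sigma> n] by (simp add: heap_store_def \<sigma>1_def \<sigma>0_def)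
      ultimately have "scan_inv n H src tgt cst visited y par0 q (insert e F) fs \<sigma>1"
        by (intro fin) (simp_all add: \<sigma>1_def \<sigma>0_def par_def key_def)
      moreover have "potential n \<sigma>1 = potential n \<sigma>" by (rule potential_cong) (simp_all add: \<sigma>1_def \<sigma>0_def)
      moreover have "bval (NLess (NArr ''par'' (NVar ''u'')) (NPlus (NVar ''N'') (NConst 3))) \<sigma>1"
        "\<not> bval (RLess (RArr ''nk'' (NConst 0)) (RArr ''key'' (NVar ''u''))) \<sigma>1"
        using True False NN by (simp_all add: \<sigma>1_def \<sigma>0_def flip: par_def key_def)
      ultimately show ?thesis by (simp add: wp_If wp_Skip)
    next
      case less: True
      define \<sigma>2 where "\<sigma>2 = \<sigma>1\<lparr>nvar := (nvar \<sigma>1)(''kx'' := u)\<rparr>"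
      have "wp cascade (\<lambda>t \<sigma>'. forest_store n \<sigma>' \<and> fib_heap n {} (narr \<sigma>' ''par'') (narr \<sigma>' ''mk'') key \<and>
        N \<le> narr \<sigma>' ''par'' u \<and>
        (\<forall>z<N. narr \<sigma>' ''par'' z = N + 3 \<longleftrightarrow> narr \<sigma>2 ''par'' z = N + 3) \<and>
        kids N (narr \<sigma>' ''par'') (N + 2) = kids N (narr \<sigma>2 ''par'') (N + 2) \<and>
        t + potential n \<sigma>' \<le> potential n \<sigma>2 + 4100 \<and> unmodified cascade \<sigma>2 \<sigma>') \<sigma>2"
        by (rule wp_cascade[OF _ N])
          (use hs'(1,2) u(1) R Ru forest_store_cong[of \<sigma>2 \<sigma> n] in \<open>simp_all add: \<sigma>2_def \<sigma>1_def \<sigma>0_def par_def mk_def\<close>)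
      then have "wp cascade (\<lambda>t. wp (RArrAssign ''key'' (NVar ''kx'') (RArr ''nk'' (NConst 0))) (\<lambda>t'. ?post (100 + t + t'))) \<sigma>2"
      proof (rule wp_mono)
        fix t :: nat and \<sigma>'
        assume *: "forest_store n \<sigma>' \<and> fib_heap n {} (narr \<sigma>' ''par'') (narr \<sigma>' ''mk'') key \<and>
          N \<le> narr \<sigma>' ''par'' u \<and>
          (\<forall>z<N. narr \<sigma>' ''par'' z = N + 3 \<longleftrightarrow> narr \<sigma>2 ''par'' z = N + 3) \<and>
          kids N (narr \<sigma>' ''par'') (N + 2) = kids N (narr \<sigma>2 ''par'') (N + 2) \<and>
          t + potential n \<sigma>' \<le> potential n \<sigma>2 + 4100 \<and> unmodified cascade \<sigma>2 \<sigma>'"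
        note um = unmodifiedD[of cascade \<sigma>2 \<sigma>', simplified]
        have 3: "narr \<sigma>' ''B'' = narr \<sigma> ''B''" "rarr \<sigma>' ''key'' = key" "nvar \<sigma>' ''kx'' = u" "rarr \<sigma>' ''nk'' 0 = ?val e"
          using * um by (simp_all add: \<sigma>2_def \<sigma>1_def \<sigma>0_def key_def)
        have 4: "narr \<sigma>' ''tgt'' = narr \<sigma> ''tgt''" "narr \<sigma>' ''visited'' = narr \<sigma> ''visited''" "narr \<sigma>' ''nxt'' = narr \<sigma> ''nxt''"
          "rarr \<sigma>' ''cst'' = rarr \<sigma> ''cst''" "rarr \<sigma>' ''y'' = rarr \<sigma> ''y''"
          "nvar \<sigma>' ''q'' = nvar \<sigma> ''q''" "nvar \<sigma>' ''R'' = nvar \<sigma> ''R''" "nvar \<sigma>' ''f'' = narr \<sigma> ''nxt'' e"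
          using * um by (simp_all add: \<sigma>2_def \<sigma>1_def \<sigma>0_def)
        define \<sigma>3 where "\<sigma>3 = \<sigma>'\<lparr>rarr := (rarr \<sigma>')(''key'' := key(u := ?val e))\<rparr>"
        have fh3: "fib_heap n {} (narr \<sigma>' ''par'') (narr \<sigma>' ''mk'') (key(u := ?val e))"
          by (rule fib_heap_key[OF _ N]) (use * less in auto)
        have tr: "\<forall>z<N. narr \<sigma>' ''par'' z = N + 3 \<longleftrightarrow> par z = N + 3"
          "kids N (narr \<sigma>' ''par'') (N + 2) = kids N par (N + 2)"
          using * by (simp_all add: \<sigma>2_def \<sigma>1_def \<sigma>0_def par_def)
        have Q': "queued N tgt ?val visited (insert e F) (narr \<sigma>' ''par'') (key(u := ?val e))"
          unfolding u_def by (rule queued_decrease[OF Q]) (use u(1) vu True less tr in \<open>auto simp: u_def\<close>)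
        have "heap_store n \<sigma>3"
          unfolding heap_store_def N[symmetric] using * fh3 tr(2) hs'(3,4) 3(1) forest_store_cong[of \<sigma>3 \<sigma>' n]
          by (simp add: \<sigma>3_def)
        then have "scan_inv n H src tgt cst visited y par0 q (insert e F) fs \<sigma>3"
          by (rule fin) (use Q' tr 4 in \<open>simp_all add: \<sigma>3_def\<close>)
        moreover have "potential n \<sigma>3 = potential n \<sigma>'" "potential n \<sigma>2 = potential n \<sigma>"
          by (rule potential_cong; simp add: \<sigma>3_def \<sigma>2_def \<sigma>1_def \<sigma>0_def)+
        ultimately show "wp (RArrAssign ''key'' (NVar ''kx'') (RArr ''nk'' (NConst 0))) (\<lambda>t'. ?post (100 + t + t')) \<sigma>'"
          using * by (simp add: wp_simps 3 \<sigma>3_def)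
      qed
      moreover have "bval (NLess (NArr ''par'' (NVar ''u'')) (NPlus (NVar ''N'') (NConst 3))) \<sigma>1"
        "bval (RLess (RArr ''nk'' (NConst 0)) (RArr ''key'' (NVar ''u''))) \<sigma>1"
        using True less NN by (simp_all add: \<sigma>1_def \<sigma>0_def flip: par_def key_def)
      moreover have "nvar \<sigma>1 ''u'' = u" by (simp add: \<sigma>1_def \<sigma>0_def)
      ultimately show ?thesis
        apply (simp add: wp_If wp_Seq[of "NAssign ''kx'' (NVar ''u'')"] wp_Seq[of cascade] wp_NAssign flip: \<sigma>2_def)
        apply (erule wp_mono, erule wp_mono, simp)
        done
    qed
  qed
  show ?thesis
  proof (cases "visited u = 0")
    case True
    then show ?thesis
      using rest[OF True]
      unfolding scan_body_def
      by (simp add: wp_simps(1-5) wp_If[of "NLess (NConst 0) (NArr ''visited'' (NVar ''u''))"] f te vis y q e \<sigma>1_def \<sigma>0_def) (erule wp_mono, simp)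
  next
    case False
    have "queued N tgt ?val visited (insert e F) par key"
      by (rule queued_keep[OF Q]) (use u(1) False in \<open>auto simp: u_def\<close>)
    moreover have "heap_store n \<sigma>0"
      using hs forest_store_cong[of \<sigma>0 \<sigma> n] by (simp add: heap_store_def \<sigma>0_def)
    ultimately have "scan_inv n H src tgt cst visited y par0 q (insert e F) fs \<sigma>0"
      by (intro fin) (simp_all add: \<sigma>0_def par_def key_def)
    moreover have "potential n \<sigma>0 = potential n \<sigma>" by (rule potential_cong) (simp_all add: \<sigma>0_def)
    ultimately show ?thesis
      using False by (simp add: scan_body_def wp_simps f te vis \<sigma>0_def)
  qed
qed

text \<open>The remaining list is a ghost value, whereas the potential in \<open>wp_While\<close> is
  a function of the store; hence the induction on the list. The 5100 per arc add the loop test to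
  the 5000 of the body.\<close>

lemma wp_scan:
  assumes "scan_inv n H src tgt cst visited y par0 q F fs \<sigma>"
    and sides: "\<And>f. f < H \<Longrightarrow> tgt f < n + n" "\<And>f. f < H \<Longrightarrow> tgt f < n \<longleftrightarrow> src f < n"
  shows "wp (While scan_test scan_body)
    (\<lambda>t \<sigma>'. scan_inv n H src tgt cst visited y par0 q (F \<union> set fs) [] \<sigma>' \<and>
       t + potential n \<sigma>' \<le> potential n \<sigma> + 5100 * length fs + 10) \<sigma>"
  using assms(1)
proof (induction fs arbitrary: F \<sigma>)
  case Nil
  then have "nvar \<sigma> ''f'' = 0" by (simp add: scan_inv_def Let_def)
  then show ?case
    using Nil by (intro wp_WhileFalse) (simp_all add: scan_test_def)
next
  case (Cons e fs)
  have e: "nvar \<sigma> ''f'' = Suc e" "e < H" using Cons.prems by (auto simp: scan_inv_def Let_def)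
  show ?case
  proof (rule wp_WhileTrue)
    show "bval scan_test \<sigma>" using e by (simp add: scan_test_def)
    show "wp scan_body (\<lambda>t. wp (While scan_test scan_body) (\<lambda>u \<sigma>'.
        scan_inv n H src tgt cst visited y par0 q (F \<union> set (e # fs)) [] \<sigma>' \<and>
        1 + bcost scan_test + t + u + potential n \<sigma>' \<le> potential n \<sigma> + 5100 * length (e # fs) + 10)) \<sigma>"
    proof (rule wp_mono[OF wp_scan_body[OF Cons.prems sides(1)[OF e(2)] sides(2)[OF e(2)]]])
      fix t \<sigma>1
      assume 1: "scan_inv n H src tgt cst visited y par0 q (insert e F) fs \<sigma>1 \<and>
        t + potential n \<sigma>1 \<le> potential n \<sigma> + 5000"
      then have "scan_inv n H src tgt cst visited y par0 q (insert e F) fs \<sigma>1" by blast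
      from Cons.IH[OF this] show "wp (While scan_test scan_body) (\<lambda>u \<sigma>'.
        scan_inv n H src tgt cst visited y par0 q (F \<union> set (e # fs)) [] \<sigma>' \<and>
        1 + bcost scan_test + t + u + potential n \<sigma>' \<le> potential n \<sigma> + 5100 * length (e # fs) + 10) \<sigma>1"
        by (rule wp_mono) (use 1 in \<open>auto simp: scan_test_def\<close>)
    qed
  qed
qed

section \<open>Adding a node and scanning its arcs\<close>

definition visit :: com where
  "visit =
     NArrAssign ''visited'' (NVar ''w'') (NConst 1) ;;
     NArrAssign ''visited'' (NPlus (NVar ''n'') (NVar ''w'')) (NConst 1) ;;
     RArrAssign ''bs'' (NConst 0) (RPlus (RArr ''bs'' (NConst 0)) (RArr ''b'' (NVar ''w''))) ;;
     NAssign ''cnt'' (NPlus (NVar ''cnt'') (NConst 1)) ;;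
     RArrAssign ''y'' (NPlus (NVar ''n'') (NVar ''w'')) (RMinus RZero (RArr ''y'' (NVar ''w''))) ;;
     NAssign ''q'' (NVar ''w'') ;; NAssign ''R'' (NVar ''N'') ;;
     NAssign ''f'' (NArr ''fst'' (NVar ''q'')) ;;
     While scan_test scan_body ;;
     NAssign ''q'' (NPlus (NVar ''n'') (NVar ''w'')) ;; NAssign ''R'' (NPlus (NVar ''N'') (NConst 1)) ;;
     NAssign ''f'' (NArr ''fst'' (NVar ''q'')) ;;
     While scan_test scan_body"

lemma scan_body_mods [simp]:
  "nvar_mods scan_body = {''e'', ''u'', ''f'', ''kx'', ''mp'', ''ml'', ''go'', ''up'', ''mx'', ''mq''}"
  "narr_mods scan_body = {''deg'', ''ch'', ''pos'', ''par'', ''mk''}"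
  "rarr_mods scan_body = {''nk'', ''key''}"
  by (auto simp: scan_body_def)

lemma visit_mods [simp]:
  "nvar_mods visit = {''cnt'', ''q'', ''R'', ''e'', ''u'', ''f'', ''kx'', ''mp'', ''ml'', ''go'', ''up'', ''mx'', ''mq''}"
  "narr_mods visit = {''visited'', ''deg'', ''ch'', ''pos'', ''par'', ''mk''}"
  "rarr_mods visit = {''nk'', ''key'', ''bs'', ''y''}"
  by (auto simp: visit_def)

definition graph_store ::
  "nat \<Rightarrow> nat \<Rightarrow> (nat \<Rightarrow> nat) \<Rightarrow> (nat \<Rightarrow> nat) \<Rightarrow> (nat \<Rightarrow> real) \<Rightarrow> (nat \<Rightarrow> real) \<Rightarrow> (nat \<Rightarrow> real) \<Rightarrow> store \<Rightarrow> bool" where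
  "graph_store n H src tgt cst b y0 \<sigma> \<longleftrightarrow> nvar \<sigma> ''n'' = n \<and>
     (\<forall>f<H. narr \<sigma> ''tgt'' f = tgt f \<and> rarr \<sigma> ''cst'' f = cst f) \<and>
     (\<forall>q<n + n. \<exists>fs. chain (narr \<sigma> ''nxt'') (narr \<sigma> ''fst'' q) fs \<and> distinct fs \<and> set fs = {f. f < H \<and> src f = q}) \<and>
     (\<forall>v<n. rarr \<sigma> ''b'' v = b v \<and> rarr \<sigma> ''y0'' v = y0 v)"

lemma graph_store_cong:
  assumes "nvar \<sigma>' ''n'' = nvar \<sigma> ''n''" "narr \<sigma>' ''tgt'' = narr \<sigma> ''tgt''" "narr \<sigma>' ''nxt'' = narr \<sigma> ''nxt''"
    "narr \<sigma>' ''fst'' = narr \<sigma> ''fst''" "rarr \<sigma>' ''cst'' = rarr \<sigma> ''cst''" "rarr \<sigma>' ''b'' = rarr \<sigma> ''b''"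
    "rarr \<sigma>' ''y0'' = rarr \<sigma> ''y0''"
  shows "graph_store n H src tgt cst b y0 \<sigma>' = graph_store n H src tgt cst b y0 \<sigma>"
  unfolding graph_store_def assms ..

definition search_store :: "nat \<Rightarrow> (nat \<Rightarrow> real) \<Rightarrow> nat set \<Rightarrow> store \<Rightarrow> bool" where
  "search_store n b S \<sigma> \<longleftrightarrow> heap_store n \<sigma> \<and> S \<subseteq> {..<n} \<and>
     (\<forall>v<n. (narr \<sigma> ''visited'' v \<noteq> 0 \<longleftrightarrow> v \<in> S) \<and> (narr \<sigma> ''visited'' (n + v) \<noteq> 0 \<longleftrightarrow> v \<in> S)) \<and>
     nvar \<sigma> ''cnt'' = card S \<and> rarr \<sigma> ''bs'' 0 = (\<Sum>v\<in>S. b v) \<and>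
     (\<forall>v\<in>S. rarr \<sigma> ''y'' (n + v) = - rarr \<sigma> ''y'' v)"

lemma search_store_cong:
  assumes "heap_store n \<sigma>' = heap_store n \<sigma>" "narr \<sigma>' ''visited'' = narr \<sigma> ''visited''" "nvar \<sigma>' ''cnt'' = nvar \<sigma> ''cnt''"
    "rarr \<sigma>' ''bs'' = rarr \<sigma> ''bs''" "\<And>v. v \<in> S \<Longrightarrow> rarr \<sigma>' ''y'' v = rarr \<sigma> ''y'' v"
    "\<And>v. v \<in> S \<Longrightarrow> rarr \<sigma>' ''y'' (n + v) = rarr \<sigma> ''y'' (n + v)"
  shows "search_store n b S \<sigma>' = search_store n b S \<sigma>"
  unfolding search_store_def using assms by simp

lemma heap_store_cong:
  assumes "forest_store n \<sigma>' = forest_store n \<sigma>" "narr \<sigma>' ''par'' = narr \<sigma> ''par''" "narr \<sigma>' ''mk'' = narr \<sigma> ''mk''"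
    "narr \<sigma>' ''B'' = narr \<sigma> ''B''" "rarr \<sigma>' ''key'' = rarr \<sigma> ''key''"
  shows "heap_store n \<sigma>' = heap_store n \<sigma>"
  unfolding heap_store_def assms ..

text \<open>Marking more nodes as visited only weakens \<open>queued\<close>, and potentials enter
  it only through the values of the arcs in \<open>F\<close>.\<close>

lemma queued_cong:
  assumes Q: "queued N tgt val visited F par key"
    and "\<And>f. f \<in> F \<Longrightarrow> val' f = val f" "\<And>u. u < N \<Longrightarrow> visited' u = 0 \<Longrightarrow> visited u = 0"
    and "\<And>u. u < N \<Longrightarrow> visited' u = 0 \<Longrightarrow> par' u = N + 3 \<longleftrightarrow> par u = N + 3"
  shows "queued N tgt val' visited' F par' key"
  unfolding queued_def
proof (intro allI impI)
  fix u assume u: "u < N" "visited' u = 0"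
  then have *: "(par u \<noteq> N + 3 \<longleftrightarrow> (\<exists>f\<in>F. tgt f = u)) \<and>
     (par u \<noteq> N + 3 \<longrightarrow> (\<exists>f\<in>F. tgt f = u \<and> key u = val f)) \<and>
     (\<forall>f\<in>F. tgt f = u \<longrightarrow> key u \<le> val f)"
    using Q assms(3) unfolding queued_def by blast
  have p: "par' u = N + 3 \<longleftrightarrow> par u = N + 3" using assms(4) u by blast
  show "(par' u \<noteq> N + 3 \<longleftrightarrow> (\<exists>f\<in>F. tgt f = u)) \<and>
     (par' u \<noteq> N + 3 \<longrightarrow> (\<exists>f\<in>F. tgt f = u \<and> key u = val' f)) \<and>
     (\<forall>f\<in>F. tgt f = u \<longrightarrow> key u \<le> val' f)"
    unfolding p using * assms(2) by simp
qed

text \<open>The hypothesis on \<open>queued\<close> already treats \<open>w\<close> as visited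
  although its arcs are not yet in the scanned set: this is the state between extracting
  \<open>w\<close> and scanning it. In the conclusion both agree again.\<close>

lemma wp_visit:
  assumes gs: "graph_store n H src tgt cst b y0 \<sigma>" and ss: "search_store n b S \<sigma>"
    and w: "nvar \<sigma> ''w'' = w" "w < n" "w \<notin> S"
    and sides: "\<And>f. f < H \<Longrightarrow> tgt f < n + n" "\<And>f. f < H \<Longrightarrow> tgt f < n \<longleftrightarrow> src f < n"
    and vis: "visited = (narr \<sigma> ''visited'')(w := 1, n + w := 1)"
    and Q: "queued (n + n) tgt (\<lambda>f. cst f + rarr \<sigma> ''y'' (src f)) visited
      {f. f < H \<and> narr \<sigma> ''visited'' (src f) \<noteq> 0} (narr \<sigma> ''par'') (rarr \<sigma> ''key'')"
  shows "wp visit (\<lambda>t \<sigma>'. graph_store n H src tgt cst b y0 \<sigma>' \<and> search_store n b (insert w S) \<sigma>' \<and>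
    narr \<sigma>' ''visited'' = visited \<and> (\<forall>v<n. rarr \<sigma>' ''y'' v = rarr \<sigma> ''y'' v) \<and>
    queued (n + n) tgt (\<lambda>f. cst f + rarr \<sigma>' ''y'' (src f)) visited
      {f. f < H \<and> visited (src f) \<noteq> 0} (narr \<sigma>' ''par'') (rarr \<sigma>' ''key'') \<and>
    (\<forall>u<n + n. visited u \<noteq> 0 \<longrightarrow> (narr \<sigma>' ''par'' u = n + n + 3 \<longleftrightarrow> narr \<sigma> ''par'' u = n + n + 3)) \<and>
    t + potential n \<sigma>' \<le> potential n \<sigma> + 5100 * card {f. f < H \<and> (src f = w \<or> src f = n + w)} + 150) \<sigma>"
proof -
  define N where N: "N = n + n"
  define F where "F = {f. f < H \<and> narr \<sigma> ''visited'' (src f) \<noteq> 0}"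
  \<comment> \<open>The copy \<open>n + w\<close> gets the negated potential, so that
    \<open>cst f + y (src f)\<close> is the right key for reversed arcs as well.\<close>
  define y where "y = (rarr \<sigma> ''y'')(n + w := - rarr \<sigma> ''y'' w)"
  define par where "par = narr \<sigma> ''par''"
  let ?val = "\<lambda>f. cst f + y (src f)"
  have hs: "heap_store n \<sigma>" and S: "S \<subseteq> {..<n}"
    and sv: "\<And>v. v < n \<Longrightarrow> (narr \<sigma> ''visited'' v \<noteq> 0 \<longleftrightarrow> v \<in> S) \<and> (narr \<sigma> ''visited'' (n + v) \<noteq> 0 \<longleftrightarrow> v \<in> S)"
    and cnt: "nvar \<sigma> ''cnt'' = card S" and bs: "rarr \<sigma> ''bs'' 0 = (\<Sum>v\<in>S. b v)"
    and yS: "\<And>v. v \<in> S \<Longrightarrow> rarr \<sigma> ''y'' (n + v) = - rarr \<sigma> ''y'' v"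
    using ss unfolding search_store_def by auto
  have finS: "finite S" using S finite_subset by blast
  have nn: "nvar \<sigma> ''n'' = n" and bw: "rarr \<sigma> ''b'' w = b w"
    using gs w unfolding graph_store_def by auto
  have NN: "nvar \<sigma> ''N'' = N" using hs forest_storeD(1)[OF _ N] unfolding heap_store_def by blast
  have vw: "narr \<sigma> ''visited'' w = 0" "narr \<sigma> ''visited'' (n + w) = 0" using sv[OF w(2)] w(3) by auto
  have srcF: "src f \<noteq> w" "src f \<noteq> n + w" if "f \<in> F" for f using that vw by (auto simp: F_def)
  have adj: "\<exists>fs. chain (narr \<sigma> ''nxt'') (narr \<sigma> ''fst'' q) fs \<and> distinct fs \<and> set fs = {f. f < H \<and> src f = q}"
    if "q < n + n" for q
    using gs that unfolding graph_store_def by blast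
  obtain fs1 where fs1: "chain (narr \<sigma> ''nxt'') (narr \<sigma> ''fst'' w) fs1" "distinct fs1" "set fs1 = {f. f < H \<and> src f = w}"
    using adj[of w] w(2) by auto
  obtain fs2 where fs2: "chain (narr \<sigma> ''nxt'') (narr \<sigma> ''fst'' (n + w)) fs2" "distinct fs2" "set fs2 = {f. f < H \<and> src f = n + w}"
    using adj[of "n + w"] w(2) by auto
  define \<sigma>0 where "\<sigma>0 = \<sigma>\<lparr>nvar := (nvar \<sigma>)(''cnt'' := card S + 1),
     narr := (narr \<sigma>)(''visited'' := visited),
     rarr := (rarr \<sigma>)(''bs'' := (rarr \<sigma> ''bs'')(0 := (\<Sum>v\<in>S. b v) + b w), ''y'' := y)\<rparr>"
  define \<sigma>1 where "\<sigma>1 = \<sigma>0\<lparr>nvar := (nvar \<sigma>0)(''q'' := w, ''R'' := N, ''f'' := narr \<sigma> ''fst'' w)\<rparr>"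
  have hs1: "heap_store n \<sigma>1"
    using hs heap_store_cong[of n \<sigma>1 \<sigma>] forest_store_cong[of \<sigma>1 \<sigma> n] by (simp add: \<sigma>1_def \<sigma>0_def)
  \<comment> \<open>No arc scanned so far starts at \<open>w\<close> or \<open>n + w\<close>, so
    writing the potential of \<open>n + w\<close> changes none of their values.\<close>
  have Q1: "queued N tgt ?val visited F par (rarr \<sigma> ''key'')"
    using Q[folded N F_def par_def] by (rule queued_cong) (use srcF in \<open>auto simp: y_def\<close>)
  have st: "\<forall>f<H. narr \<sigma> ''tgt'' f = tgt f \<and> rarr \<sigma> ''cst'' f = cst f"
    using gs unfolding graph_store_def by blast
  have inv1: "scan_inv n H src tgt cst visited y par w F fs1 \<sigma>1"
    unfolding scan_inv_def Let_def N[symmetric]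
    using hs1 Q1 st fs1 w(2) by (simp add: \<sigma>1_def \<sigma>0_def flip: par_def)
  let ?post = "\<lambda>t \<sigma>'. graph_store n H src tgt cst b y0 \<sigma>' \<and> search_store n b (insert w S) \<sigma>' \<and>
    narr \<sigma>' ''visited'' = visited \<and> (\<forall>v<n. rarr \<sigma>' ''y'' v = rarr \<sigma> ''y'' v) \<and>
    queued (n + n) tgt (\<lambda>f. cst f + rarr \<sigma>' ''y'' (src f)) visited
      {f. f < H \<and> visited (src f) \<noteq> 0} (narr \<sigma>' ''par'') (rarr \<sigma>' ''key'') \<and>
    (\<forall>u<n + n. visited u \<noteq> 0 \<longrightarrow> (narr \<sigma>' ''par'' u = n + n + 3 \<longleftrightarrow> narr \<sigma> ''par'' u = n + n + 3)) \<and>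
    t + potential n \<sigma>' \<le> potential n \<sigma> + 5100 * card {f. f < H \<and> (src f = w \<or> src f = n + w)} + 150"
  let ?rest = "NAssign ''q'' (NPlus (NVar ''n'') (NVar ''w'')) ;; NAssign ''R'' (NPlus (NVar ''N'') (NConst 1)) ;;
     NAssign ''f'' (NArr ''fst'' (NVar ''q'')) ;;
     While scan_test scan_body"
  have "wp (While scan_test scan_body ;; ?rest) (\<lambda>t. ?post (50 + t)) \<sigma>1"
    unfolding wp_Seq[of "While scan_test scan_body"]
  proof (rule wp_frame[OF wp_scan[OF inv1 sides]])
    fix t1 \<sigma>2
    assume 2: "scan_inv n H src tgt cst visited y par w (F \<union> set fs1) [] \<sigma>2 \<and>
      t1 + potential n \<sigma>2 \<le> potential n \<sigma>1 + 5100 * length fs1 + 10"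
      and "unmodified (While scan_test scan_body) \<sigma>1 \<sigma>2"
    then have um2: "unmodified scan_body \<sigma>1 \<sigma>2" by (simp add: unmodified_def)
    note um2' = unmodifiedD[OF um2, simplified]
    define \<sigma>3 where "\<sigma>3 = \<sigma>2\<lparr>nvar := (nvar \<sigma>2)(''q'' := n + w, ''R'' := N + 1, ''f'' := narr \<sigma> ''fst'' (n + w))\<rparr>"
    have e2: "nvar \<sigma>2 ''n'' = n" "nvar \<sigma>2 ''w'' = w" "nvar \<sigma>2 ''N'' = N" "narr \<sigma>2 ''fst'' = narr \<sigma> ''fst''"
      "narr \<sigma>2 ''nxt'' = narr \<sigma> ''nxt''"
      using nn w(1) NN by (simp_all add: um2' \<sigma>1_def \<sigma>0_def)
    have hs3: "heap_store n \<sigma>3"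
      using 2 heap_store_cong[of n \<sigma>3 \<sigma>2] forest_store_cong[of \<sigma>3 \<sigma>2 n]
      by (simp add: \<sigma>3_def scan_inv_def Let_def)
    have inv3: "scan_inv n H src tgt cst visited y par (n + w) (F \<union> set fs1) fs2 \<sigma>3"
      using 2 hs3 fs2 e2(5) unfolding scan_inv_def Let_def N[symmetric] by (simp add: \<sigma>3_def)
    have "wp (While scan_test scan_body) (\<lambda>u. ?post (70 + t1 + u)) \<sigma>3"
    proof (rule wp_frame[OF wp_scan[OF inv3 sides]])
      fix t2 \<sigma>4
      assume 4: "scan_inv n H src tgt cst visited y par (n + w) (F \<union> set fs1 \<union> set fs2) [] \<sigma>4 \<and>
        t2 + potential n \<sigma>4 \<le> potential n \<sigma>3 + 5100 * length fs2 + 10"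
        and "unmodified (While scan_test scan_body) \<sigma>3 \<sigma>4"
      then have um4: "unmodified scan_body \<sigma>3 \<sigma>4" by (simp add: unmodified_def)
      note um4' = unmodifiedD[OF um4, simplified]
      have i4: "heap_store n \<sigma>4" "narr \<sigma>4 ''visited'' = visited" "rarr \<sigma>4 ''y'' = y"
        "queued N tgt ?val visited (F \<union> set fs1 \<union> set fs2) (narr \<sigma>4 ''par'') (rarr \<sigma>4 ''key'')"
        "\<forall>u<N. visited u \<noteq> 0 \<longrightarrow> (narr \<sigma>4 ''par'' u = N + 3 \<longleftrightarrow> par u = N + 3)"
        using 4 unfolding scan_inv_def Let_def N[symmetric] by blast+
      have gs4: "graph_store n H src tgt cst b y0 \<sigma>4"
        using gs graph_store_cong[of \<sigma>4 \<sigma>] by (simp add: um4' um2' \<sigma>3_def \<sigma>1_def \<sigma>0_def)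
      have c4: "nvar \<sigma>4 ''cnt'' = card S + 1" "rarr \<sigma>4 ''bs'' 0 = (\<Sum>v\<in>S. b v) + b w"
        by (simp_all add: um4' um2' \<sigma>3_def \<sigma>1_def \<sigma>0_def)
      have ss4: "search_store n b (insert w S) \<sigma>4"
        unfolding search_store_def i4(2,3) c4
      proof (intro conjI)
        show "heap_store n \<sigma>4" by (rule i4(1))
        show "insert w S \<subseteq> {..<n}" using S w by auto
        show "\<forall>v<n. (visited v \<noteq> 0 \<longleftrightarrow> v \<in> insert w S) \<and> (visited (n + v) \<noteq> 0 \<longleftrightarrow> v \<in> insert w S)"
          using sv w(2) by (auto simp: vis)
        show "card S + 1 = card (insert w S)" using finS w(3) by simp
        show "(\<Sum>v\<in>S. b v) + b w = (\<Sum>v\<in>insert w S. b v)" using finS w(3) by simp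
        show "\<forall>v\<in>insert w S. y (n + v) = - y v" using yS S w by (auto simp: y_def)
      qed
      have Feq: "F \<union> set fs1 \<union> set fs2 = {f. f < H \<and> visited (src f) \<noteq> 0}"
        unfolding fs1(3) fs2(3) F_def vis by auto
      \<comment> \<open>Both lists are free of duplicates and have different sources, so the arcs
        charged to \<open>w\<close> are counted once each.\<close>
      have "card {f. f < H \<and> (src f = w \<or> src f = n + w)} = length fs1 + length fs2"
      proof -
        have "{f. f < H \<and> (src f = w \<or> src f = n + w)} = set fs1 \<union> set fs2" unfolding fs1(3) fs2(3) by blast
        moreover have "set fs1 \<inter> set fs2 = {}" unfolding fs1(3) fs2(3) using w(2) by auto
        ultimately show ?thesis
          using card_Un_disjoint[of "set fs1" "set fs2"] distinct_card[OF fs1(2)] distinct_card[OF fs2(2)] by simp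
      qed
      moreover have "potential n \<sigma>3 = potential n \<sigma>2" "potential n \<sigma>1 = potential n \<sigma>"
        by (rule potential_cong; simp add: \<sigma>3_def \<sigma>1_def \<sigma>0_def)+
      ultimately have tt: "70 + t1 + t2 + potential n \<sigma>4
          \<le> potential n \<sigma> + 5100 * card {f. f < H \<and> (src f = w \<or> src f = n + w)} + 150"
        using 2 4 by simp
      have yv: "\<forall>v<n. y v = rarr \<sigma> ''y'' v" by (auto simp: y_def)
      show "?post (70 + t1 + t2) \<sigma>4"
        using gs4 ss4 i4 Feq tt yv unfolding N[symmetric] par_def[symmetric] by simp
    qed
    then show "wp ?rest (\<lambda>u. ?post (50 + (t1 + u))) \<sigma>2"
      unfolding wp_Seq wp_NAssign
      apply (simp add: e2 \<sigma>3_def)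
      apply (erule wp_mono)
      apply simp
      done
  qed
  moreover have vis': "(narr \<sigma> ''visited'')(w := Suc 0, n + w := Suc 0) = visited" using vis by simp
  ultimately show ?thesis
    unfolding visit_def
    apply (simp add: wp_NAssign wp_NArrAssign wp_RArrAssign wp_Seq[of "NAssign _ _"] wp_Seq[of "NArrAssign _ _ _"] wp_Seq[of "RArrAssign _ _ _"])
    apply (simp add: \<sigma>1_def \<sigma>0_def w(1) nn NN bw bs cnt vis' flip: y_def)
    apply (erule wp_mono)
    apply simp
    done
qed

section \<open>The main loop\<close>

definition choose_heap :: com where
  "choose_heap =
     If (BAnd (BNot (RLess (RArr ''bs'' (NConst 0)) RZero))
              (NLess (NConst 0) (NArr ''deg'' (NPlus (NVar ''N'') (NConst 1)))))
       (NAssign ''R'' (NPlus (NVar ''N'') (NConst 1))) (NAssign ''R'' (NVar ''N''))"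

text \<open>Solves the key for the new potential: it is \<open>c + y v - y0 w\<close> in the
  out-heap and \<open>c + y0 w - y v\<close> in the in-heap. The arc behind the key need not be
  stored.\<close>

definition settle :: com where
  "settle =
     If (NLess (NVar ''x'') (NVar ''n''))
       (NAssign ''w'' (NVar ''x'') ;;
        RArrAssign ''y'' (NVar ''w'') (RPlus (RArr ''key'' (NVar ''x'')) (RArr ''y0'' (NVar ''w''))))
       (NAssign ''w'' (NMinus (NVar ''x'') (NVar ''n'')) ;;
        RArrAssign ''y'' (NVar ''w'') (RMinus (RArr ''y0'' (NVar ''w'')) (RArr ''key'' (NVar ''x''))))"

definition main_test :: bexp where
  "main_test = NLess (NVar ''cnt'') (NVar ''n'')"

definition main_body :: com where
  "main_body = choose_heap ;; pop ;;
     If (NLess (NConst 0) (NArr ''visited'' (NVar ''x''))) Skip (settle ;; visit)"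

text \<open>The element need not be a root itself, but the root above it is on the same side, and no
  root is bucketed between operations.\<close>

lemma heap_nonempty:
  assumes hs: "heap_store n \<sigma>" and N: "N = n + n" and u: "u < N" "narr \<sigma> ''par'' u \<noteq> N + 3"
  shows "kids N (narr \<sigma> ''par'') (if u < n then N else N + 1) \<noteq> {}"
proof -
  have fs: "forest_store n \<sigma>" and fh: "fib_heap n {} (narr \<sigma> ''par'') (narr \<sigma> ''mk'') (rarr \<sigma> ''key'')"
    and rp: "kids N (narr \<sigma> ''par'') (N + 2) = {}"
    using hs unfolding heap_store_def N by auto
  obtain z where z: "z < N" "N \<le> narr \<sigma> ''par'' z" "narr \<sigma> ''par'' z \<noteq> N + 3" "z < n \<longleftrightarrow> u < n"
    using fib_heap_root[OF fh N u] by metis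
  have "narr \<sigma> ''par'' z < N + 4" by (rule forest_storeD(4)[OF fs N z(1)])
  then have "narr \<sigma> ''par'' z = N \<or> narr \<sigma> ''par'' z = N + 1 \<or> narr \<sigma> ''par'' z = N + 2" using z by linarith
  moreover have "narr \<sigma> ''par'' z \<noteq> N + 2" using rp z(1) by (auto simp: kids_def)
  ultimately have "narr \<sigma> ''par'' z = (if u < n then N else N + 1)"
    using fib_heapD(7,8)[OF fh N z(1)] z(4) by auto
  then show ?thesis using z(1) by (auto simp: kids_def)
qed

lemma queuedD:
  assumes "queued N tgt val visited F par key" "f \<in> F" "tgt f < N" "visited (tgt f) = 0"
  shows "par (tgt f) \<noteq> N + 3" "key (tgt f) \<le> val f"
  using assms unfolding queued_def by blast+

section \<open>Arc copies, heap keys and the cuts of the procedure\<close>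

locale crossover_instance =
  fixes n m :: nat and G :: "(nat, nat) pre_digraph" and c :: "nat \<Rightarrow> int" and b :: "nat \<Rightarrow> int"
    and x :: "nat \<Rightarrow> real" and y0 s0 :: "nat \<Rightarrow> real" and r :: nat
  assumes verts_eq: "verts G = {..<n}" and arcs_eq: "arcs G = {..<m}"
    and input: "crossover_input G c b x y0 s0" and root: "r \<in> verts G"

sublocale crossover_instance \<subseteq> mcf G c b x
  by (rule crossover_input_mcf[OF input])

context crossover_instance
begin

definition src :: "nat \<Rightarrow> nat" where
  "src f = (if f < m then tail G f else n + head G (f - m))"

definition tgt :: "nat \<Rightarrow> nat" where
  "tgt f = (if f < m then head G f else n + tail G (f - m))"

text \<open>The fixed part of a key, containing \<open>y0\<close> of the target; the potential of
  the source is added when the arc is scanned. For the reversed copy the sign of \<open>y0\<close>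
  changes, and the source contributes its negated potential.\<close>

definition cst :: "nat \<Rightarrow> real" where
  "cst f = (if f < m then real_of_int (c f) - y0 (head G f) else real_of_int (c (f - m)) + y0 (tail G (f - m)))"

definition rb :: "nat \<Rightarrow> real" where
  "rb v = real_of_int (b v)"

lemma ends: "a < m \<Longrightarrow> tail G a < n" "a < m \<Longrightarrow> head G a < n"
  using tail_in_verts head_in_verts verts_eq arcs_eq by auto

lemma sides:
  assumes "f < m + m"
  shows "tgt f < n + n" "tgt f < n \<longleftrightarrow> src f < n"
  using assms ends[of f] ends[of "f - m"] by (auto simp: tgt_def src_def)

abbreviation val :: "(nat \<Rightarrow> real) \<Rightarrow> nat \<Rightarrow> real" where
  "val y f \<equiv> cst f + y (src f)"

abbreviation seen :: "(nat \<Rightarrow> nat) \<Rightarrow> nat set" where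
  "seen visited \<equiv> {f. f < m + m \<and> visited (src f) \<noteq> 0}"

text \<open>\<open>ya\<close> is kept apart from the array because the potentials of the procedure
  are 0 outside \<open>S\<close>, while the array also holds negated potentials from index
  \<open>n\<close> on. Only the values on \<open>S\<close> have to agree.\<close>

definition main_inv :: "nat set \<Rightarrow> store \<Rightarrow> bool" where
  "main_inv S \<sigma> \<longleftrightarrow> graph_store n (m + m) src tgt cst rb y0 \<sigma> \<and> search_store n rb S \<sigma> \<and> S \<noteq> {} \<and>
     queued (n + n) tgt (val (rarr \<sigma> ''y'')) (narr \<sigma> ''visited'') (seen (narr \<sigma> ''visited''))
       (narr \<sigma> ''par'') (rarr \<sigma> ''key'') \<and>
     (\<exists>ya. crossover_reachable G c b y0 r (card S - 1) (S, ya) \<and> (\<forall>v\<in>S. ya v = rarr \<sigma> ''y'' v))"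

lemma main_inv_visited:
  assumes "main_inv S \<sigma>" "v < n"
  shows "narr \<sigma> ''visited'' v \<noteq> 0 \<longleftrightarrow> v \<in> S" "narr \<sigma> ''visited'' (n + v) \<noteq> 0 \<longleftrightarrow> v \<in> S"
  using assms unfolding main_inv_def search_store_def by auto

lemma main_inv_y:
  assumes "main_inv S \<sigma>" "v \<in> S"
  shows "rarr \<sigma> ''y'' (n + v) = - rarr \<sigma> ''y'' v"
  using assms unfolding main_inv_def search_store_def by auto

lemma out_arc_queued:
  assumes inv: "main_inv S \<sigma>" and a: "a \<in> out_cut G S"
  shows "head G a < n" "head G a \<notin> S" "narr \<sigma> ''par'' (head G a) \<noteq> n + n + 3"
    "rarr \<sigma> ''key'' (head G a) \<le> real_of_int (c a) + rarr \<sigma> ''y'' (tail G a) - y0 (head G a)"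
proof -
  have am: "a < m" "tail G a \<in> S" "head G a \<notin> S" using a arcs_eq by (auto simp: out_cut_def)
  then show h: "head G a < n" "head G a \<notin> S" using ends by auto
  have F: "a \<in> seen (narr \<sigma> ''visited'')"
    using am ends(1)[OF am(1)] main_inv_visited(1)[OF inv, of "tail G a"] by (simp add: src_def)
  have T: "tgt a = head G a" "val (rarr \<sigma> ''y'') a = real_of_int (c a) + rarr \<sigma> ''y'' (tail G a) - y0 (head G a)"
    using am by (simp_all add: tgt_def src_def cst_def)
  have V: "narr \<sigma> ''visited'' (head G a) = 0" using h main_inv_visited(1)[OF inv, of "head G a"] by simp
  have Q: "queued (n + n) tgt (val (rarr \<sigma> ''y'')) (narr \<sigma> ''visited'') (seen (narr \<sigma> ''visited''))
       (narr \<sigma> ''par'') (rarr \<sigma> ''key'')"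
    using inv unfolding main_inv_def by blast
  show "narr \<sigma> ''par'' (head G a) \<noteq> n + n + 3"
    "rarr \<sigma> ''key'' (head G a) \<le> real_of_int (c a) + rarr \<sigma> ''y'' (tail G a) - y0 (head G a)"
    using queuedD[OF Q F, unfolded T] h(1) V by simp_all
qed

lemma in_arc_queued:
  assumes inv: "main_inv S \<sigma>" and a: "a \<in> in_cut G S"
  shows "tail G a < n" "tail G a \<notin> S" "narr \<sigma> ''par'' (n + tail G a) \<noteq> n + n + 3"
    "rarr \<sigma> ''key'' (n + tail G a) \<le> real_of_int (c a) + y0 (tail G a) - rarr \<sigma> ''y'' (head G a)"
proof -
  have am: "a < m" "head G a \<in> S" "tail G a \<notin> S" using a arcs_eq by (auto simp: in_cut_def)
  then show h: "tail G a < n" "tail G a \<notin> S" using ends by auto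
  have F: "m + a \<in> seen (narr \<sigma> ''visited'')"
    using am ends(2)[OF am(1)] main_inv_visited(2)[OF inv, of "head G a"] by (simp add: src_def)
  have T: "tgt (m + a) = n + tail G a"
    "val (rarr \<sigma> ''y'') (m + a) = real_of_int (c a) + y0 (tail G a) - rarr \<sigma> ''y'' (head G a)"
    using am main_inv_y[OF inv am(2)] by (simp_all add: tgt_def src_def cst_def)
  have V: "narr \<sigma> ''visited'' (n + tail G a) = 0" using h main_inv_visited(2)[OF inv, of "tail G a"] by simp
  have Q: "queued (n + n) tgt (val (rarr \<sigma> ''y'')) (narr \<sigma> ''visited'') (seen (narr \<sigma> ''visited''))
       (narr \<sigma> ''par'') (rarr \<sigma> ''key'')"
    using inv unfolding main_inv_def by blast
  show "narr \<sigma> ''par'' (n + tail G a) \<noteq> n + n + 3"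
    "rarr \<sigma> ''key'' (n + tail G a) \<le> real_of_int (c a) + y0 (tail G a) - rarr \<sigma> ''y'' (head G a)"
    using queuedD[OF Q F, unfolded T] h(1) V by simp_all
qed

lemma queued_arc:
  assumes inv: "main_inv S \<sigma>" and u: "u < n + n" "narr \<sigma> ''visited'' u = 0" "narr \<sigma> ''par'' u \<noteq> n + n + 3"
  obtains f where "f < m + m" "narr \<sigma> ''visited'' (src f) \<noteq> 0" "tgt f = u" "rarr \<sigma> ''key'' u = val (rarr \<sigma> ''y'') f"
proof -
  have "\<exists>f\<in>seen (narr \<sigma> ''visited''). tgt f = u \<and> rarr \<sigma> ''key'' u = val (rarr \<sigma> ''y'') f"
    using inv u unfolding main_inv_def queued_def by blast
  then show ?thesis using that by blast
qed

text \<open>The extracted key is the value of a scanned arc from \<open>S\<close> to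
  \<open>w\<close>, and every arc of the cut ends in a queued element whose key is at most its
  value. A minimal key thus comes from a minimizing arc.\<close>

lemma settle_out:
  assumes inv: "main_inv S \<sigma>" and w: "w < n" "w \<notin> S" "narr \<sigma> ''par'' w \<noteq> n + n + 3"
    and min: "\<And>z. z < n \<Longrightarrow> narr \<sigma> ''par'' z \<noteq> n + n + 3 \<Longrightarrow> rarr \<sigma> ''key'' w \<le> rarr \<sigma> ''key'' z"
    and cond: "(\<Sum>v\<in>S. b v) < 0 \<or> in_cut G S = {}" and ya: "\<forall>v\<in>S. ya v = rarr \<sigma> ''y'' v"
  shows "crossover_step G c b y0 (S, ya) (insert w S, ya(w := rarr \<sigma> ''key'' w + y0 w))"
proof -
  have "narr \<sigma> ''visited'' w = 0" using main_inv_visited(1)[OF inv w(1)] w(2) by simp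
  then obtain f where f: "f < m + m" "narr \<sigma> ''visited'' (src f) \<noteq> 0" "tgt f = w"
    "rarr \<sigma> ''key'' w = val (rarr \<sigma> ''y'') f"
    using queued_arc[OF inv, of w] w by auto
  \<comment> \<open>Only arcs that are not reversed have a target below \<open>n\<close>.\<close>
  have fm: "f < m" using f(3) w(1) by (cases "f < m") (auto simp: tgt_def)
  then have "src f = tail G f" "tgt f = head G f" "tail G f < n" "cst f = real_of_int (c f) - y0 (head G f)"
    using ends by (auto simp: src_def tgt_def cst_def)
  then have t: "tail G f \<in> S" "head G f = w" "rarr \<sigma> ''key'' w = real_of_int (c f) + ya (tail G f) - y0 w"
    using main_inv_visited(1)[OF inv, of "tail G f"] f ya by auto
  have a: "f \<in> out_cut G S" using t w fm arcs_eq by (simp add: out_cut_def)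
  have "\<forall>a'\<in>out_cut G S. real_of_int (c f) + ya (tail G f) - y0 (head G f)
      \<le> real_of_int (c a') + ya (tail G a') - y0 (head G a')"
  proof
    fix a' assume a': "a' \<in> out_cut G S"
    then have "tail G a' \<in> S" by (simp add: out_cut_def)
    then show "real_of_int (c f) + ya (tail G f) - y0 (head G f)
      \<le> real_of_int (c a') + ya (tail G a') - y0 (head G a')"
      using min[OF out_arc_queued(1,3)[OF inv a']] out_arc_queued(4)[OF inv a'] t ya by simp
  qed
  from crossover_step.out_step[OF cond a this] show ?thesis
    using t by simp
qed

text \<open>As for the out-heap. In addition, the arc behind the key witnesses that the in-cut is
  nonempty, which the choice of the heap did not ensure.\<close>

lemma settle_in:
  assumes inv: "main_inv S \<sigma>" and w: "w < n" "w \<notin> S" "narr \<sigma> ''par'' (n + w) \<noteq> n + n + 3"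
    and min: "\<And>z. z < n \<Longrightarrow> narr \<sigma> ''par'' (n + z) \<noteq> n + n + 3 \<Longrightarrow> rarr \<sigma> ''key'' (n + w) \<le> rarr \<sigma> ''key'' (n + z)"
    and cond: "\<not> (\<Sum>v\<in>S. b v) < 0" and ya: "\<forall>v\<in>S. ya v = rarr \<sigma> ''y'' v"
  shows "crossover_step G c b y0 (S, ya) (insert w S, ya(w := y0 w - rarr \<sigma> ''key'' (n + w)))"
proof -
  have "narr \<sigma> ''visited'' (n + w) = 0" using main_inv_visited(2)[OF inv w(1)] w(2) by simp
  then obtain f where f: "f < m + m" "narr \<sigma> ''visited'' (src f) \<noteq> 0" "tgt f = n + w"
    "rarr \<sigma> ''key'' (n + w) = val (rarr \<sigma> ''y'') f"
    using queued_arc[OF inv, of "n + w"] w by auto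
  have fm: "\<not> f < m" using f(3) ends(2)[of f] by (auto simp: tgt_def)
  define a where "a = f - m"
  have am: "a < m" using f(1) fm by (simp add: a_def)
  have e: "src f = n + head G a" "tail G a = w" "head G a < n" "cst f = real_of_int (c a) + y0 (tail G a)"
    using ends(2)[OF am] f(3) fm by (auto simp: src_def tgt_def cst_def a_def)
  then have h: "head G a \<in> S" using main_inv_visited(2)[OF inv e(3)] f(2) by simp
  then have t: "rarr \<sigma> ''key'' (n + w) = real_of_int (c a) + y0 w - ya (head G a)"
    using f(4) e main_inv_y[OF inv h] ya by simp
  have a: "a \<in> in_cut G S" using e h w am arcs_eq by (simp add: in_cut_def)
  have "\<forall>a'\<in>in_cut G S. real_of_int (c a) + y0 (tail G a) - ya (head G a)
      \<le> real_of_int (c a') + y0 (tail G a') - ya (head G a')"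
  proof
    fix a' assume a': "a' \<in> in_cut G S"
    then have "head G a' \<in> S" by (simp add: in_cut_def)
    then show "real_of_int (c a) + y0 (tail G a) - ya (head G a)
      \<le> real_of_int (c a') + y0 (tail G a') - ya (head G a')"
      using min[OF in_arc_queued(1,3)[OF inv a']] in_arc_queued(4)[OF inv a'] t e ya by simp
  qed
  moreover have "\<not> ((\<Sum>v\<in>S. b v) < 0 \<or> in_cut G S = {})" using cond a by auto
  ultimately have "crossover_step G c b y0 (S, ya) (insert (tail G a) S, ya(tail G a := ya (head G a) - real_of_int (c a)))"
    using crossover_step.in_step[OF _ a] by blast
  then show ?thesis
    using t e by simp
qed

text \<open>Besides the heap potential, this holds prepaid budgets: 5100 for each arc copy whose
  source is unvisited, and the cost of one extraction and its iteration for each element that is not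
  yet both visited and outside the heaps.\<close>

definition main_pot :: "nat \<Rightarrow> store \<Rightarrow> nat" where
  "main_pot K \<sigma> = potential n \<sigma> + 5100 * card {f. f < m + m \<and> narr \<sigma> ''visited'' (src f) = 0}
     + (10000 * (K + 1) + 500) * card {u. u < n + n \<and> \<not> (narr \<sigma> ''visited'' u \<noteq> 0 \<and> narr \<sigma> ''par'' u = n + n + 3)}"

text \<open>For \<open>R = N + 1\<close> only the sign of \<open>b(S)\<close> is claimed, since
  stale elements may fill the in-heap over an empty in-cut.\<close>

lemma choose_heap_correct:
  assumes inv: "main_inv S \<sigma>" and lt: "nvar \<sigma> ''cnt'' < n" and N: "N = n + n"
  obtains R where "R = N \<or> R = N + 1" "kids N (narr \<sigma> ''par'') R \<noteq> {}"
    "R = N \<Longrightarrow> (\<Sum>v\<in>S. b v) < 0 \<or> in_cut G S = {}" "R = N + 1 \<Longrightarrow> \<not> (\<Sum>v\<in>S. b v) < 0"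
    "wp choose_heap (\<lambda>t \<sigma>'. t \<le> 20 \<and> \<sigma>' = \<sigma>\<lparr>nvar := (nvar \<sigma>)(''R'' := R)\<rparr>) \<sigma>"
proof -
  have hs: "heap_store n \<sigma>" and S: "S \<subseteq> {..<n}" "nvar \<sigma> ''cnt'' = card S" "S \<noteq> {}" "rarr \<sigma> ''bs'' 0 = (\<Sum>v\<in>S. rb v)"
    using inv unfolding main_inv_def search_store_def by auto
  have fs: "forest_store n \<sigma>" using hs unfolding heap_store_def by blast
  note NN = forest_storeD(1)[OF fs N]
  have bs: "rarr \<sigma> ''bs'' 0 < 0 \<longleftrightarrow> (\<Sum>v\<in>S. b v) < 0"
    using S(4) by (simp add: rb_def flip: of_int_sum)
  have deg: "narr \<sigma> ''deg'' (N + 1) = card (kids N (narr \<sigma> ''par'') (N + 1))"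
    by (rule forest_storeD(3)[OF fs N]) simp
  have "S \<noteq> {..<n}" using S(2) lt by auto
  then have proper: "S \<subset> verts G" using S(1) unfolding verts_eq by blast
  show ?thesis
  proof (cases "\<not> (\<Sum>v\<in>S. b v) < 0 \<and> kids N (narr \<sigma> ''par'') (N + 1) \<noteq> {}")
    case True
    then have "0 < card (kids N (narr \<sigma> ''par'') (N + 1))" by (simp add: card_gt_0_iff)
    then have "wp choose_heap (\<lambda>t \<sigma>'. t \<le> 20 \<and> \<sigma>' = \<sigma>\<lparr>nvar := (nvar \<sigma>)(''R'' := N + 1)\<rparr>) \<sigma>"
      using True bs deg NN by (simp add: choose_heap_def wp_simps)
    then show ?thesis by (intro that[of "N + 1"]) (use True in simp_all)
  next
    case False
    \<comment> \<open>An empty in-heap does certify an empty in-cut, as each entering arc has the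
      copy of its tail queued there.\<close>
    have cond: "(\<Sum>v\<in>S. b v) < 0 \<or> in_cut G S = {}"
    proof (rule ccontr)
      assume *: "\<not> ((\<Sum>v\<in>S. b v) < 0 \<or> in_cut G S = {})"
      then obtain a where "a \<in> in_cut G S" by blast
      then have "kids N (narr \<sigma> ''par'') (N + 1) \<noteq> {}"
        using heap_nonempty[OF hs N, of "n + tail G a"] in_arc_queued[OF inv, of a] by (simp add: N)
      then show False using * False by blast
    qed
    obtain a where "a \<in> out_cut G S" using out_cut_nonempty[OF proper S(3) cond] by blast
    then have ne: "kids N (narr \<sigma> ''par'') N \<noteq> {}"
      using heap_nonempty[OF hs N, of "head G a"] out_arc_queued[OF inv, of a] by (simp add: N)
    have "\<not> (\<not> rarr \<sigma> ''bs'' 0 < 0 \<and> 0 < narr \<sigma> ''deg'' (N + 1))"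
      using False bs deg by auto
    then have "wp choose_heap (\<lambda>t \<sigma>'. t \<le> 20 \<and> \<sigma>' = \<sigma>\<lparr>nvar := (nvar \<sigma>)(''R'' := N)\<rparr>) \<sigma>"
      using NN by (auto simp: choose_heap_def wp_simps)
    then show ?thesis by (intro that[of N]) (use ne cond in simp_all)
  qed
qed

text \<open>Every iteration uses up the budget of one extraction, whether the extracted element is
  stale or its node joins \<open>S\<close>. This bounds the number of iterations although
  \<open>S\<close> need not grow in each of them.\<close>

lemma wp_main_body:
  assumes inv: "main_inv S \<sigma>" and test: "bval main_test \<sigma>" and K: "n + n < 2 ^ Suc K"
  shows "wp main_body (\<lambda>t \<sigma>'. (\<exists>S. main_inv S \<sigma>') \<and>
    1 + bcost main_test + t + main_pot K \<sigma>' \<le> main_pot K \<sigma>) \<sigma>"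
proof -
  define N where N: "N = n + n"
  define par where "par = narr \<sigma> ''par''"
  define key where "key = rarr \<sigma> ''key''"
  define vis where "vis = narr \<sigma> ''visited''"
  define y where "y = rarr \<sigma> ''y''"
  have gs: "graph_store n (m + m) src tgt cst rb y0 \<sigma>" and ss: "search_store n rb S \<sigma>" and S0: "S \<noteq> {}"
    and Q: "queued N tgt (val y) vis (seen vis) par key"
    using inv unfolding main_inv_def N par_def key_def vis_def y_def by blast+
  obtain ya where ya: "crossover_reachable G c b y0 r (card S - 1) (S, ya)" "\<forall>v\<in>S. ya v = y v"
    using inv unfolding main_inv_def y_def by blast
  have nn: "nvar \<sigma> ''n'' = n" and gy0: "\<And>v. v < n \<Longrightarrow> rarr \<sigma> ''y0'' v = y0 v"
    using gs unfolding graph_store_def by auto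
  have hs: "heap_store n \<sigma>" and Sn: "S \<subseteq> {..<n}" using ss unfolding search_store_def by auto
  have finS: "finite S" using Sn finite_subset by blast
  have visS: "\<And>v. v < n \<Longrightarrow> (vis v \<noteq> 0 \<longleftrightarrow> v \<in> S) \<and> (vis (n + v) \<noteq> 0 \<longleftrightarrow> v \<in> S)"
    using main_inv_visited[OF inv] unfolding vis_def by blast
  have lt: "nvar \<sigma> ''cnt'' < n" using test nn by (simp add: main_test_def)
  obtain R where R: "R = N \<or> R = N + 1" "kids N par R \<noteq> {}"
    "R = N \<Longrightarrow> (\<Sum>v\<in>S. b v) < 0 \<or> in_cut G S = {}" "R = N + 1 \<Longrightarrow> \<not> (\<Sum>v\<in>S. b v) < 0"
    and ch: "wp choose_heap (\<lambda>t \<sigma>'. t \<le> 20 \<and> \<sigma>' = \<sigma>\<lparr>nvar := (nvar \<sigma>)(''R'' := R)\<rparr>) \<sigma>"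
    using choose_heap_correct[OF inv lt N] unfolding par_def by blast
  define \<sigma>1 where "\<sigma>1 = \<sigma>\<lparr>nvar := (nvar \<sigma>)(''R'' := R)\<rparr>"
  have hs1: "heap_store n \<sigma>1"
    using hs heap_store_cong[of n \<sigma>1 \<sigma>] forest_store_cong[of \<sigma>1 \<sigma> n] by (simp add: \<sigma>1_def)
  have pot1: "potential n \<sigma>1 = potential n \<sigma>" by (rule potential_cong) (simp_all add: \<sigma>1_def)
  define live where "live \<equiv> \<lambda>vis par. {u. u < N \<and> \<not> (vis u \<noteq> (0::nat) \<and> par u = N + 3)}"
  have finl: "finite (live v p)" for v p by (simp add: live_def)
  have mp: "main_pot K \<sigma>' = potential n \<sigma>' + 5100 * card {f. f < m + m \<and> narr \<sigma>' ''visited'' (src f) = 0}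
     + (10000 * (K + 1) + 500) * card (live (narr \<sigma>' ''visited'') (narr \<sigma>' ''par''))" for \<sigma>'
    unfolding main_pot_def live_def N by simp
  let ?post = "\<lambda>t \<sigma>'. (\<exists>S. main_inv S \<sigma>') \<and> t + main_pot K \<sigma>' \<le> main_pot K \<sigma>"
  let ?rest = "If (NLess (NConst 0) (NArr ''visited'' (NVar ''x''))) Skip (settle ;; visit)"
  have "wp pop (\<lambda>t. wp ?rest (\<lambda>u. ?post (50 + (t + u)))) \<sigma>1"
  proof (rule wp_mono[OF wp_pop[OF hs1 N _ R(1) _ K[folded N]]])
    show "nvar \<sigma>1 ''R'' = R" by (simp add: \<sigma>1_def)
    show "kids N (narr \<sigma>1 ''par'') R \<noteq> {}" using R(2) by (simp add: \<sigma>1_def par_def)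
    fix t \<sigma>2
    assume A: "heap_store n \<sigma>2 \<and> nvar \<sigma>2 ''x'' < N \<and> narr \<sigma>1 ''par'' (nvar \<sigma>2 ''x'') \<noteq> N + 3 \<and>
     (nvar \<sigma>2 ''x'' < n \<longleftrightarrow> R = N) \<and>
     (\<forall>z<N. narr \<sigma>1 ''par'' z \<noteq> N + 3 \<longrightarrow> (z < n \<longleftrightarrow> R = N) \<longrightarrow> rarr \<sigma>1 ''key'' (nvar \<sigma>2 ''x'') \<le> rarr \<sigma>1 ''key'' z) \<and>
     (\<forall>z<N. narr \<sigma>2 ''par'' z = N + 3 \<longleftrightarrow> narr \<sigma>1 ''par'' z = N + 3 \<or> z = nvar \<sigma>2 ''x'') \<and>
     t + potential n \<sigma>2 \<le> potential n \<sigma>1 + 10000 * (K + 1) \<and> unmodified pop \<sigma>1 \<sigma>2"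
    define e where "e = nvar \<sigma>2 ''x''"
    define par2 where "par2 = narr \<sigma>2 ''par''"
    have par1: "narr \<sigma>1 ''par'' = par" "rarr \<sigma>1 ''key'' = key" by (simp_all add: \<sigma>1_def par_def key_def)
    note A' = A[unfolded par1 pot1, folded e_def par2_def]
    have hs2: "heap_store n \<sigma>2" and e: "e < N" "par e \<noteq> N + 3" "e < n \<longleftrightarrow> R = N"
      and min: "\<And>z. z < N \<Longrightarrow> par z \<noteq> N + 3 \<Longrightarrow> (z < n \<longleftrightarrow> R = N) \<Longrightarrow> key e \<le> key z"
      and tr: "\<And>z. z < N \<Longrightarrow> par2 z = N + 3 \<longleftrightarrow> par z = N + 3 \<or> z = e"
      and t: "t + potential n \<sigma>2 \<le> potential n \<sigma> + 10000 * (K + 1)" and um: "unmodified pop \<sigma>1 \<sigma>2"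
      using A' by blast+
    note um' = unmodifiedD[OF um, simplified]
    have e2: "narr \<sigma>2 ''visited'' = vis" "rarr \<sigma>2 ''key'' = key" "rarr \<sigma>2 ''y'' = y" "rarr \<sigma>2 ''bs'' = rarr \<sigma> ''bs''"
      "nvar \<sigma>2 ''cnt'' = nvar \<sigma> ''cnt''" "nvar \<sigma>2 ''n'' = n" "rarr \<sigma>2 ''y0'' = rarr \<sigma> ''y0''"
      using nn by (simp_all add: um' \<sigma>1_def vis_def key_def y_def)
    have gs2: "graph_store n (m + m) src tgt cst rb y0 \<sigma>2"
      using gs graph_store_cong[of \<sigma>2 \<sigma>] by (simp add: um' \<sigma>1_def)
    have ss2: "search_store n rb S \<sigma>2"
      using ss search_store_cong[of n \<sigma>2 \<sigma>] hs hs2 by (simp add: e2 vis_def y_def)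
    have el: "e \<in> live vis par" using e by (simp add: live_def)
    show "wp ?rest (\<lambda>u. ?post (50 + (t + u))) \<sigma>2"
    proof (cases "vis e = 0")
      case False
      have "queued N tgt (val y) vis (seen vis) par2 key"
        by (rule queued_cong[OF Q]) (use tr False in auto)
      then have inv2: "main_inv S \<sigma>2"
        unfolding main_inv_def e2 N[symmetric] par2_def[symmetric] using gs2 ss2 S0 ya by blast
      have "live vis par2 \<subseteq> live vis par - {e}" using tr False by (auto simp: live_def)
      then have "card (live vis par2) \<le> card (live vis par - {e})" by (rule card_mono[rotated]) (simp add: finl)
      then have lc: "card (live vis par2) + 1 \<le> card (live vis par)"
        using card_Suc_Diff1[OF finl el] by simp
      have "100 + t + main_pot K \<sigma>2 \<le> main_pot K \<sigma>"
      proof -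
        have "(10000 * (K + 1) + 500) * (card (live vis par2) + 1) \<le> (10000 * (K + 1) + 500) * card (live vis par)"
          using lc by (rule mult_le_mono2)
        then show ?thesis
          unfolding mp e2 par2_def[symmetric] vis_def[symmetric] par_def[symmetric] using t
          by (simp only: add_mult_distrib2) simp
      qed
      then show ?thesis
        using inv2 False by (auto simp: wp_simps e2 simp flip: e_def)
    next
      case True
      define w where "w = (if e < n then e else e - n)"
      define yw where "yw = (if e < n then key e + y0 w else y0 w - key e)"
      have w: "w < n" "e = w \<or> e = n + w" using e(1) by (auto simp: w_def N)
      have wS: "w \<notin> S" using visS[OF w(1)] True w(2) by auto
      have vw: "vis w = 0" "vis (n + w) = 0" using visS[OF w(1)] wS by auto
      have step: "crossover_step G c b y0 (S, ya) (insert w S, ya(w := yw))"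
      proof (cases "e < n")
        case True
        then have we: "w = e" "yw = key e + y0 w" by (auto simp: w_def yw_def)
        have RN: "R = N" using e(3) True by simp
        show ?thesis
          using settle_out[OF inv w(1) wS, of ya] R(3)[OF RN] ya(2) e(2) min RN
          unfolding we(2) unfolding we(1) N[symmetric] par_def[symmetric] key_def[symmetric] y_def[symmetric]
          by (simp add: N)
      next
        case False
        then have we: "e = n + w" "yw = y0 w - key e" by (auto simp: w_def yw_def)
        have RN: "R = N + 1" "R \<noteq> N" using e(3) False R(1) by auto
        show ?thesis
          using settle_in[OF inv w(1) wS, of ya] R(4)[OF RN(1)] ya(2) e(2) min RN(2)
          unfolding we N[symmetric] par_def[symmetric] key_def[symmetric] y_def[symmetric]
          by (simp add: N)
      qed
      define \<sigma>3 where "\<sigma>3 = \<sigma>2\<lparr>nvar := (nvar \<sigma>2)(''w'' := w), rarr := (rarr \<sigma>2)(''y'' := y(w := yw))\<rparr>"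
      define vis' where "vis' = vis(w := 1, n + w := 1)"
      have hs3: "heap_store n \<sigma>3"
        using hs2 heap_store_cong[of n \<sigma>3 \<sigma>2] forest_store_cong[of \<sigma>3 \<sigma>2 n] by (simp add: \<sigma>3_def)
      have gs3: "graph_store n (m + m) src tgt cst rb y0 \<sigma>3"
        using gs2 graph_store_cong[of \<sigma>3 \<sigma>2] by (simp add: \<sigma>3_def)
      have ss3: "search_store n rb S \<sigma>3"
      proof -
        have "search_store n rb S \<sigma>3 = search_store n rb S \<sigma>2"
          by (rule search_store_cong) (use hs2 hs3 wS w(1) in \<open>auto simp: \<sigma>3_def e2\<close>)
        then show ?thesis using ss2 by simp
      qed
      have sn: "src f \<noteq> w" "src f \<noteq> n + w" if "f \<in> seen vis" for f using that vw by auto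
      have ev': "e = w \<or> e = n + w" by (rule w(2))
      have Q3: "queued (n + n) tgt (\<lambda>f. cst f + rarr \<sigma>3 ''y'' (src f)) vis'
          {f. f < m + m \<and> narr \<sigma>3 ''visited'' (src f) \<noteq> 0} (narr \<sigma>3 ''par'') (rarr \<sigma>3 ''key'')"
      proof -
        \<comment> \<open>Extracting \<open>e\<close> would break the claim that the queued elements
          are the targets of scanned arcs, but \<open>e\<close> is one of the two copies of
          \<open>w\<close> and counts as visited in \<open>vis'\<close>.\<close>
        have "queued N tgt (val (y(w := yw))) vis' (seen vis) par2 key"
        proof (rule queued_cong[OF Q])
          show "val (y(w := yw)) f = val y f" if "f \<in> seen vis" for f using sn(1)[OF that] by simp
          show "vis u = 0" if "vis' u = 0" for u using that by (auto simp: vis'_def split: if_splits)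
          show "par2 u = N + 3 \<longleftrightarrow> par u = N + 3" if "u < N" "vis' u = 0" for u
            using tr[OF that(1)] that(2) ev' w(1) by (auto simp: vis'_def split: if_splits)
        qed
        then show ?thesis by (simp add: \<sigma>3_def e2 par2_def N)
      qed
      have v3: "vis' = (narr \<sigma>3 ''visited'')(w := 1, n + w := 1)" by (simp add: vis'_def \<sigma>3_def e2)
      have w3: "nvar \<sigma>3 ''w'' = w" by (simp add: \<sigma>3_def)
      have "wp visit (\<lambda>u. ?post (100 + (t + u))) \<sigma>3"
      proof (rule wp_mono[OF wp_visit[OF gs3 ss3 w3 w(1) wS sides v3 Q3]])
        fix u \<sigma>4
        assume B: "graph_store n (m + m) src tgt cst rb y0 \<sigma>4 \<and> search_store n rb (insert w S) \<sigma>4 \<and>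
          narr \<sigma>4 ''visited'' = vis' \<and> (\<forall>v<n. rarr \<sigma>4 ''y'' v = rarr \<sigma>3 ''y'' v) \<and>
          queued (n + n) tgt (\<lambda>f. cst f + rarr \<sigma>4 ''y'' (src f)) vis'
            {f. f < m + m \<and> vis' (src f) \<noteq> 0} (narr \<sigma>4 ''par'') (rarr \<sigma>4 ''key'') \<and>
          (\<forall>u<n + n. vis' u \<noteq> 0 \<longrightarrow> (narr \<sigma>4 ''par'' u = n + n + 3 \<longleftrightarrow> narr \<sigma>3 ''par'' u = n + n + 3)) \<and>
          u + potential n \<sigma>4 \<le> potential n \<sigma>3 + 5100 * card {f. f < m + m \<and> (src f = w \<or> src f = n + w)} + 150"
        have y4: "rarr \<sigma>4 ''y'' v = (y(w := yw)) v" if "v < n" for v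
          using B that by (simp add: \<sigma>3_def)
        have "crossover_reachable G c b y0 r (card (insert w S) - 1) (insert w S, ya(w := yw))"
        proof -
          have "0 < card S" using S0 finS by (simp add: card_gt_0_iff)
          then have "card (insert w S) - 1 = Suc (card S - 1)" using finS wS by simp
          then show ?thesis using ya(1) step unfolding crossover_reachable_def by auto
        qed
        moreover have "\<forall>v\<in>insert w S. (ya(w := yw)) v = rarr \<sigma>4 ''y'' v"
        proof
          fix v assume v: "v \<in> insert w S"
          then have "v < n" using Sn w(1) by auto
          then show "(ya(w := yw)) v = rarr \<sigma>4 ''y'' v" using y4 v ya(2) by auto
        qed
        ultimately have inv4: "main_inv (insert w S) \<sigma>4"
          using B unfolding main_inv_def by auto
        \<comment> \<open>The arcs scanned now are exactly those whose source ceases to be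
          unvisited, so their budget is released.\<close>
        have arcs: "card {f. f < m + m \<and> vis' (src f) = 0} + card {f. f < m + m \<and> (src f = w \<or> src f = n + w)}
            = card {f. f < m + m \<and> vis (src f) = 0}"
        proof -
          have "{f. f < m + m \<and> vis (src f) = 0}
              = {f. f < m + m \<and> vis' (src f) = 0} \<union> {f. f < m + m \<and> (src f = w \<or> src f = n + w)}"
            using vw by (auto simp: vis'_def)
          moreover have "{f. f < m + m \<and> vis' (src f) = 0} \<inter> {f. f < m + m \<and> (src f = w \<or> src f = n + w)} = {}"
            by (auto simp: vis'_def)
          ultimately show ?thesis by (simp add: card_Un_disjoint)
        qed
        define par4 where "par4 = narr \<sigma>4 ''par''"
        have p4: "par4 u = N + 3 \<longleftrightarrow> par2 u = N + 3" if "u < N" "vis' u \<noteq> 0" for u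
          using B that by (simp add: par4_def par2_def \<sigma>3_def N)
        \<comment> \<open>\<open>e\<close> is extracted and visited, hence spent for good. Elements
          spent earlier remain so, because scanning moves no visited element into or out of a
          heap.\<close>
        have "live vis' par4 \<subseteq> live vis par - {e}"
        proof
          fix u assume "u \<in> live vis' par4"
          then have u: "u < N" "vis' u = 0 \<or> par4 u \<noteq> N + 3" by (auto simp: live_def)
          have "vis' e \<noteq> 0" using ev' by (auto simp: vis'_def)
          then have "u \<noteq> e" using u p4[of e] tr[OF e(1)] e(1) by auto
          moreover have "\<not> (vis u \<noteq> 0 \<and> par u = N + 3)"
          proof
            assume h: "vis u \<noteq> 0 \<and> par u = N + 3"
            then have "vis' u \<noteq> 0" by (auto simp: vis'_def)
            then show False using u p4[OF u(1)] tr[OF u(1)] h by auto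
          qed
          ultimately show "u \<in> live vis par - {e}" using u(1) by (simp add: live_def)
        qed
        then have "card (live vis' par4) \<le> card (live vis par - {e})" by (rule card_mono[rotated]) (simp add: finl)
        then have lc: "card (live vis' par4) + 1 \<le> card (live vis par)"
          using card_Suc_Diff1[OF finl el] by simp
        have pot3: "potential n \<sigma>3 = potential n \<sigma>2" by (rule potential_cong) (simp_all add: \<sigma>3_def)
        have "100 + (t + u) + main_pot K \<sigma>4 \<le> main_pot K \<sigma>"
        proof -
          have "(10000 * (K + 1) + 500) * (card (live vis' par4) + 1) \<le> (10000 * (K + 1) + 500) * card (live vis par)"
            using lc by (rule mult_le_mono2)
          then have l: "(10000 * (K + 1) + 500) * card (live vis' par4) + (10000 * (K + 1) + 500)
              \<le> (10000 * (K + 1) + 500) * card (live vis par)"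
            by (simp only: add_mult_distrib2 mult_1_right)
          have v4: "narr \<sigma>4 ''visited'' = vis'" using B by blast
          have "u + potential n \<sigma>4 \<le> potential n \<sigma>3 + 5100 * card {f. f < m + m \<and> (src f = w \<or> src f = n + w)} + 150"
            using B by blast
          then show ?thesis
            unfolding mp v4 par4_def[symmetric] vis_def[symmetric] par_def[symmetric] using t l pot3 arcs
            by linarith
        qed
        then show "?post (100 + (t + u)) \<sigma>4" using inv4 by blast
      qed
      moreover have "wp settle (\<lambda>t \<sigma>'. t \<le> 20 \<and> \<sigma>' = \<sigma>3) \<sigma>2"
        using e2 gy0[OF w(1)] w(1)
        by (simp add: settle_def wp_simps \<sigma>3_def yw_def w_def flip: e_def) auto
      ultimately have "wp settle (\<lambda>t1. wp visit (\<lambda>u. ?post (70 + (t + (t1 + u))))) \<sigma>2"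
        apply -
        apply (erule wp_mono)
        apply (elim conjE)
        apply simp
        apply (erule wp_mono[of visit])
        apply simp
        done
      then show ?thesis
        using True
        apply (simp add: wp_simps(5,6) e2 flip: e_def)
        apply (erule wp_mono)
        apply (erule wp_mono)
        apply simp
        done
    qed
  qed
  then show ?thesis
    unfolding main_body_def wp_Seq
    apply -
    apply (rule wp_mono[OF ch])
    apply (elim conjE)
    apply (simp add: \<sigma>1_def main_test_def)
    apply (erule wp_mono)
    apply (erule wp_mono)
    apply simp
    done
qed

end

section \<open>Initialization\<close>

definition base_body :: com where
  "base_body =
     NArrAssign ''base'' (NVar ''i'') (NVar ''acc'') ;;
     NAssign ''acc'' (NPlus (NVar ''acc'') (NVar ''M'')) ;;
     NAssign ''i'' (NPlus (NVar ''i'') (NConst 1))"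

definition init_base :: com where
  "init_base =
     NAssign ''N'' (NPlus (NVar ''n'') (NVar ''n'')) ;;
     NAssign ''M'' (NPlus (NVar ''N'') (NConst 4)) ;;
     NAssign ''i'' (NConst 0) ;; NAssign ''acc'' (NConst 0) ;;
     While (NLess (NVar ''i'') (NVar ''M'')) base_body"

text \<open>All elements start in the list of \<open>N + 3\<close>, so both heaps are empty and the
  potential starts at 0.\<close>

definition forest_body :: com where
  "forest_body =
     NArrAssign ''ch'' (NPlus (NArr ''base'' (NPlus (NVar ''N'') (NConst 3))) (NVar ''i'')) (NVar ''i'') ;;
     NArrAssign ''pos'' (NVar ''i'') (NVar ''i'') ;;
     NArrAssign ''par'' (NVar ''i'') (NPlus (NVar ''N'') (NConst 3)) ;;
     NAssign ''i'' (NPlus (NVar ''i'') (NConst 1))"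

definition init_forest :: com where
  "init_forest =
     NArrAssign ''deg'' (NPlus (NVar ''N'') (NConst 3)) (NVar ''N'') ;;
     NAssign ''i'' (NConst 0) ;;
     While (NLess (NVar ''i'') (NVar ''N'')) forest_body"

definition arcs_body :: com where
  "arcs_body =
     NArrAssign ''tgt'' (NVar ''i'') (NArr ''head'' (NVar ''i'')) ;;
     RArrAssign ''cst'' (NVar ''i'') (RMinus (RArr ''c'' (NVar ''i'')) (RArr ''y0'' (NArr ''head'' (NVar ''i'')))) ;;
     NArrAssign ''nxt'' (NVar ''i'') (NArr ''fst'' (NArr ''tail'' (NVar ''i''))) ;;
     NArrAssign ''fst'' (NArr ''tail'' (NVar ''i'')) (NPlus (NVar ''i'') (NConst 1)) ;;
     NAssign ''j'' (NPlus (NVar ''m'') (NVar ''i'')) ;;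
     NArrAssign ''tgt'' (NVar ''j'') (NPlus (NVar ''n'') (NArr ''tail'' (NVar ''i''))) ;;
     RArrAssign ''cst'' (NVar ''j'') (RPlus (RArr ''c'' (NVar ''i'')) (RArr ''y0'' (NArr ''tail'' (NVar ''i'')))) ;;
     NAssign ''q'' (NPlus (NVar ''n'') (NArr ''head'' (NVar ''i''))) ;;
     NArrAssign ''nxt'' (NVar ''j'') (NArr ''fst'' (NVar ''q'')) ;;
     NArrAssign ''fst'' (NVar ''q'') (NPlus (NVar ''j'') (NConst 1)) ;;
     NAssign ''i'' (NPlus (NVar ''i'') (NConst 1))"

definition init_arcs :: com where
  "init_arcs = NAssign ''i'' (NConst 0) ;; While (NLess (NVar ''i'') (NVar ''m'')) arcs_body"

text \<open>The root is handled by the same \<open>visit\<close> as all other nodes, with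
  \<open>S\<close> empty; its potential 0 is the initial content of \<open>y\<close>.\<close>

definition crossover_program :: com where
  "crossover_program = init_base ;; init_forest ;; init_arcs ;;
     NAssign ''w'' (NVar ''r'') ;; visit ;; While main_test main_body"

lemma init_mods [simp]:
  "nvar_mods init_base = {''N'', ''M'', ''i'', ''acc''}" "narr_mods init_base = {''base''}" "rarr_mods init_base = {}"
  "nvar_mods init_forest = {''i''}" "narr_mods init_forest = {''ch'', ''pos'', ''par'', ''deg''}" "rarr_mods init_forest = {}"
  "nvar_mods init_arcs = {''i'', ''j'', ''q''}" "narr_mods init_arcs = {''tgt'', ''nxt'', ''fst''}" "rarr_mods init_arcs = {''cst''}"
  by (auto simp: init_base_def base_body_def init_forest_def forest_body_def init_arcs_def arcs_body_def)

lemma wp_init_base: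
  assumes n: "nvar \<sigma> ''n'' = n" and N: "N = n + n"
  shows "wp init_base (\<lambda>t \<sigma>'. nvar \<sigma>' ''N'' = N \<and> (\<forall>p<N + 4. narr \<sigma>' ''base'' p = p * (N + 4)) \<and>
    t \<le> 20 * (N + 4) + 20 \<and> unmodified init_base \<sigma> \<sigma>') \<sigma>"
proof -
  define I where "I \<sigma> \<longleftrightarrow> nvar \<sigma> ''N'' = N \<and> nvar \<sigma> ''M'' = N + 4 \<and> nvar \<sigma> ''i'' \<le> N + 4 \<and>
    nvar \<sigma> ''acc'' = nvar \<sigma> ''i'' * (N + 4) \<and> (\<forall>p<nvar \<sigma> ''i''. narr \<sigma> ''base'' p = p * (N + 4))" for \<sigma> :: store
  define \<Phi> where "\<Phi> \<sigma> = 20 * (N + 4 - nvar \<sigma> ''i'')" for \<sigma> :: store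
  define \<sigma>1 where "\<sigma>1 = \<sigma>\<lparr>nvar := (nvar \<sigma>)(''N'' := N, ''M'' := N + 4, ''i'' := 0, ''acc'' := 0)\<rparr>"
  have body: "wp base_body (\<lambda>t \<sigma>'. I \<sigma>' \<and> 1 + bcost (NLess (NVar ''i'') (NVar ''M'')) + t + \<Phi> \<sigma>' \<le> \<Phi> \<sigma>) \<sigma>"
    if "I \<sigma>" "bval (NLess (NVar ''i'') (NVar ''M'')) \<sigma>" for \<sigma>
    using that by (simp add: base_body_def wp_simps I_def \<Phi>_def less_Suc_eq)
  have "I \<sigma>1" by (simp add: I_def \<sigma>1_def)
  from wp_While[where \<Phi>=\<Phi>, OF body this]
  have "wp (While (NLess (NVar ''i'') (NVar ''M'')) base_body) (\<lambda>t \<sigma>'. nvar \<sigma>' ''N'' = N \<and>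
      (\<forall>p<N + 4. narr \<sigma>' ''base'' p = p * (N + 4)) \<and> 12 + t \<le> 20 * (N + 4) + 20) \<sigma>1"
    by (rule wp_mono) (auto simp: I_def \<Phi>_def \<sigma>1_def)
  then have "wp init_base (\<lambda>t \<sigma>'. nvar \<sigma>' ''N'' = N \<and> (\<forall>p<N + 4. narr \<sigma>' ''base'' p = p * (N + 4)) \<and>
    t \<le> 20 * (N + 4) + 20) \<sigma>"
    unfolding init_base_def
    by (simp add: wp_simps n \<sigma>1_def flip: N)
  then show ?thesis by (rule wp_frame) blast
qed

lemma fib_heap_empty:
  assumes "\<And>x. x < n + n \<Longrightarrow> par x = n + n + 3"
  shows "fib_heap n {} par (\<lambda>_. 0) key"
proof -
  have "kids (n + n) par p = {}" if "p < n + n" for p using assms that by (auto simp: kids_def)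
  then have "card {c \<in> kids (n + n) par p - {}. card (kids (n + n) par c) + 0 < j} \<le> j" if "p < n + n" for p j
    using that by simp
  then show ?thesis by (intro fib_heapI[OF refl]) (use assms in auto)
qed

lemma wp_init_forest:
  assumes nN: "nvar \<sigma> ''N'' = N" and N: "N = n + n" and base: "\<forall>p<N + 4. narr \<sigma> ''base'' p = p * (N + 4)"
    and zero: "narr \<sigma> ''deg'' = (\<lambda>_. 0)" "narr \<sigma> ''mk'' = (\<lambda>_. 0)" "narr \<sigma> ''B'' = (\<lambda>_. 0)"
  shows "wp init_forest (\<lambda>t \<sigma>'. heap_store n \<sigma>' \<and> (\<forall>x<N. narr \<sigma>' ''par'' x = N + 3) \<and> potential n \<sigma>' = 0 \<and>
    t \<le> 30 * N + 20 \<and> unmodified init_forest \<sigma> \<sigma>') \<sigma>"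
proof -
  define I where "I \<sigma>' \<longleftrightarrow> nvar \<sigma>' ''N'' = N \<and> (\<forall>p<N + 4. narr \<sigma>' ''base'' p = p * (N + 4)) \<and>
    narr \<sigma>' ''deg'' = (\<lambda>_. 0)(N + 3 := N) \<and> narr \<sigma>' ''mk'' = (\<lambda>_. 0) \<and> narr \<sigma>' ''B'' = (\<lambda>_. 0) \<and> nvar \<sigma>' ''i'' \<le> N \<and>
    (\<forall>k<nvar \<sigma>' ''i''. narr \<sigma>' ''ch'' ((N + 3) * (N + 4) + k) = k \<and> narr \<sigma>' ''pos'' k = k \<and> narr \<sigma>' ''par'' k = N + 3)" for \<sigma>' :: store
  define \<Phi> where "\<Phi> \<sigma> = 30 * (N - nvar \<sigma> ''i'')" for \<sigma> :: store
  define \<sigma>1 where "\<sigma>1 = \<sigma>\<lparr>nvar := (nvar \<sigma>)(''i'' := 0), narr := (narr \<sigma>)(''deg'' := (\<lambda>_. 0)(N + 3 := N))\<rparr>"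
  have body: "wp forest_body (\<lambda>t \<sigma>'. I \<sigma>' \<and> 1 + bcost (NLess (NVar ''i'') (NVar ''N'')) + t + \<Phi> \<sigma>' \<le> \<Phi> \<sigma>) \<sigma>"
    if "I \<sigma>" "bval (NLess (NVar ''i'') (NVar ''N'')) \<sigma>" for \<sigma>
    using that by (simp add: forest_body_def wp_simps I_def \<Phi>_def less_Suc_eq)
  have "I \<sigma>1" using nN base zero by (simp add: I_def \<sigma>1_def)
  from wp_While[where \<Phi>=\<Phi>, OF body this]
  have "wp (While (NLess (NVar ''i'') (NVar ''N'')) forest_body) (\<lambda>t \<sigma>'. heap_store n \<sigma>' \<and>
      (\<forall>x<N. narr \<sigma>' ''par'' x = N + 3) \<and> potential n \<sigma>' = 0 \<and> 15 + t \<le> 30 * N + 20) \<sigma>1"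
  proof (rule wp_mono)
    fix t \<sigma>'
    assume A: "I \<sigma>' \<and> \<not> bval (NLess (NVar ''i'') (NVar ''N'')) \<sigma>' \<and>
      t + \<Phi> \<sigma>' \<le> \<Phi> \<sigma>1 + 1 + bcost (NLess (NVar ''i'') (NVar ''N''))"
    then have i: "nvar \<sigma>' ''i'' = N" by (auto simp: I_def)
    have J: "nvar \<sigma>' ''N'' = N" "\<forall>p<N + 4. narr \<sigma>' ''base'' p = p * (N + 4)"
      "narr \<sigma>' ''deg'' = (\<lambda>_. 0)(N + 3 := N)" "narr \<sigma>' ''mk'' = (\<lambda>_. 0)" "narr \<sigma>' ''B'' = (\<lambda>_. 0)"
      "\<And>k. k < N \<Longrightarrow> narr \<sigma>' ''ch'' ((N + 3) * (N + 4) + k) = k \<and> narr \<sigma>' ''pos'' k = k \<and> narr \<sigma>' ''par'' k = N + 3"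
      using A i unfolding I_def by auto
    have cl: "child_lists N (narr \<sigma>' ''par'') (narr \<sigma>' ''ch'') (narr \<sigma>' ''pos'') (narr \<sigma>' ''deg'')"
      unfolding child_lists_def J(3)
    proof (intro conjI allI impI, goal_cases)
      case (1 x) then show ?case using J(6) by simp
    next
      case (2 x) then show ?case using J(6) by simp
    next
      case (3 x) then show ?case using J(6) by simp
    next
      case (4 p i) then show ?case using J(6) by (auto split: if_splits)
    next
      case (5 p i) then show ?case using J(6) by (auto split: if_splits)
    next
      case (6 p i) then show ?case using J(6) by (auto split: if_splits)
    qed
    have kids: "kids N (narr \<sigma>' ''par'') p = {}" if "p \<noteq> N + 3" for p using J(6) that by (auto simp: kids_def)
    have "marked N (narr \<sigma>' ''par'') (\<lambda>_. 0) = {}" by (simp add: marked_def)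
    then have "potential n \<sigma>' = 0"
      unfolding potential_def Let_def N[symmetric] J(4) using kids[of N] kids[of "N + 1"] kids[of "N + 2"] by simp
    moreover have "heap_store n \<sigma>'"
      unfolding heap_store_def forest_store_def N[symmetric] J(4,5)
      using J(1,2) cl fib_heap_empty[of n "narr \<sigma>' ''par''"] J(6) kids[of "N + 2"] by (simp add: N)
    ultimately show "heap_store n \<sigma>' \<and>
      (\<forall>x<N. narr \<sigma>' ''par'' x = N + 3) \<and> potential n \<sigma>' = 0 \<and> 15 + t \<le> 30 * N + 20"
      using J(6) A by (simp add: \<Phi>_def \<sigma>1_def)
  qed
  then have "wp init_forest (\<lambda>t \<sigma>'. heap_store n \<sigma>' \<and> (\<forall>x<N. narr \<sigma>' ''par'' x = N + 3) \<and> potential n \<sigma>' = 0 \<and>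
    t \<le> 30 * N + 20) \<sigma>"
    unfolding init_forest_def
    apply (simp add: wp_simps nN zero(1) \<sigma>1_def)
    apply (erule wp_mono)
    apply simp
    done
  then show ?thesis by (rule wp_frame) blast
qed

section \<open>Linked adjacency lists\<close>

definition adjacency :: "nat \<Rightarrow> (nat \<Rightarrow> nat) \<Rightarrow> nat set \<Rightarrow> (nat \<Rightarrow> nat) \<Rightarrow> (nat \<Rightarrow> nat) \<Rightarrow> bool" where
  "adjacency N src A nxt first \<longleftrightarrow>
     (\<forall>q<N. \<exists>fs. chain nxt (first q) fs \<and> distinct fs \<and> set fs = {f. f \<in> A \<and> src f = q})"

lemma chain_upd: "k \<notin> set fs \<Longrightarrow> chain (nxt(k := p)) q fs = chain nxt q fs"
  by (induction fs arbitrary: q) auto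

text \<open>Pushing to the front writes only the link of \<open>k\<close>, which occurs in no
  existing list, and the entry pointer of the list of \<open>s\<close>.\<close>

lemma adjacency_push:
  assumes adj: "adjacency N src A nxt first" and k: "k \<notin> A" and s: "s = src k"
  shows "adjacency N src (insert k A) (nxt(k := first s)) (first(s := Suc k))"
  unfolding adjacency_def
proof (intro allI impI)
  fix q assume "q < N"
  then obtain fs where fs: "chain nxt (first q) fs" "distinct fs" "set fs = {f. f \<in> A \<and> src f = q}"
    using adj unfolding adjacency_def by blast
  have kfs: "k \<notin> set fs" using fs(3) k by simp
  show "\<exists>fs. chain (nxt(k := first s)) ((first(s := Suc k)) q) fs \<and> distinct fs \<and> set fs = {f. f \<in> insert k A \<and> src f = q}"
  proof (cases "q = s")
    case True
    have "set (k # fs) = {f. f \<in> insert k A \<and> src f = q}" using fs(3) True s by auto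
    then show ?thesis
      using fs kfs True chain_upd[OF kfs, of nxt "first s" "first s"] by (intro exI[of _ "k # fs"]) simp
  next
    case False
    have "set fs = {f. f \<in> insert k A \<and> src f = q}" using fs(3) False s by auto
    then show ?thesis
      using fs(1,2) False chain_upd[OF kfs, of nxt "first s" "first q"] by (intro exI[of _ fs]) simp
  qed
qed

context crossover_instance
begin

definition arcs_inv :: "store \<Rightarrow> bool" where
  "arcs_inv \<sigma> \<longleftrightarrow> nvar \<sigma> ''n'' = n \<and> nvar \<sigma> ''m'' = m \<and> nvar \<sigma> ''i'' \<le> m \<and>
     (\<forall>a<m. narr \<sigma> ''tail'' a = tail G a \<and> narr \<sigma> ''head'' a = head G a \<and> rarr \<sigma> ''c'' a = real_of_int (c a)) \<and>
     (\<forall>v<n. rarr \<sigma> ''y0'' v = y0 v) \<and>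
     (\<forall>a<nvar \<sigma> ''i''. narr \<sigma> ''tgt'' a = tgt a \<and> narr \<sigma> ''tgt'' (m + a) = tgt (m + a) \<and>
        rarr \<sigma> ''cst'' a = cst a \<and> rarr \<sigma> ''cst'' (m + a) = cst (m + a)) \<and>
     adjacency (n + n) src {f. f < nvar \<sigma> ''i'' \<or> m \<le> f \<and> f < m + nvar \<sigma> ''i''} (narr \<sigma> ''nxt'') (narr \<sigma> ''fst'')"

lemma wp_arcs_body:
  assumes inv: "arcs_inv \<sigma>" and test: "nvar \<sigma> ''i'' < m"
  shows "wp arcs_body (\<lambda>t \<sigma>'. arcs_inv \<sigma>' \<and> 1 + bcost (NLess (NVar ''i'') (NVar ''m'')) + t + 100 * (m - nvar \<sigma>' ''i'')
    \<le> 100 * (m - nvar \<sigma> ''i'')) \<sigma>"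
proof -
  define i where "i = nvar \<sigma> ''i''"
  define A where "A k = {f. f < k \<or> m \<le> f \<and> f < m + k}" for k
  have im: "i < m" using test by (simp add: i_def)
  have I: "nvar \<sigma> ''n'' = n" "nvar \<sigma> ''m'' = m" "narr \<sigma> ''tail'' i = tail G i" "narr \<sigma> ''head'' i = head G i"
    "rarr \<sigma> ''c'' i = real_of_int (c i)" "rarr \<sigma> ''y0'' (head G i) = y0 (head G i)" "rarr \<sigma> ''y0'' (tail G i) = y0 (tail G i)"
    and rest: "\<forall>a<m. narr \<sigma> ''tail'' a = tail G a \<and> narr \<sigma> ''head'' a = head G a \<and> rarr \<sigma> ''c'' a = real_of_int (c a)"
     "\<forall>v<n. rarr \<sigma> ''y0'' v = y0 v"
     "\<forall>a<i. narr \<sigma> ''tgt'' a = tgt a \<and> narr \<sigma> ''tgt'' (m + a) = tgt (m + a) \<and>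
        rarr \<sigma> ''cst'' a = cst a \<and> rarr \<sigma> ''cst'' (m + a) = cst (m + a)"
    and adj: "adjacency (n + n) src (A i) (narr \<sigma> ''nxt'') (narr \<sigma> ''fst'')"
    using inv ends[OF im] im unfolding arcs_inv_def A_def i_def by auto
  have s: "src i = tail G i" "src (m + i) = n + head G i" "tgt i = head G i" "tgt (m + i) = n + tail G i"
    "cst i = real_of_int (c i) - y0 (head G i)" "cst (m + i) = real_of_int (c i) + y0 (tail G i)"
    using im by (simp_all add: src_def tgt_def cst_def)
  define nxt1 where "nxt1 = (narr \<sigma> ''nxt'')(i := narr \<sigma> ''fst'' (tail G i))"
  define fst1 where "fst1 = (narr \<sigma> ''fst'')(tail G i := Suc i)"
  define nxt2 where "nxt2 = nxt1(m + i := fst1 (n + head G i))"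
  define fst2 where "fst2 = fst1(n + head G i := Suc (m + i))"
  have adj1: "adjacency (n + n) src (insert i (A i)) nxt1 fst1"
    unfolding nxt1_def fst1_def by (rule adjacency_push[OF adj]) (use im s in \<open>auto simp: A_def\<close>)
  have "adjacency (n + n) src (insert (m + i) (insert i (A i))) nxt2 fst2"
    unfolding nxt2_def fst2_def by (rule adjacency_push[OF adj1]) (use im s in \<open>auto simp: A_def\<close>)
  moreover have "insert (m + i) (insert i (A i)) = A (Suc i)" using im by (auto simp: A_def)
  ultimately have adj2: "adjacency (n + n) src (A (Suc i)) nxt2 fst2" by simp
  define tgt2 where "tgt2 = (narr \<sigma> ''tgt'')(i := head G i, m + i := n + tail G i)"
  define cst2 where "cst2 = (rarr \<sigma> ''cst'')(i := real_of_int (c i) - y0 (head G i), m + i := real_of_int (c i) + y0 (tail G i))"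
  have vals: "\<forall>a<Suc i. tgt2 a = tgt a \<and> tgt2 (m + a) = tgt (m + a) \<and> cst2 a = cst a \<and> cst2 (m + a) = cst (m + a)"
    using rest(3) s im by (auto simp: tgt2_def cst2_def less_Suc_eq)
  define \<sigma>2 where "\<sigma>2 = \<sigma>\<lparr>nvar := (nvar \<sigma>)(''j'' := m + i, ''q'' := n + head G i, ''i'' := Suc i),
     narr := (narr \<sigma>)(''tgt'' := tgt2, ''nxt'' := nxt2, ''fst'' := fst2), rarr := (rarr \<sigma>)(''cst'' := cst2)\<rparr>"
  have inv2: "arcs_inv \<sigma>2"
    using rest(1,2) I(1,2) vals adj2 im unfolding arcs_inv_def A_def by (simp add: \<sigma>2_def)
  have "wp arcs_body (\<lambda>t \<sigma>'. t \<le> 90 \<and> \<sigma>' = \<sigma>2) \<sigma>"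
    using I im
    by (simp add: arcs_body_def wp_simps \<sigma>2_def tgt2_def cst2_def nxt2_def fst2_def nxt1_def fst1_def
        fun_upd_twist flip: i_def)
  then show ?thesis
    by (rule wp_mono) (use inv2 im in \<open>auto simp: \<sigma>2_def i_def\<close>)
qed

lemma wp_init_arcs:
  assumes "nvar \<sigma> ''n'' = n" "nvar \<sigma> ''m'' = m"
    "\<forall>a<m. narr \<sigma> ''tail'' a = tail G a \<and> narr \<sigma> ''head'' a = head G a \<and> rarr \<sigma> ''c'' a = real_of_int (c a)"
    "\<forall>v<n. rarr \<sigma> ''y0'' v = y0 v \<and> rarr \<sigma> ''b'' v = rb v" "narr \<sigma> ''fst'' = (\<lambda>_. 0)"
  shows "wp init_arcs (\<lambda>t \<sigma>'. graph_store n (m + m) src tgt cst rb y0 \<sigma>' \<and> t \<le> 100 * m + 20 \<and>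
    unmodified init_arcs \<sigma> \<sigma>') \<sigma>"
proof -
  define \<sigma>1 where "\<sigma>1 = \<sigma>\<lparr>nvar := (nvar \<sigma>)(''i'' := 0)\<rparr>"
  let ?W = "While (NLess (NVar ''i'') (NVar ''m'')) arcs_body"
  \<comment> \<open>The set is empty; this is the form that simplification gives to the set of
    inserted arcs at \<open>i = 0\<close>.\<close>
  have "adjacency (n + n) src {f. m \<le> f \<and> f < m} (narr \<sigma> ''nxt'') (\<lambda>_. 0)" by (auto simp: adjacency_def intro!: exI[of _ "[]"])
  then have "arcs_inv \<sigma>1" using assms by (simp add: arcs_inv_def \<sigma>1_def)
  have body: "wp arcs_body (\<lambda>t \<sigma>'. arcs_inv \<sigma>' \<and> 1 + bcost (NLess (NVar ''i'') (NVar ''m'')) + t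
      + 100 * (m - nvar \<sigma>' ''i'') \<le> 100 * (m - nvar \<sigma>2 ''i'')) \<sigma>2"
    if "arcs_inv \<sigma>2" "bval (NLess (NVar ''i'') (NVar ''m'')) \<sigma>2" for \<sigma>2
    using wp_arcs_body[OF that(1)] that by (simp add: arcs_inv_def)
  from wp_While[where \<Phi>="\<lambda>\<sigma>. 100 * (m - nvar \<sigma> ''i'')", OF body \<open>arcs_inv \<sigma>1\<close>]
  have "wp ?W (\<lambda>t \<sigma>'. graph_store n (m + m) src tgt cst rb y0 \<sigma>' \<and> 2 + t \<le> 100 * m + 20) \<sigma>1"
  proof (rule wp_frame)
    fix t \<sigma>'
    assume A: "arcs_inv \<sigma>' \<and> \<not> bval (NLess (NVar ''i'') (NVar ''m'')) \<sigma>' \<and>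
      t + 100 * (m - nvar \<sigma>' ''i'') \<le> 100 * (m - nvar \<sigma>1 ''i'') + 1 + bcost (NLess (NVar ''i'') (NVar ''m''))"
      and um: "unmodified ?W \<sigma>1 \<sigma>'"
    have i: "nvar \<sigma>' ''i'' = m" using A by (auto simp: arcs_inv_def)
    have b: "\<forall>v<n. rarr \<sigma>' ''b'' v = rb v"
      using unmodifiedD(3)[OF um, of "''b''"] assms(4) by (simp add: arcs_body_def \<sigma>1_def)
    have J: "nvar \<sigma>' ''n'' = n" "\<forall>v<n. rarr \<sigma>' ''y0'' v = y0 v"
      "\<forall>a<m. narr \<sigma>' ''tgt'' a = tgt a \<and> narr \<sigma>' ''tgt'' (m + a) = tgt (m + a) \<and>
        rarr \<sigma>' ''cst'' a = cst a \<and> rarr \<sigma>' ''cst'' (m + a) = cst (m + a)"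
      "adjacency (n + n) src {f. f < m \<or> m \<le> f \<and> f < m + m} (narr \<sigma>' ''nxt'') (narr \<sigma>' ''fst'')"
      using A unfolding arcs_inv_def i by blast+
    have "narr \<sigma>' ''tgt'' f = tgt f \<and> rarr \<sigma>' ''cst'' f = cst f" if "f < m + m" for f
      using J(3)[rule_format, of f] J(3)[rule_format, of "f - m"] that by (cases "f < m") simp_all
    moreover have "{f. f < m \<or> m \<le> f \<and> f < m + m} = {f. f < m + m}" by auto
    ultimately have "graph_store n (m + m) src tgt cst rb y0 \<sigma>'"
      unfolding graph_store_def using J(1,2) b J(4) unfolding adjacency_def by simp
    then show "graph_store n (m + m) src tgt cst rb y0 \<sigma>' \<and> 2 + t \<le> 100 * m + 20"
      using A by (simp add: \<sigma>1_def)
  qed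
  then have "wp init_arcs (\<lambda>t \<sigma>'. graph_store n (m + m) src tgt cst rb y0 \<sigma>' \<and> t \<le> 100 * m + 20) \<sigma>"
    by (simp add: init_arcs_def wp_simps \<sigma>1_def)
  then show ?thesis by (rule wp_frame) blast
qed

section \<open>Total running time\<close>

lemma wp_crossover_program:
  assumes K: "n + n < 2 ^ Suc K"
  shows "wp crossover_program (\<lambda>t \<sigma>. t \<le> 30000 * (m + n * (K + 1) + 1) \<and>
    (\<exists>y. crossover_output G c b y0 r y \<and> (\<forall>v\<in>verts G. rarr \<sigma> ''y'' v = y v))) (input_store n m G c b x y0 s0 r)"
    (is "wp _ ?post ?\<sigma>0")
proof -
  define N where N: "N = n + n"
  have rn: "r < n" using root verts_eq by simp
  have in0: "nvar ?\<sigma>0 ''n'' = n" "nvar ?\<sigma>0 ''m'' = m" "nvar ?\<sigma>0 ''r'' = r" "nvar ?\<sigma>0 ''cnt'' = 0"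
    "narr ?\<sigma>0 ''deg'' = (\<lambda>_. 0)" "narr ?\<sigma>0 ''mk'' = (\<lambda>_. 0)" "narr ?\<sigma>0 ''B'' = (\<lambda>_. 0)" "narr ?\<sigma>0 ''fst'' = (\<lambda>_. 0)"
    "narr ?\<sigma>0 ''visited'' = (\<lambda>_. 0)" "rarr ?\<sigma>0 ''bs'' = (\<lambda>_. 0)" "rarr ?\<sigma>0 ''y'' = (\<lambda>_. 0)"
    by (simp_all add: input_store_def)
  have arr0: "\<forall>a<m. narr ?\<sigma>0 ''tail'' a = tail G a \<and> narr ?\<sigma>0 ''head'' a = head G a \<and> rarr ?\<sigma>0 ''c'' a = real_of_int (c a)"
    "\<forall>v<n. rarr ?\<sigma>0 ''y0'' v = y0 v \<and> rarr ?\<sigma>0 ''b'' v = rb v"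
    by (simp_all add: input_store_def input_array_def rb_def)
  show ?thesis
    unfolding crossover_program_def wp_Seq[of init_base]
  proof (rule wp_mono[OF wp_init_base[OF in0(1) N]])
    fix t1 \<sigma>1
    assume A1: "nvar \<sigma>1 ''N'' = N \<and> (\<forall>p<N + 4. narr \<sigma>1 ''base'' p = p * (N + 4)) \<and>
      t1 \<le> 20 * (N + 4) + 20 \<and> unmodified init_base ?\<sigma>0 \<sigma>1"
    then have um1: "unmodified init_base ?\<sigma>0 \<sigma>1" by blast
    note um1' = unmodifiedD[OF um1, simplified]
    have z1: "narr \<sigma>1 ''deg'' = (\<lambda>_. 0)" "narr \<sigma>1 ''mk'' = (\<lambda>_. 0)" "narr \<sigma>1 ''B'' = (\<lambda>_. 0)"
      using in0 by (simp_all add: um1')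
    show "wp (init_forest ;; init_arcs ;; NAssign ''w'' (NVar ''r'') ;; visit ;; While main_test main_body)
      (\<lambda>u. ?post (t1 + u)) \<sigma>1"
      unfolding wp_Seq[of init_forest]
    proof (rule wp_mono[OF wp_init_forest[OF _ N _ z1]])
      show "nvar \<sigma>1 ''N'' = N" "\<forall>p<N + 4. narr \<sigma>1 ''base'' p = p * (N + 4)" using A1 by auto
      fix t2 \<sigma>2
      assume A2: "heap_store n \<sigma>2 \<and> (\<forall>x<N. narr \<sigma>2 ''par'' x = N + 3) \<and> potential n \<sigma>2 = 0 \<and>
        t2 \<le> 30 * N + 20 \<and> unmodified init_forest \<sigma>1 \<sigma>2"
      then have um2: "unmodified init_forest \<sigma>1 \<sigma>2" by blast
      note um2' = unmodifiedD[OF um2, simplified]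
      have i2: "nvar \<sigma>2 ''n'' = n" "nvar \<sigma>2 ''m'' = m" "narr \<sigma>2 ''fst'' = (\<lambda>_. 0)"
        using in0 by (simp_all add: um1' um2')
      have a2: "\<forall>a<m. narr \<sigma>2 ''tail'' a = tail G a \<and> narr \<sigma>2 ''head'' a = head G a \<and> rarr \<sigma>2 ''c'' a = real_of_int (c a)"
        "\<forall>v<n. rarr \<sigma>2 ''y0'' v = y0 v \<and> rarr \<sigma>2 ''b'' v = rb v"
        using arr0 by (simp_all add: um1' um2')
      show "wp (init_arcs ;; NAssign ''w'' (NVar ''r'') ;; visit ;; While main_test main_body)
        (\<lambda>u. ?post (t1 + (t2 + u))) \<sigma>2"
        unfolding wp_Seq[of init_arcs]
      proof (rule wp_mono[OF wp_init_arcs[OF i2(1,2) a2 i2(3)]])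
        fix t3 \<sigma>3
        assume A3: "graph_store n (m + m) src tgt cst rb y0 \<sigma>3 \<and> t3 \<le> 100 * m + 20 \<and> unmodified init_arcs \<sigma>2 \<sigma>3"
        then have um3: "unmodified init_arcs \<sigma>2 \<sigma>3" by blast
        note um3' = unmodifiedD[OF um3, simplified]
        define \<sigma>4 where "\<sigma>4 = \<sigma>3\<lparr>nvar := (nvar \<sigma>3)(''w'' := r)\<rparr>"
        have i4: "nvar \<sigma>3 ''r'' = r" "nvar \<sigma>4 ''cnt'' = 0" "narr \<sigma>4 ''visited'' = (\<lambda>_. 0)" "rarr \<sigma>4 ''bs'' = (\<lambda>_. 0)"
          "rarr \<sigma>4 ''y'' = (\<lambda>_. 0)" "nvar \<sigma>4 ''w'' = r"
          using in0 by (simp_all add: um1' um2' um3' \<sigma>4_def)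
        have gs4: "graph_store n (m + m) src tgt cst rb y0 \<sigma>4"
          using A3 graph_store_cong[of \<sigma>4 \<sigma>3] by (simp add: \<sigma>4_def)
        have hs4: "heap_store n \<sigma>4"
          using A2 heap_store_cong[of n \<sigma>4 \<sigma>2] forest_store_cong[of \<sigma>4 \<sigma>2 n] by (simp add: um3' \<sigma>4_def)
        have pot4: "potential n \<sigma>4 = 0"
          using A2 potential_cong[of \<sigma>4 \<sigma>2 n] by (simp add: um3' \<sigma>4_def)
        have par4: "\<forall>x<N. narr \<sigma>4 ''par'' x = N + 3"
          using A2 by (simp add: um3' \<sigma>4_def)
        have ss4: "search_store n rb {} \<sigma>4"
          using hs4 i4 by (simp add: search_store_def)
        define vis where "vis = (narr \<sigma>4 ''visited'')(r := 1, n + r := 1)"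
        have Q4: "queued (n + n) tgt (\<lambda>f. cst f + rarr \<sigma>4 ''y'' (src f)) vis
            {f. f < m + m \<and> narr \<sigma>4 ''visited'' (src f) \<noteq> 0} (narr \<sigma>4 ''par'') (rarr \<sigma>4 ''key'')"
          using par4 by (simp add: queued_def i4 N)
        have "wp (visit ;; While main_test main_body) (\<lambda>u. ?post (t1 + (t2 + (t3 + (2 + u))))) \<sigma>4"
          unfolding wp_Seq[of visit]
        proof (rule wp_mono[OF wp_visit[OF gs4 ss4 i4(6) rn _ sides vis_def Q4]])
          show "r \<notin> {}" by simp
          fix t5 \<sigma>5
          assume A5: "graph_store n (m + m) src tgt cst rb y0 \<sigma>5 \<and> search_store n rb {r} \<sigma>5 \<and>
            narr \<sigma>5 ''visited'' = vis \<and> (\<forall>v<n. rarr \<sigma>5 ''y'' v = rarr \<sigma>4 ''y'' v) \<and>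
            queued (n + n) tgt (\<lambda>f. cst f + rarr \<sigma>5 ''y'' (src f)) vis
              {f. f < m + m \<and> vis (src f) \<noteq> 0} (narr \<sigma>5 ''par'') (rarr \<sigma>5 ''key'') \<and>
            (\<forall>u<n + n. vis u \<noteq> 0 \<longrightarrow> (narr \<sigma>5 ''par'' u = n + n + 3 \<longleftrightarrow> narr \<sigma>4 ''par'' u = n + n + 3)) \<and>
            t5 + potential n \<sigma>5 \<le> potential n \<sigma>4 + 5100 * card {f. f < m + m \<and> (src f = r \<or> src f = n + r)} + 150"
          have "crossover_reachable G c b y0 r (card {r} - 1) ({r}, \<lambda>_. 0)"
            by (simp add: crossover_reachable_def)
          moreover have "\<forall>v\<in>{r}. 0 = rarr \<sigma>5 ''y'' v" using A5 rn i4(5) by simp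
          ultimately have inv5: "\<exists>S. main_inv S \<sigma>5"
            using A5 unfolding main_inv_def by (intro exI[of _ "{r}"]) auto
          have card_le: "card {f. f < m + m \<and> P f} \<le> m + m" for P
            using card_mono[of "{..<m + m}" "{f. f < m + m \<and> P f}"] by auto
          have "card {u. u < n + n \<and> P u} \<le> n + n" for P
            using card_mono[of "{..<n + n}" "{u. u < n + n \<and> P u}"] by auto
          then have live: "(10000 * (K + 1) + 500) * card {u. u < n + n \<and> \<not> (narr \<sigma>5 ''visited'' u \<noteq> 0 \<and> narr \<sigma>5 ''par'' u = n + n + 3)}
              \<le> (10000 * (K + 1) + 500) * (n + n)"
            by (rule mult_le_mono2)
          have time: "t5 + potential n \<sigma>5 \<le> 5100 * card {f. f < m + m \<and> (src f = r \<or> src f = n + r)} + 150"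
            using A5 pot4 by simp
          \<comment> \<open>Stated for arbitrary numbers, to keep the cardinalities out of the
            linear arithmetic. \<open>k1\<close> stands for the arcs of the root and
            \<open>k2\<close> for those not yet scanned, each bounded by all arc copies.\<close>
          have sum_le: "t5 + (p + 5100 * k2 + u) \<le> 150 + 5100 * (m + m) + 5100 * (m + m) + v"
            if "u \<le> v" "t5 + p \<le> 5100 * k1 + 150" "k1 \<le> m + m" "k2 \<le> m + m" for p k1 k2 u v :: nat
            using that by simp
          have pot5: "t5 + main_pot K \<sigma>5 \<le> 150 + 5100 * (m + m) + 5100 * (m + m) + (10000 * (K + 1) + 500) * (n + n)"
            unfolding main_pot_def by (rule sum_le[OF live time card_le card_le])
          have body: "wp main_body (\<lambda>t \<sigma>'. (\<exists>S. main_inv S \<sigma>') \<and>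
              1 + bcost main_test + t + main_pot K \<sigma>' \<le> main_pot K \<sigma>) \<sigma>"
            if "\<exists>S. main_inv S \<sigma>" "bval main_test \<sigma>" for \<sigma>
            using wp_main_body[OF _ that(2) K] that(1) by blast
          show "wp (While main_test main_body) (\<lambda>u. ?post (t1 + (t2 + (t3 + (2 + (t5 + u)))))) \<sigma>5"
          proof (rule wp_mono[OF wp_While[where \<Phi>="main_pot K", OF body inv5]])
            fix t6 \<sigma>6
            assume A6: "(\<exists>S. main_inv S \<sigma>6) \<and> \<not> bval main_test \<sigma>6 \<and>
              t6 + main_pot K \<sigma>6 \<le> main_pot K \<sigma>5 + 1 + bcost main_test"
            then obtain S where S: "main_inv S \<sigma>6" by blast
            then have S': "S \<subseteq> {..<n}" "nvar \<sigma>6 ''cnt'' = card S" "nvar \<sigma>6 ''n'' = n"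
              unfolding main_inv_def search_store_def graph_store_def by blast+
            have "n \<le> card S" using A6 S' by (simp add: main_test_def)
            then have Sn: "S = {..<n}" using S'(1) by (intro card_seteq) auto
            obtain ya where "crossover_reachable G c b y0 r (card S - 1) (S, ya)" "\<forall>v\<in>S. ya v = rarr \<sigma>6 ''y'' v"
              using S unfolding main_inv_def by blast
            then have out: "\<exists>y. crossover_output G c b y0 r y \<and> (\<forall>v\<in>verts G. rarr \<sigma>6 ''y'' v = y v)"
              unfolding crossover_output_def verts_eq Sn by (intro exI[of _ ya]) auto
            \<comment> \<open>Naming the product makes the final estimate linear in
              \<open>m\<close>, \<open>n\<close> and \<open>z\<close>.\<close>
            define z where "z = n * (K + 1)"
            have "n \<le> z" by (simp add: z_def)
            moreover have "(10000 * (K + 1) + 500) * (n + n) = 20000 * z + 1000 * n"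
              by (simp add: z_def algebra_simps)
            then have "t5 + main_pot K \<sigma>5 \<le> 150 + 20400 * m + 20000 * z + 1000 * n" using pot5 by simp
            moreover have "t6 \<le> main_pot K \<sigma>5 + 4" using A6 by (simp add: main_test_def)
            moreover have "t1 \<le> 40 * n + 100" "t2 \<le> 60 * n + 20" "t3 \<le> 100 * m + 20"
              using A1 A2 A3 N by auto
            ultimately have "t1 + (t2 + (t3 + (2 + (t5 + t6)))) \<le> 30000 * (m + z + 1)"
              by simp
            then have "t1 + (t2 + (t3 + (2 + (t5 + t6)))) \<le> 30000 * (m + n * (K + 1) + 1)"
              unfolding z_def .
            then show "?post (t1 + (t2 + (t3 + (2 + (t5 + t6))))) \<sigma>6" using out by blast
          qed
        qed
        then show "wp (NAssign ''w'' (NVar ''r'') ;; visit ;; While main_test main_body)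
          (\<lambda>u. ?post (t1 + (t2 + (t3 + u)))) \<sigma>3"
          unfolding wp_Seq[of "NAssign ''w'' (NVar ''r'')"] wp_NAssign using i4(1) by (simp add: \<sigma>4_def)
      qed
    qed
  qed
qed

text \<open>The constant is \<open>3 * 30000\<close>, because \<open>n * (K + 1)\<close> is at most
  \<open>3 * n * log 2 n + 2\<close>. The 2 is needed for \<open>n = 1\<close>, where the logarithm
  vanishes, and goes into the additive 1 of the bound.\<close>

lemma crossover_program_time:
  "\<exists>t \<sigma> y. runs crossover_program (input_store n m G c b x y0 s0 r) t \<sigma> \<and>
     real t \<le> 90000 * (real m + real n * log 2 (real n) + 1) \<and>
     crossover_output G c b y0 r y \<and> (\<forall>v\<in>verts G. rarr \<sigma> ''y'' v = y v)"
proof -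
  have n: "1 \<le> n" using root verts_eq by auto
  \<comment> \<open>Rounding \<open>log 2 (2 * n)\<close> down gives an exponent with
    \<open>2 * n < 2 ^ Suc K\<close>, which the degree bound requires for a forest of
    \<open>2 * n\<close> elements, and with \<open>K \<le> 1 + log 2 n\<close>.\<close>
  define K where "K = nat \<lfloor>log 2 (real (n + n))\<rfloor>"
  have log: "log 2 (real (n + n)) = 1 + log 2 (real n)"
  proof -
    have "log 2 (real (n + n)) = log 2 (2 * real n)" by simp
    also have "\<dots> = log 2 2 + log 2 (real n)" using n by (subst log_mult) auto
    finally show ?thesis by simp
  qed
  have l0: "0 \<le> log 2 (real n)" using n by simp
  have K: "real K \<le> 1 + log 2 (real n)" "1 + log 2 (real n) < real K + 1"
    using l0 log unfolding K_def by linarith+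
  have "n + n < 2 ^ Suc K"
  proof -
    have "real (n + n) = 2 powr (log 2 (real (n + n)))" using n by simp
    also have "\<dots> < 2 powr (real (Suc K))" using K log by (intro powr_less_mono) auto
    also have "\<dots> = real (2 ^ Suc K)" by (subst powr_realpow) auto
    finally show ?thesis by linarith
  qed
  from wp_crossover_program[OF this] obtain t \<sigma> y where run: "runs crossover_program (input_store n m G c b x y0 s0 r) t \<sigma>"
    and t: "t \<le> 30000 * (m + n * (K + 1) + 1)"
    and y: "crossover_output G c b y0 r y" "\<forall>v\<in>verts G. rarr \<sigma> ''y'' v = y v"
    unfolding wp_def by blast
  have "real n * (real K + 1) \<le> real n * (2 + log 2 (real n))"
    using K by (intro mult_left_mono) auto
  also have "\<dots> \<le> 3 * (real n * log 2 (real n)) + 2"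
  proof (cases "n = 1")
    case False
    then have "2 \<le> n" using n by simp
    then have "log 2 2 \<le> log 2 (real n)" by (subst log_le_cancel_iff) auto
    then have "1 \<le> log 2 (real n)" by simp
    then have "real n * 1 \<le> real n * log 2 (real n)" by (intro mult_left_mono) auto
    then show ?thesis by (simp add: algebra_simps)
  qed simp
  finally have nK: "real n * (real K + 1) \<le> 3 * (real n * log 2 (real n)) + 2" .
  have "real t \<le> real (30000 * (m + n * (K + 1) + 1))" using t by (rule of_nat_mono)
  also have "\<dots> = 30000 * (real m + real n * (real K + 1) + 1)" by (simp add: algebra_simps)
  also have "\<dots> \<le> 90000 * (real m + real n * log 2 (real n) + 1)" using nK by simp
  finally show ?thesis using run y by blast
qed

end

theorem theorem2:
  shows
    "(\<forall>(G :: ('v, 'a) pre_digraph) c b x y0 s0 r.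
        crossover_input G c b x y0 s0 \<and> r \<in> verts G \<longrightarrow>
          (\<forall>k \<sigma>. k < card (verts G) - 1 \<and> crossover_reachable G c b y0 r k \<sigma> \<longrightarrow>
             (\<exists>\<sigma>'. crossover_step G c b y0 \<sigma> \<sigma>')) \<and>
          (\<exists>y. crossover_output G c b y0 r y) \<and>
          (\<forall>y. crossover_output G c b y0 r y \<longrightarrow>
             (\<forall>v\<in>verts G. y v \<in> \<int>) \<and> dual_optimal G c b y (dual_slack G c y)))
     \<and>
     (\<exists>(P :: com) (C :: real). \<forall>n m (G :: (nat, nat) pre_digraph) c b x y0 s0 r.
        verts G = {..<n} \<and> arcs G = {..<m} \<and> crossover_input G c b x y0 s0 \<and> r \<in> verts G \<longrightarrow>
          (\<exists>t \<sigma> y. runs P (input_store n m G c b x y0 s0 r) t \<sigma> \<and>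
             real t \<le> C * (real m + real n * log 2 (real n) + 1) \<and>
             crossover_output G c b y0 r y \<and>
             (\<forall>v\<in>verts G. rarr \<sigma> ''y'' v = y v)))"
proof (rule conjI)
  show "\<exists>(P :: com) (C :: real). \<forall>n m (G :: (nat, nat) pre_digraph) c b x y0 s0 r.
        verts G = {..<n} \<and> arcs G = {..<m} \<and> crossover_input G c b x y0 s0 \<and> r \<in> verts G \<longrightarrow>
          (\<exists>t \<sigma> y. runs P (input_store n m G c b x y0 s0 r) t \<sigma> \<and>
             real t \<le> C * (real m + real n * log 2 (real n) + 1) \<and>
             crossover_output G c b y0 r y \<and>
             (\<forall>v\<in>verts G. rarr \<sigma> ''y'' v = y v))"
    using crossover_instance.crossover_program_time[OF crossover_instance.intro]
    by (intro exI[of _ crossover_program] exI[of _ 90000]) blast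
qed (intro allI impI, rule crossover_correct; blast)

end
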